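(* Let $\Sigma\subset H_1$ be a $p$-minimal surface of type II (respectively, of type III). If $\Sigma$ can be smoothly extended (as a $p$-minimal surface) through the singular curve, then the part on the other side of the singular curve is of type III (respectively, of type II).
   Context: The Heisenberg group $H_1$ is $\mathbb{R}^3$ with the group law $(x_1,y_1,z_1)\circ(x_2,y_2,z_2)=(x_1+x_2,\,y_1+y_2,\,z_1+z_2+y_1x_2-x_1y_2)$. Left invariant fields: $\mathring e_1=\partial_x+y\partial_z$, $\mathring e_2=\partial_y-x\partial_z$, $T=\partial_z$. Contact form $\Theta=dz+x\,dy-y\,dx$, contact bundle $\xi=\ker\Theta$, $J\mathring e_1=\mathring e_2$, $J\mathring e_2=-\mathring e_1$. The adapted metric makes $\mathring e_1,\mathring e_2,T$ orthonormal; $\nabla$ is the connection for which they are parallel. All objects are $C^\infty$. For a surface in $H_1$, a point is singular if $T_p\Sigma=\xi_p$, otherwise regular. On the regular part choose a unit field $e_1\in T\Sigma\cap\xi$ (up to sign), $e_2=Je_1$; $H$ is defined by $\nabla_{e_1}e_2=-He_1$; $p$-minimal means $H=0$ on the regular part. The $\alpha$-function is defined by $\alpha e_2+T\in T\Sigma$. A compatible coordinate system on the regular part is one with $e_1=\partial_x$. A $p$-minimal surface (without singular points) is, locally in compatible coordinates, of general type if $\alpha=\frac{x+c_1(y)}{(x+c_1(y))^2+c_2(y)}$ with $c_2(y)\ne0$ for all $y$. It is of type II if $c_2(y)<0$ for all $y$ and either $x<-c_1(y)-\sqrt{-c_2(y)}$ or $x>-c_1(y)+\sqrt{-c_2(y)}$;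 of type III if $c_2(y)<0$ for all $y$ and $-c_1(y)-\sqrt{-c_2(y)}<x<-c_1(y)+\sqrt{-c_2(y)}$. The singular curve of a type II or III surface refers to the boundary curve $x=-c_1(y)+\sqrt{-c_2(y)}$ or $x=-c_1(y)-\sqrt{-c_2(y)}$ of the coordinate domain, along which $\alpha$ blows up (points of the extended surface there are singular). *)

theory Defs
  imports "HOL-Analysis.Analysis"
begin

section \<open>Smooth maps on open sets\<close>

text \<open>Only used for open \<open>U\<close> in a Euclidean space, where this is the usual class \<open>C^k\<close>.\<close>

primrec Ck_on ::
  "nat \<Rightarrow> 'a::euclidean_space set \<Rightarrow> ('a \<Rightarrow> 'b::euclidean_space) \<Rightarrow> bool" where
  "Ck_on 0 U f \<longleftrightarrow> continuous_on U f"
| "Ck_on (Suc k) U f \<longleftrightarrow>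
     (\<forall>u\<in>U. f differentiable (at u)) \<and>
     (\<forall>v. Ck_on k U (\<lambda>u. frechet_derivative f (at u) v))"

definition smooth_on :: "'a::euclidean_space set \<Rightarrow> ('a \<Rightarrow> 'b::euclidean_space) \<Rightarrow> bool" where
  "smooth_on U f \<longleftrightarrow> (\<forall>k. Ck_on k U f)"

section \<open>The Heisenberg group\<close>

text \<open>A point \<open>(x, y, z)\<close>; tangent vectors are given by their Euclidean components
  with respect to \<open>\<partial>\<^sub>x, \<partial>\<^sub>y, \<partial>\<^sub>z\<close>.  The group law
  \<open>(x1, y1, z1) \<circ> (x2, y2, z2) = (x1 + x2, y1 + y2, z1 + z2 + y1 x2 - x1 y2)\<close>
  enters only through its left invariant frame.\<close>

type_synonym heis = "real \<times> real \<times> real"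

fun E1 :: "heis \<Rightarrow> heis" where "E1 (x, y, z) = (1, 0, y)"
fun E2 :: "heis \<Rightarrow> heis" where "E2 (x, y, z) = (0, 1, - x)"
definition T :: heis where "T = (0, 0, 1)"

fun contact_form :: "heis \<Rightarrow> heis \<Rightarrow> real" where
  "contact_form (x, y, z) (a, b, c) = c + x * b - y * a"

definition contact_plane :: "heis \<Rightarrow> heis set" where
  "contact_plane p = {v. contact_form p v = 0}"

definition from_frame :: "heis \<Rightarrow> real \<times> real \<times> real \<Rightarrow> heis" where
  "from_frame p = (\<lambda>(a, b, c). a *\<^sub>R E1 p + b *\<^sub>R E2 p + c *\<^sub>R T)"

text \<open>The inverse of \<^term>\<open>from_frame p\<close>: the contact form annihilates
  \<open>E1\<close>, \<open>E2\<close> and is \<open>1\<close> on \<open>T\<close>.\<close>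

definition to_frame :: "heis \<Rightarrow> heis \<Rightarrow> real \<times> real \<times> real" where
  "to_frame p v = (fst v, fst (snd v), contact_form p v)"

definition adapted_metric :: "heis \<Rightarrow> heis \<Rightarrow> heis \<Rightarrow> real" where
  "adapted_metric p v w = inner (to_frame p v) (to_frame p w)"

text \<open>Only applied to vectors of the contact plane; the value \<open>J T = 0\<close> is a convention.\<close>

definition J :: "heis \<Rightarrow> heis \<Rightarrow> heis" where
  "J p v = (case to_frame p v of (a, b, c) \<Rightarrow> from_frame p (- b, a, 0))"

section \<open>Surfaces\<close>

definition local_param :: "heis set \<Rightarrow> (real \<times> real) set \<Rightarrow> (real \<times> real \<Rightarrow> heis) \<Rightarrow> bool" where
  "local_param S U \<phi> \<longleftrightarrow>
     open U \<and> smooth_on U \<phi> \<and>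
     (\<forall>u\<in>U. inj (frechet_derivative \<phi> (at u))) \<and>
     (\<exists>\<psi>. homeomorphism U (\<phi> ` U) \<phi> \<psi>) \<and>
     openin (top_of_set S) (\<phi> ` U)"

definition smooth_surface :: "heis set \<Rightarrow> bool" where
  "smooth_surface S \<longleftrightarrow> (\<forall>p\<in>S. \<exists>U \<phi>. local_param S U \<phi> \<and> p \<in> \<phi> ` U)"

definition tangent_space :: "heis set \<Rightarrow> heis \<Rightarrow> heis set" where
  "tangent_space S p =
     {v. \<exists>U \<phi> u w. local_param S U \<phi> \<and> u \<in> U \<and> \<phi> u = p \<and> v = frechet_derivative \<phi> (at u) w}"

definition singular_point :: "heis set \<Rightarrow> heis \<Rightarrow> bool" where
  "singular_point S p \<longleftrightarrow> p \<in> S \<and> tangent_space S p = contact_plane p"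

definition regular_point :: "heis set \<Rightarrow> heis \<Rightarrow> bool" where
  "regular_point S p \<longleftrightarrow> p \<in> S \<and> \<not> singular_point S p"

text \<open>A local choice of \<open>e\<^sub>1\<close>, as a vector field along the parametrization \<open>\<phi>\<close>.\<close>

definition characteristic_field ::
  "heis set \<Rightarrow> (real \<times> real) set \<Rightarrow> (real \<times> real \<Rightarrow> heis) \<Rightarrow> (real \<times> real \<Rightarrow> heis) \<Rightarrow> bool" where
  "characteristic_field S U \<phi> e \<longleftrightarrow>
     smooth_on U e \<and>
     (\<forall>u\<in>U. regular_point S (\<phi> u) \<and>
        e u \<in> tangent_space S (\<phi> u) \<inter> contact_plane (\<phi> u) \<and>
        adapted_metric (\<phi> u) (e u) (e u) = 1)"

text \<open>The covariant derivative at \<open>\<phi> u\<close>, in the direction of the tangent vector \<open>v\<close> of the surface,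
  of a vector field \<open>V\<close> along \<open>\<phi>\<close>.  Since \<open>E1\<close>, \<open>E2\<close>, \<open>T\<close> are parallel it is the derivative of the
  frame components of \<open>V\<close> in the parameter direction that \<open>d\<phi>\<close> maps to \<open>v\<close>.\<close>

definition cov_deriv ::
  "(real \<times> real \<Rightarrow> heis) \<Rightarrow> (real \<times> real \<Rightarrow> heis) \<Rightarrow> real \<times> real \<Rightarrow> heis \<Rightarrow> heis" where
  "cov_deriv \<phi> V u v =
     from_frame (\<phi> u)
       (frechet_derivative (\<lambda>w. to_frame (\<phi> w) (V w)) (at u)
          (inv (frechet_derivative \<phi> (at u)) v))"

definition p_mean_curvature ::
  "(real \<times> real \<Rightarrow> heis) \<Rightarrow> (real \<times> real \<Rightarrow> heis) \<Rightarrow> real \<times> real \<Rightarrow> real" where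
  "p_mean_curvature \<phi> e1 u =
     (THE H. cov_deriv \<phi> (\<lambda>w. J (\<phi> w) (e1 w)) u (e1 u) = - H *\<^sub>R e1 u)"

text \<open>Replacing \<open>e1\<close> by its negative changes the sign of \<open>H\<close>, so the condition does not depend
  on the choice of \<open>e1\<close>.\<close>

definition p_minimal_surface :: "heis set \<Rightarrow> bool" where
  "p_minimal_surface S \<longleftrightarrow>
     smooth_surface S \<and>
     (\<forall>U \<phi> e1. local_param S U \<phi> \<and> characteristic_field S U \<phi> e1 \<longrightarrow>
        (\<forall>u\<in>U. p_mean_curvature \<phi> e1 u = 0))"

definition alpha_function :: "heis set \<Rightarrow> heis \<Rightarrow> heis \<Rightarrow> real" where
  "alpha_function S p e1 = (THE a. a *\<^sub>R J p e1 + T \<in> tangent_space S p)"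

section \<open>Surfaces of type II and III\<close>

definition coord_e1 :: "(real \<times> real \<Rightarrow> heis) \<Rightarrow> real \<times> real \<Rightarrow> heis" where
  "coord_e1 X u = frechet_derivative X (at u) (1, 0)"

definition compatible_coords :: "heis set \<Rightarrow> (real \<times> real) set \<Rightarrow> (real \<times> real \<Rightarrow> heis) \<Rightarrow> bool" where
  "compatible_coords S D X \<longleftrightarrow>
     local_param S D X \<and> connected D \<and> D \<noteq> {} \<and> characteristic_field S D X (coord_e1 X)"

definition general_type_coords ::
  "heis set \<Rightarrow> (real \<times> real) set \<Rightarrow> (real \<times> real \<Rightarrow> heis) \<Rightarrow> (real \<Rightarrow> real) \<Rightarrow> (real \<Rightarrow> real) \<Rightarrow> bool" where
  "general_type_coords S D X c1 c2 \<longleftrightarrow>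
     compatible_coords S D X \<and> smooth_on (snd ` D) c1 \<and> smooth_on (snd ` D) c2 \<and>
     (\<forall>y\<in>snd ` D. c2 y \<noteq> 0) \<and>
     (\<forall>(x, y)\<in>D. (x + c1 y)\<^sup>2 + c2 y \<noteq> 0 \<and>
        alpha_function S (X (x, y)) (coord_e1 X (x, y)) = (x + c1 y) / ((x + c1 y)\<^sup>2 + c2 y))"

text \<open>The zeros \<open>x = - c\<^sub>1(y) \<plusminus> sqrt(- c\<^sub>2(y))\<close> of the denominator of \<open>\<alpha>\<close>, for \<open>s = \<plusminus>1\<close>.\<close>

definition sing_root :: "real \<Rightarrow> (real \<Rightarrow> real) \<Rightarrow> (real \<Rightarrow> real) \<Rightarrow> real \<Rightarrow> real" where
  "sing_root s c1 c2 y = - c1 y + s * sqrt (- c2 y)"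

definition type_II_coords ::
  "heis set \<Rightarrow> (real \<times> real) set \<Rightarrow> (real \<times> real \<Rightarrow> heis) \<Rightarrow> (real \<Rightarrow> real) \<Rightarrow> (real \<Rightarrow> real) \<Rightarrow> bool" where
  "type_II_coords S D X c1 c2 \<longleftrightarrow>
     general_type_coords S D X c1 c2 \<and> (\<forall>y\<in>snd ` D. c2 y < 0) \<and>
     ((\<forall>(x, y)\<in>D. x < sing_root (-1) c1 c2 y) \<or> (\<forall>(x, y)\<in>D. x > sing_root 1 c1 c2 y))"

definition type_III_coords ::
  "heis set \<Rightarrow> (real \<times> real) set \<Rightarrow> (real \<times> real \<Rightarrow> heis) \<Rightarrow> (real \<Rightarrow> real) \<Rightarrow> (real \<Rightarrow> real) \<Rightarrow> bool" where
  "type_III_coords S D X c1 c2 \<longleftrightarrow>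
     general_type_coords S D X c1 c2 \<and> (\<forall>y\<in>snd ` D. c2 y < 0) \<and>
     (\<forall>(x, y)\<in>D. sing_root (-1) c1 c2 y < x \<and> x < sing_root 1 c1 c2 y)"

definition type_II_surface :: "heis set \<Rightarrow> bool" where
  "type_II_surface S \<longleftrightarrow>
     p_minimal_surface S \<and> S \<noteq> {} \<and> (\<forall>p\<in>S. regular_point S p) \<and>
     (\<forall>p\<in>S. \<exists>D X c1 c2. type_II_coords S D X c1 c2 \<and> p \<in> X ` D)"

definition type_III_surface :: "heis set \<Rightarrow> bool" where
  "type_III_surface S \<longleftrightarrow>
     p_minimal_surface S \<and> S \<noteq> {} \<and> (\<forall>p\<in>S. regular_point S p) \<and>
     (\<forall>p\<in>S. \<exists>D X c1 c2. type_III_coords S D X c1 c2 \<and> p \<in> X ` D)"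

text \<open>Near \<open>(f y\<^sub>0, y\<^sub>0)\<close> the domain \<open>D\<close> is exactly one of the two sides of the curve \<open>x = f y\<close>.\<close>

definition bounded_by_graph_at :: "(real \<times> real) set \<Rightarrow> (real \<Rightarrow> real) \<Rightarrow> real \<Rightarrow> bool" where
  "bounded_by_graph_at D f y0 \<longleftrightarrow>
     (\<exists>\<epsilon>>0. (\<forall>(x, y)\<in>ball (f y0, y0) \<epsilon>. (x, y) \<in> D \<longleftrightarrow> x > f y) \<or>
            (\<forall>(x, y)\<in>ball (f y0, y0) \<epsilon>. (x, y) \<in> D \<longleftrightarrow> x < f y))"

text \<open>\<open>C\<close> is a singular curve of \<open>S\<close>, as a subset of the Heisenberg group: the points \<open>\<sigma> y\<close> that the
  coordinate map \<open>X\<close> reaches in the limit along a boundary curve of the coordinate domain, over an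
  open interval \<open>I\<close> of values of \<open>y\<close>.\<close>

definition singular_curve :: "heis set \<Rightarrow> heis set \<Rightarrow> bool" where
  "singular_curve S C \<longleftrightarrow>
     (\<exists>D X c1 c2. (type_II_coords S D X c1 c2 \<or> type_III_coords S D X c1 c2) \<and>
        (\<exists>s\<in>{-1, 1}. \<exists>I \<sigma>. open I \<and> is_interval I \<and> I \<noteq> {} \<and>
           (\<forall>y\<in>I. bounded_by_graph_at D (sing_root s c1 c2) y \<and>
                   (X \<longlongrightarrow> \<sigma> y) (at (sing_root s c1 c2 y, y) within D)) \<and>
           C = \<sigma> ` I))"

definition p_minimal_extension_through :: "heis set \<Rightarrow> heis set \<Rightarrow> heis set \<Rightarrow> bool" where
  "p_minimal_extension_through S C S' \<longleftrightarrow> p_minimal_surface S' \<and> S \<subseteq> S' \<and> C \<subseteq> S'"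

text \<open>The part of the extension \<open>S'\<close> lying in \<open>W\<close> on the other side of \<open>C\<close>, for a sufficiently small
  neighbourhood \<open>W\<close> of \<open>C\<close>.\<close>

definition other_side :: "heis set \<Rightarrow> heis set \<Rightarrow> heis set \<Rightarrow> heis set \<Rightarrow> heis set" where
  "other_side S C S' W = (S' \<inter> W) - (S \<union> C)"

end

theory Submission
  imports Defs
begin

text \<open>
  \<open>H = 0\<close> says that the horizontal components of \<open>e\<^sub>1\<close> are constant along \<open>e\<^sub>1\<close>, so the
  characteristic curves are straight lines and \<open>X (x, y) = A y + x v y\<close> in compatible coordinates.
  With \<open>Q = \<Theta> X\<^sub>y\<close> and \<open>m\<close> the \<open>e\<^sub>2\<close>-component of \<open>X\<^sub>y\<close> one has \<open>\<alpha> = m / Q\<close> and \<open>Q\<^sub>x = 2 m\<close>; hence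
  \<open>m = k (x + c\<^sub>1)\<close> and \<open>Q = k ((x + c\<^sub>1)\<^sup>2 + c\<^sub>2)\<close> for some \<open>k y \<noteq> 0\<close>, and the ruled map
  \<open>Y (x, y) = A y + x v y\<close> continues \<open>X\<close> as an immersion across the singular curve \<open>Q = 0\<close>.

  The extension \<open>S'\<close> has to contain this continuation.  Near a singular point \<open>S'\<close> is a graph over
  the \<open>(x, y)\<close>-plane, on which the contact form restricts to \<open>F\<^sub>1 dx + F\<^sub>2 dy\<close>, and \<open>H = 0\<close> becomes
  \<open>DF(RF) \<cdot> RF = 0\<close> with \<open>R\<close> the rotation by a right angle.  All second order data of the graph at
  the singular curve are limits from the given side, and along the continuation of a characteristic
  line with direction \<open>v\<close> the quotient of \<open>F \<cdot> v\<close> and \<open>F \<cdot> Rv\<close> satisfies a linear differential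
  equation with bounded coefficient and zero initial value.  So \<open>F \<cdot> v = 0\<close> there, which means that
  the line stays in \<open>S'\<close>.

  The sign of \<open>(x + c\<^sub>1)\<^sup>2 + c\<^sub>2\<close>, which is intrinsic because \<open>e\<^sub>1 \<alpha> + 2 \<alpha>\<^sup>2\<close> is its inverse,
  distinguishes type II from type III and changes across the simple zero of \<open>Q\<close>.
\<close>

section \<open>Calculus of smooth maps\<close>

text \<open>The crux is a uniqueness problem. \<open>S'\<close> is only known to contain
  \<open>S\<close> and the curve, and \<open>H = 0\<close> constrains it at regular points alone, so
  nothing says beforehand that beyond the curve \<open>S'\<close> is ruled by the same lines. As an
  equation for \<open>F\<close>, minimality degenerates exactly where \<open>F = 0\<close>, that is,
  on the curve. What rescues the argument is a difference in order: along the line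
  \<open>F \<bullet> Rv\<close> leaves zero with speed 2, while \<open>F \<bullet> v\<close>
  vanishes to second order, so passing to the quotient removes the degeneracy.

  Surfaces are bare subsets of space here, so every new parametrization has to be recognized as a
  chart; invariance of domain does this for any injective immersion into a known surface.

  The local pieces beyond the curve are glued at the end. That they do not run back into
  \<open>S\<close> or into the curve is a global matter, decided pointwise: the sign of the
  denominator keeps them off \<open>S\<close>, and regularity keeps them off the curve.\<close>

lemma Ck_on_subset: "Ck_on k U f \<Longrightarrow> V \<subseteq> U \<Longrightarrow> Ck_on k V f"
  by (induction k arbitrary: f) (auto intro: continuous_on_subset)

lemma Ck_on_cong:
  assumes "open U" "\<And>u. u \<in> U \<Longrightarrow> f u = g u" "Ck_on k U f"
  shows "Ck_on k U g"
  using assms(2,3)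
proof (induction k arbitrary: f g)
  case 0
  then show ?case by (metis Ck_on.simps(1) continuous_on_cong)
next
  case (Suc k)
  have d: "(g has_derivative frechet_derivative f (at u)) (at u)" if "u \<in> U" for u
  proof (rule has_derivative_transform_within_open[of f])
    show "(f has_derivative frechet_derivative f (at u)) (at u)"
      using Suc.prems(2) that by (simp add: frechet_derivative_works[symmetric])
  qed (use that assms(1) Suc.prems(1) in auto)
  have e: "frechet_derivative f (at u) v = frechet_derivative g (at u) v" if "u \<in> U" for u v
    using frechet_derivative_at[OF d[OF that]] by simp
  have "Ck_on k U (\<lambda>u. frechet_derivative g (at u) v)" for v
    by (rule Suc.IH[of "\<lambda>u. frechet_derivative f (at u) v"]) (use e Suc.prems in auto)
  then show ?case using d by (auto simp: differentiable_def)
qed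

lemma Ck_on_SucI:
  assumes "open U" "\<And>u. u \<in> U \<Longrightarrow> (f has_derivative f' u) (at u)"
    and "\<And>v. Ck_on k U (\<lambda>u. f' u v)"
  shows "Ck_on (Suc k) U f"
proof -
  have "Ck_on k U (\<lambda>u. frechet_derivative f (at u) v)" for v
    by (rule Ck_on_cong[OF assms(1) _ assms(3)[of v]])
       (simp add: frechet_derivative_at[OF assms(2), symmetric])
  then show ?thesis using assms(2) by (auto simp: differentiable_def)
qed

lemma Ck_on_has_derivative:
  "Ck_on (Suc k) U f \<Longrightarrow> u \<in> U \<Longrightarrow> (f has_derivative frechet_derivative f (at u)) (at u)"
  by (simp add: frechet_derivative_works[symmetric])

lemma Ck_on_Suc_D: "Ck_on (Suc k) U f \<Longrightarrow> Ck_on k U f"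
proof (induction k arbitrary: f)
  case 0
  then show ?case
    by (auto intro!: continuous_at_imp_continuous_on differentiable_imp_continuous_within)
qed auto

lemma Ck_on_const: "Ck_on k U (\<lambda>u. c)"
  by (induction k arbitrary: c) auto

lemma Ck_on_bounded_linear:
  assumes "bounded_linear L" "open U" "Ck_on k U f"
  shows "Ck_on k U (\<lambda>u. L (f u))"
  using assms(3)
proof (induction k arbitrary: f)
  case 0
  then show ?case using bounded_linear.continuous_on[OF assms(1)] by auto
next
  case (Suc k)
  show ?case
  proof (rule Ck_on_SucI[OF assms(2)])
    show "((\<lambda>u. L (f u)) has_derivative (\<lambda>v. L (frechet_derivative f (at u) v))) (at u)"
      if "u \<in> U" for u
      using bounded_linear.has_derivative[OF assms(1) Ck_on_has_derivative[OF Suc.prems that]] .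
  qed (use Suc in auto)
qed

lemma Ck_on_add:
  assumes "open U" "Ck_on k U f" "Ck_on k U g"
  shows "Ck_on k U (\<lambda>u. f u + g u)"
  using assms(2,3)
proof (induction k arbitrary: f g)
  case 0
  then show ?case by (auto intro: continuous_on_add)
next
  case (Suc k)
  show ?case
  proof (rule Ck_on_SucI[OF assms(1)])
    show "((\<lambda>u. f u + g u) has_derivative
       (\<lambda>v. frechet_derivative f (at u) v + frechet_derivative g (at u) v)) (at u)"
      if "u \<in> U" for u
      using that Suc.prems by (intro has_derivative_add Ck_on_has_derivative)
  qed (use Suc in auto)
qed

lemma Ck_on_sum:
  assumes "open U" "\<And>i. i \<in> I \<Longrightarrow> Ck_on k U (f i)"
  shows "Ck_on k U (\<lambda>u. \<Sum>i\<in>I. f i u)"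
  using assms(2)
  by (induction I rule: infinite_finite_induct) (auto intro: Ck_on_const Ck_on_add[OF assms(1)])

lemma Ck_on_bilinear:
  assumes "bounded_bilinear b" "open U" "Ck_on k U f" "Ck_on k U g"
  shows "Ck_on k U (\<lambda>u. b (f u) (g u))"
  using assms(3,4)
proof (induction k arbitrary: f g)
  case 0
  then show ?case using bounded_bilinear.continuous_on[OF assms(1)] by auto
next
  case (Suc k)
  show ?case
  proof (rule Ck_on_SucI[OF assms(2)])
    show "((\<lambda>u. b (f u) (g u)) has_derivative
       (\<lambda>v. b (f u) (frechet_derivative g (at u) v) + b (frechet_derivative f (at u) v) (g u))) (at u)"
      if "u \<in> U" for u
      using that Suc.prems by (intro bounded_bilinear.FDERIV[OF assms(1)] Ck_on_has_derivative)
    show "Ck_on k U (\<lambda>u. b (f u) (frechet_derivative g (at u) v) + b (frechet_derivative f (at u) v) (g u))"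
      for v
      by (intro Ck_on_add assms(2) Suc.IH) (use Suc.prems in \<open>auto intro: Ck_on_Suc_D simp del: Ck_on.simps\<close>, auto)
  qed
qed

text \<open>The class is defined through derivatives in fixed directions, but the chain rule yields
  the derivative of \<open>f\<close> in the moving direction \<open>?g' u v\<close>. Expanding that
  direction in \<open>Basis\<close> gives a sum of components of \<open>?g'\<close> times
  derivatives of \<open>f\<close> in fixed directions, composed with \<open>g\<close>; the induction
  hypothesis covers the latter.\<close>

lemma Ck_on_compose:
  assumes "open U" "open V" "g ` U \<subseteq> V" "Ck_on k V f" "Ck_on k U g"
  shows "Ck_on k U (\<lambda>u. f (g u))"
  using assms(4,5)
proof (induction k arbitrary: f)
  case 0
  then show ?case using continuous_on_compose2[of V f U g] assms(3) by auto
next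
  case (Suc k)
  let ?f' = "\<lambda>p. frechet_derivative f (at p)" and ?g' = "\<lambda>u. frechet_derivative g (at u)"
  have gk: "Ck_on k U g" by (rule Ck_on_Suc_D[OF Suc.prems(2)])
  show ?case
  proof (rule Ck_on_SucI[OF assms(1)])
    fix u assume u: "u \<in> U"
    then have gu: "g u \<in> V" using assms(3) by auto
    have f: "(f has_derivative ?f' (g u)) (at (g u))"
      by (rule Ck_on_has_derivative[OF Suc.prems(1) gu])
    have "((\<lambda>u. f (g u)) has_derivative (\<lambda>v. ?f' (g u) (?g' u v))) (at u)"
      using diff_chain_at[OF Ck_on_has_derivative[OF Suc.prems(2) u] f] by (simp add: o_def)
    moreover have "(\<lambda>v. ?f' (g u) (?g' u v)) = (\<lambda>v. \<Sum>b\<in>Basis. (?g' u v \<bullet> b) *\<^sub>R ?f' (g u) b)"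
    proof
      fix v
      let ?w = "?g' u v"
      interpret l: linear "?f' (g u)" by (rule has_derivative_linear[OF f])
      have "?f' (g u) ?w = ?f' (g u) (\<Sum>b\<in>Basis. (?w \<bullet> b) *\<^sub>R b)"
        by (simp only: euclidean_representation)
      also have "\<dots> = (\<Sum>b\<in>Basis. (?w \<bullet> b) *\<^sub>R ?f' (g u) b)"
        by (simp only: l.sum l.scale)
      finally show "?f' (g u) ?w = (\<Sum>b\<in>Basis. (?w \<bullet> b) *\<^sub>R ?f' (g u) b)" .
    qed
    ultimately show "((\<lambda>u. f (g u)) has_derivative
        (\<lambda>v. \<Sum>b\<in>Basis. (?g' u v \<bullet> b) *\<^sub>R ?f' (g u) b)) (at u)" by (simp only:)
  next
    fix v
    show "Ck_on k U (\<lambda>u. \<Sum>b\<in>Basis. (?g' u v \<bullet> b) *\<^sub>R ?f' (g u) b)"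
    proof (intro Ck_on_sum[OF assms(1)] Ck_on_bilinear[OF bounded_bilinear_scaleR assms(1)])
      show "Ck_on k U (\<lambda>u. ?g' u v \<bullet> b)" for b
        by (rule Ck_on_bounded_linear[OF bounded_linear_inner_left assms(1)]) (use Suc.prems in auto)
      show "Ck_on k U (\<lambda>u. ?f' (g u) b)" for b
        by (rule Suc.IH) (use Suc.prems gk in auto)
    qed
  qed
qed

lemma smooth_on_subset: "smooth_on U f \<Longrightarrow> V \<subseteq> U \<Longrightarrow> smooth_on V f"
  by (auto simp: smooth_on_def intro: Ck_on_subset)

lemma smooth_on_const [simp]: "smooth_on U (\<lambda>u. c)"
  by (simp add: smooth_on_def Ck_on_const)

lemma smooth_on_bounded_linear:
  "bounded_linear L \<Longrightarrow> open U \<Longrightarrow> smooth_on U f \<Longrightarrow> smooth_on U (\<lambda>u. L (f u))"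
  by (simp add: smooth_on_def Ck_on_bounded_linear)

lemma smooth_on_add:
  "open U \<Longrightarrow> smooth_on U f \<Longrightarrow> smooth_on U g \<Longrightarrow> smooth_on U (\<lambda>u. f u + g u)"
  by (simp add: smooth_on_def Ck_on_add)

lemma smooth_on_scaleR:
  "open U \<Longrightarrow> smooth_on U f \<Longrightarrow> smooth_on U g \<Longrightarrow> smooth_on U (\<lambda>u. f u *\<^sub>R g u)"
  by (simp add: smooth_on_def Ck_on_bilinear[OF bounded_bilinear_scaleR])

lemma smooth_on_mult:
  fixes f g :: "'a::euclidean_space \<Rightarrow> real"
  shows "open U \<Longrightarrow> smooth_on U f \<Longrightarrow> smooth_on U g \<Longrightarrow> smooth_on U (\<lambda>u. f u * g u)"
  by (simp add: smooth_on_def Ck_on_bilinear[OF bounded_bilinear_mult])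

lemma smooth_on_minus: "open U \<Longrightarrow> smooth_on U f \<Longrightarrow> smooth_on U (\<lambda>u. - f u)"
  by (rule smooth_on_bounded_linear[OF bounded_linear_minus[OF bounded_linear_ident]])

lemma smooth_on_diff:
  "open U \<Longrightarrow> smooth_on U f \<Longrightarrow> smooth_on U g \<Longrightarrow> smooth_on U (\<lambda>u. f u - g u)"
  using smooth_on_add[of U f "\<lambda>u. - g u"] smooth_on_minus[of U g] by simp

lemma smooth_on_compose:
  "open U \<Longrightarrow> open V \<Longrightarrow> g ` U \<subseteq> V \<Longrightarrow> smooth_on V f \<Longrightarrow> smooth_on U g \<Longrightarrow> smooth_on U (\<lambda>u. f (g u))"
  by (simp add: smooth_on_def Ck_on_compose)

lemma smooth_on_id: "open U \<Longrightarrow> smooth_on U (\<lambda>u. u)"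
proof -
  assume "open U"
  have "Ck_on k U (\<lambda>u. u)" for k
    by (cases k) (auto intro: Ck_on_SucI[OF \<open>open U\<close>] has_derivative_ident Ck_on_const simp del: Ck_on.simps(2))
  then show ?thesis by (simp add: smooth_on_def)
qed

lemma smooth_on_fst: "open U \<Longrightarrow> smooth_on U f \<Longrightarrow> smooth_on U (\<lambda>u. fst (f u))"
  and smooth_on_snd: "open U \<Longrightarrow> smooth_on U f \<Longrightarrow> smooth_on U (\<lambda>u. snd (f u))"
  by (auto intro: smooth_on_bounded_linear bounded_linear_fst bounded_linear_snd)

lemma smooth_on_Pair:
  assumes "open U" "smooth_on U f" "smooth_on U g"
  shows "smooth_on U (\<lambda>u. (f u, g u))"
proof -
  have "smooth_on U (\<lambda>u. (f u, 0) + (0, g u))"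
    by (intro smooth_on_add assms smooth_on_bounded_linear[of "\<lambda>x. (x, 0)" U f]
        smooth_on_bounded_linear[of "\<lambda>x. (0, x)" U g] bounded_linear_Pair
        bounded_linear_ident bounded_linear_zero)
  then show ?thesis by simp
qed

lemma smooth_on_frechet_derivative:
  "smooth_on U f \<Longrightarrow> smooth_on U (\<lambda>u. frechet_derivative f (at u) v)"
  unfolding smooth_on_def by (metis Ck_on.simps(2))

lemma smooth_on_has_derivative:
  "smooth_on U f \<Longrightarrow> u \<in> U \<Longrightarrow> (f has_derivative frechet_derivative f (at u)) (at u)"
  unfolding smooth_on_def by (metis Ck_on_has_derivative)

lemma smooth_on_continuous_on: "smooth_on U f \<Longrightarrow> continuous_on U f"
  unfolding smooth_on_def by (metis Ck_on.simps(1))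

lemma smooth_on_real_inverse: "smooth_on (- {0}) (inverse :: real \<Rightarrow> real)"
proof -
  have o: "open (- {0::real})" by auto
  have "Ck_on k (- {0}) (inverse :: real \<Rightarrow> real)" for k
  proof (induction k)
    case 0
    then show ?case by (auto intro: continuous_intros)
  next
    case (Suc k)
    show ?case
    proof (rule Ck_on_SucI[OF o])
      show "(inverse has_derivative (\<lambda>v. - (inverse u * v * inverse u))) (at u)" if "u \<in> - {0}" for u :: real
        using that by (intro has_derivative_inverse') auto
      show "Ck_on k (- {0}) (\<lambda>u. - (inverse u * v * inverse u))" for v :: real
        by (intro Ck_on_bounded_linear[OF bounded_linear_minus[OF bounded_linear_ident] o]
             Ck_on_bilinear[OF bounded_bilinear_mult o] Suc Ck_on_const)
    qed
  qed
  then show ?thesis by (simp add: smooth_on_def)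
qed

lemma smooth_on_inverse:
  fixes f :: "'a::euclidean_space \<Rightarrow> real"
  shows "open U \<Longrightarrow> smooth_on U f \<Longrightarrow> (\<And>u. u \<in> U \<Longrightarrow> f u \<noteq> 0) \<Longrightarrow> smooth_on U (\<lambda>u. inverse (f u))"
  by (rule smooth_on_compose[OF _ _ _ smooth_on_real_inverse]) auto

lemma smooth_on_divide:
  fixes f g :: "'a::euclidean_space \<Rightarrow> real"
  shows "open U \<Longrightarrow> smooth_on U f \<Longrightarrow> smooth_on U g \<Longrightarrow> (\<And>u. u \<in> U \<Longrightarrow> g u \<noteq> 0)
    \<Longrightarrow> smooth_on U (\<lambda>u. f u / g u)"
  unfolding divide_inverse by (intro smooth_on_mult smooth_on_inverse)

lemma smooth_on_real_sqrt: "smooth_on {0<..} sqrt"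
proof -
  have o: "open {0::real<..}" by auto
  have "Ck_on k {0<..} sqrt" for k
  proof (induction k)
    case 0
    then show ?case by (auto intro: continuous_intros)
  next
    case (Suc k)
    have p: "sqrt ` {0<..} \<subseteq> - {0}" by auto
    show ?case
    proof (rule Ck_on_SucI[OF o])
      show "(sqrt has_derivative (\<lambda>v. v * (inverse (sqrt u) * (1 / 2)))) (at u)" if "u \<in> {0<..}" for u
      proof -
        have "(\<lambda>v. v * (inverse (sqrt u) * (1 / 2))) = (*) (inverse (sqrt u) / 2)"
          by (simp add: fun_eq_iff)
        then show ?thesis using DERIV_real_sqrt[of u] that by (simp add: has_field_derivative_def)
      qed
      show "Ck_on k {0<..} (\<lambda>u. v * (inverse (sqrt u) * (1 / 2)))" for v :: real
        by (intro Ck_on_bilinear[OF bounded_bilinear_mult o] Ck_on_const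
             Ck_on_compose[OF o _ p _ Suc]) (use smooth_on_real_inverse in \<open>auto simp: smooth_on_def\<close>)
    qed
  qed
  then show ?thesis by (simp add: smooth_on_def)
qed

lemma smooth_on_sqrt:
  "open U \<Longrightarrow> smooth_on U f \<Longrightarrow> (\<And>u. u \<in> U \<Longrightarrow> f u > 0) \<Longrightarrow> smooth_on U (\<lambda>u. sqrt (f u))"
  by (rule smooth_on_compose[OF _ _ _ smooth_on_real_sqrt]) auto

lemmas smooth_intros =
  smooth_on_const smooth_on_id smooth_on_fst smooth_on_snd smooth_on_Pair smooth_on_add smooth_on_diff
  smooth_on_minus smooth_on_mult smooth_on_scaleR smooth_on_divide smooth_on_sqrt

section \<open>Surfaces and their tangent spaces\<close>

abbreviation jac :: "(real \<times> real \<Rightarrow> real \<times> real) \<Rightarrow> real \<times> real \<Rightarrow> real" where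
  "jac f u \<equiv> fst (frechet_derivative f (at u) (1, 0)) * snd (frechet_derivative f (at u) (0, 1))
     - fst (frechet_derivative f (at u) (0, 1)) * snd (frechet_derivative f (at u) (1, 0))"

lemma linear_real_pair:
  fixes L :: "real \<times> real \<Rightarrow> 'a::real_vector"
  assumes "linear L"
  shows "L w = fst w *\<^sub>R L (1, 0) + snd w *\<^sub>R L (0, 1)"
proof -
  interpret linear L by fact
  have "w = fst w *\<^sub>R (1, 0) + snd w *\<^sub>R (0, 1)" by (simp add: prod_eq_iff)
  then have "L w = L (fst w *\<^sub>R (1, 0) + snd w *\<^sub>R (0, 1))" by simp
  then show ?thesis by (simp only: add scale)
qed

text \<open>The criterion \<open>has_derivative_locally_injective\<close> wants the derivative to be
  continuous in operator norm. In the plane this follows from the continuity of its two columns, the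
  derivatives along \<open>(1, 0)\<close> and \<open>(0, 1)\<close>; each may move by
  \<open>e / 3\<close>.\<close>

lemma smooth_on_locally_injective:
  fixes f :: "real \<times> real \<Rightarrow> real \<times> real"
  assumes "open U" "smooth_on U f" "u \<in> U" "jac f u \<noteq> 0"
  obtains r where "r > 0" "ball u r \<subseteq> U" "inj_on f (ball u r)"
proof -
  let ?f' = "\<lambda>u. frechet_derivative f (at u)"
  have der: "(f has_derivative ?f' x) (at x)" if "x \<in> U" for x
    by (rule smooth_on_has_derivative[OF assms(2) that])
  have lin: "linear (?f' x)" if "x \<in> U" for x
    using has_derivative_linear[OF der[OF that]] .
  have rep: "?f' x v = fst v *\<^sub>R ?f' x (1,0) + snd v *\<^sub>R ?f' x (0,1)" if "x \<in> U" for x v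
    using linear_real_pair[OF lin[OF that]] .
  have "inj (?f' u)"
  proof (subst linear_injective_0[OF lin[OF assms(3)]], intro allI impI)
    fix v assume v: "?f' u v = 0"
    let ?a = "fst (?f' u (1,0))" and ?b = "fst (?f' u (0,1))"
      and ?c = "snd (?f' u (1,0))" and ?d = "snd (?f' u (0,1))"
    have "fst v * ?a + snd v * ?b = 0" "fst v * ?c + snd v * ?d = 0"
      using v rep[OF assms(3), of v] by (simp_all add: prod_eq_iff)
    then have "fst v * (?a * ?d - ?b * ?c) = 0" "snd v * (?a * ?d - ?b * ?c) = 0" by algebra+
    then show "v = 0" using assms(4) by (simp add: prod_eq_iff)
  qed
  then obtain g' where g': "linear g'" "g' \<circ> ?f' u = id"
    using linear_injective_left_inverse[OF lin[OF assms(3)]] by auto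
  show ?thesis
  proof (rule has_derivative_locally_injective[where f' = ?f' and g' = g' and f = f and a = u and S = U])
    show "bounded_linear g'" using g' by (simp add: linear_conv_bounded_linear)
    fix e :: real assume e: "e > 0"
    have "\<exists>d>0. \<forall>x\<in>ball u d. x \<in> U \<and> dist (?f' x v) (?f' u v) < e / 3" for v
    proof -
      have "continuous_on U (\<lambda>x. ?f' x v)"
        by (intro smooth_on_continuous_on smooth_on_frechet_derivative assms)
      then have "isCont (\<lambda>x. ?f' x v) u" using assms by (simp add: continuous_on_eq_continuous_at)
      then have "\<forall>\<^sub>F x in nhds u. dist (?f' x v) (?f' u v) < e / 3"
        using e tendstoD[of "\<lambda>x. ?f' x v" "?f' u v" "nhds u" "e / 3"]
        by (simp add: isCont_def tendsto_at_iff_tendsto_nhds[of "\<lambda>x. ?f' x v"])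
      moreover have "\<forall>\<^sub>F x in nhds u. x \<in> U" using assms by (simp add: eventually_nhds_in_open)
      ultimately have "\<forall>\<^sub>F x in nhds u. x \<in> U \<and> dist (?f' x v) (?f' u v) < e / 3"
        by eventually_elim auto
      then show ?thesis unfolding eventually_nhds_metric by (auto simp: dist_commute)
    qed
    then obtain d where d: "\<And>v. d v > 0"
      "\<And>v x. x \<in> ball u (d v) \<Longrightarrow> x \<in> U \<and> dist (?f' x v) (?f' u v) < e / 3" by metis
    show "\<exists>d>0. \<forall>x. dist u x < d \<longrightarrow> onorm (\<lambda>v. ?f' x v - ?f' u v) < e"
    proof (intro exI[of _ "min (d (1,0)) (d (0,1))"] conjI allI impI)
      fix x assume x: "dist u x < min (d (1,0)) (d (0,1))"
      have xU: "x \<in> U" and 1: "norm (?f' x (1,0) - ?f' u (1,0)) \<le> e / 3"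
        and 2: "norm (?f' x (0,1) - ?f' u (0,1)) \<le> e / 3"
        using d(2)[of x "(1,0)"] d(2)[of x "(0,1)"] x by (auto simp: dist_norm)
      have "onorm (\<lambda>v. ?f' x v - ?f' u v) \<le> 2 * (e / 3)"
      proof (rule onorm_le)
        fix v :: "real \<times> real"
        have n: "\<bar>fst v\<bar> \<le> norm v" "\<bar>snd v\<bar> \<le> norm v"
          using norm_fst_le[of "fst v" "snd v"] norm_snd_le[of "snd v" "fst v"] by auto
        have "?f' x v - ?f' u v = fst v *\<^sub>R (?f' x (1,0) - ?f' u (1,0)) + snd v *\<^sub>R (?f' x (0,1) - ?f' u (0,1))"
          using rep[OF xU, of v] rep[OF assms(3), of v] by (simp add: algebra_simps)
        also have "norm \<dots> \<le> \<bar>fst v\<bar> * norm (?f' x (1,0) - ?f' u (1,0)) + \<bar>snd v\<bar> * norm (?f' x (0,1) - ?f' u (0,1))"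
          by (rule order_trans[OF norm_triangle_ineq]) simp
        also have "\<dots> \<le> norm v * (e / 3) + norm v * (e / 3)"
          by (intro add_mono mult_mono n 1 2) auto
        finally show "norm (?f' x v - ?f' u v) \<le> 2 * (e / 3) * norm v" by (simp add: algebra_simps)
      qed
      then show "onorm (\<lambda>v. ?f' x v - ?f' u v) < e" using e by simp
    qed (use d in auto)
  qed (use assms der g' that in auto)
qed

text \<open>Local injectivity and invariance of domain give a continuous inverse on an open image.
  Its derivative at \<open>y\<close> is \<open>g' (g y)\<close> with \<open>g'\<close> smooth, so
  each order of smoothness of \<open>g\<close> yields the next one.\<close>

lemma smooth_local_inverse:
  fixes f :: "real \<times> real \<Rightarrow> real \<times> real"
  assumes "open U" "smooth_on U f" "u \<in> U" "jac f u \<noteq> 0"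
  obtains V g where "open V" "u \<in> V" "V \<subseteq> U" "inj_on f V" "open (f ` V)"
    "\<And>x. x \<in> V \<Longrightarrow> g (f x) = x" "smooth_on (f ` V) g"
proof -
  obtain r where r: "r > 0" "ball u r \<subseteq> U" "inj_on f (ball u r)"
    using smooth_on_locally_injective[OF assms] .
  let ?f' = "\<lambda>u. frechet_derivative f (at u)"
  \<comment> \<open>Intersecting with the set where the Jacobian is nonzero makes the inverse
    differentiable on the whole image, not just at \<open>f u\<close>.\<close>
  define V where "V = ball u r \<inter> jac f -` (- {0})"
  have sj: "smooth_on (ball u r) (jac f)"
    by (intro smooth_intros smooth_on_frechet_derivative smooth_on_subset[OF assms(2) r(2)]) auto
  have oV: "open V" unfolding V_def
    by (intro continuous_open_preimage smooth_on_continuous_on sj) auto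
  have VU: "V \<subseteq> U" and uV: "u \<in> V" and inj: "inj_on f V"
    using r assms(4) by (auto simp: V_def intro: inj_on_subset)
  have cont: "continuous_on V f" using smooth_on_continuous_on[OF smooth_on_subset[OF assms(2) VU]] .
  have ofV: "open (f ` V)" by (rule invariance_of_domain[OF cont oV inj])
  define g where "g = inv_into V f"
  have gf: "g (f x) = x" if "x \<in> V" for x using that inj by (simp add: g_def)
  have cg: "continuous_on (f ` V) g"
  proof (rule continuous_on_inverse_open_map[OF cont refl gf])
    fix W assume "openin (top_of_set V) W"
    then have "open W" "W \<subseteq> V" using oV openin_open_trans openin_imp_subset by blast+
    then have "open (f ` W)"
      using invariance_of_domain continuous_on_subset[OF cont] inj_on_subset[OF inj] by metis
    then show "openin (top_of_set (f ` V)) (f ` W)" using \<open>W \<subseteq> V\<close> by (simp add: open_subset image_mono)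
  qed
  \<comment> \<open>Cramer's rule\<close>
  define g' where "g' x w = ((fst w * snd (?f' x (0,1)) - fst (?f' x (0,1)) * snd w) / jac f x,
     (fst (?f' x (1,0)) * snd w - fst w * snd (?f' x (1,0))) / jac f x)" for x w
  have derg: "(g has_derivative g' (g y)) (at y)" if y: "y \<in> f ` V" for y
  proof (rule has_derivative_inverse_basic[where f = f and T = "f ` V"])
    let ?x = "g y"
    have xV: "?x \<in> V" and fx: "f ?x = y" using y gf by auto
    show der: "(f has_derivative ?f' ?x) (at (g y))"
      using smooth_on_has_derivative[OF assms(2), of ?x] xV VU by blast
    have j: "jac f ?x \<noteq> 0" using xV by (simp add: V_def)
    show "bounded_linear (g' ?x)"
      unfolding linear_conv_bounded_linear[symmetric]
      by (rule linearI) (auto simp: g'_def algebra_simps add_divide_distrib diff_divide_distrib)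
    show "g' ?x \<circ> ?f' ?x = id"
    proof
      fix w
      have e: "?f' ?x w = fst w *\<^sub>R ?f' ?x (1,0) + snd w *\<^sub>R ?f' ?x (0,1)"
        by (rule linear_real_pair[OF has_derivative_linear[OF der]])
      show "(g' ?x \<circ> ?f' ?x) w = id w"
        using j unfolding o_def id_def e g'_def
        by (simp add: prod_eq_iff divide_simps) (simp add: algebra_simps)
    qed
    show "continuous (at y) g" using cg y unfolding continuous_on_eq_continuous_at[OF ofV] by blast
  qed (use ofV y gf in auto)
  have "Ck_on k (f ` V) g" for k
  proof (induction k)
    case 0
    then show ?case using cg by simp
  next
    case (Suc k)
    have sm: "smooth_on V (\<lambda>x. g' x w)" for w
      unfolding g'_def
      by (intro smooth_intros smooth_on_frechet_derivative smooth_on_subset[OF assms(2) VU] oV)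
         (auto simp: V_def)
    show ?case
    proof (rule Ck_on_SucI[OF ofV derg])
      show "Ck_on k (f ` V) (\<lambda>y. g' (g y) w)" for w
        by (rule Ck_on_compose[OF ofV oV _ _ Suc]) (use sm gf in \<open>auto simp: smooth_on_def\<close>)
    qed auto
  qed
  then have "smooth_on (f ` V) g" by (simp add: smooth_on_def)
  then show ?thesis using that oV uV VU inj ofV gf by blast
qed

section \<open>Charts of surfaces and invariance of domain\<close>

lemma local_paramD:
  assumes "local_param S U \<phi>"
  shows "open U" "smooth_on U \<phi>" "\<And>u. u \<in> U \<Longrightarrow> inj (frechet_derivative \<phi> (at u))"
    "openin (top_of_set S) (\<phi> ` U)" "\<phi> ` U \<subseteq> S" "inj_on \<phi> U" "continuous_on U \<phi>"
    "\<And>u. u \<in> U \<Longrightarrow> (\<phi> has_derivative frechet_derivative \<phi> (at u)) (at u)"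
    "\<exists>\<psi>. homeomorphism U (\<phi> ` U) \<phi> \<psi>"
proof -
  show "open U" "smooth_on U \<phi>" "\<And>u. u \<in> U \<Longrightarrow> inj (frechet_derivative \<phi> (at u))"
    and o: "openin (top_of_set S) (\<phi> ` U)" and h: "\<exists>\<psi>. homeomorphism U (\<phi> ` U) \<phi> \<psi>"
    using assms by (auto simp: local_param_def)
  show "\<phi> ` U \<subseteq> S" using openin_imp_subset[OF o] .
  show "inj_on \<phi> U" using h by (auto simp: homeomorphism_def intro: inj_on_inverseI)
  show "continuous_on U \<phi>" using h by (auto simp: homeomorphism_def)
  show "\<And>u. u \<in> U \<Longrightarrow> (\<phi> has_derivative frechet_derivative \<phi> (at u)) (at u)"
    using assms smooth_on_has_derivative by (auto simp: local_param_def)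
qed

text \<open>Read in a chart of \<open>S\<close>, the map becomes a continuous injection between open
  sets of the plane, hence open.\<close>

lemma openin_image_injective:
  fixes U :: "(real \<times> real) set"
  assumes S: "smooth_surface S" and "open U" "continuous_on U \<phi>" "inj_on \<phi> U" "\<phi> ` U \<subseteq> S"
  shows "openin (top_of_set S) (\<phi> ` U)"
proof (subst openin_subopen, intro ballI)
  fix p assume "p \<in> \<phi> ` U"
  then obtain u where u: "u \<in> U" "p = \<phi> u" by auto
  then obtain U' \<phi>' where lp: "local_param S U' \<phi>'" "p \<in> \<phi>' ` U'"
    using S assms(5) unfolding smooth_surface_def by blast
  obtain \<psi> where hom: "homeomorphism U' (\<phi>' ` U') \<phi>' \<psi>" using local_paramD(9)[OF lp(1)] ..
  define V where "V = U \<inter> \<phi> -` (\<phi>' ` U')"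
  have "openin (top_of_set U) V" unfolding V_def
    by (rule continuous_openin_preimage[OF assms(3) _ local_paramD(4)[OF lp(1)]]) (use assms(5) in auto)
  then have oV: "open V" using assms(2) openin_open_trans by blast
  have V: "V \<subseteq> U" "\<phi> ` V \<subseteq> \<phi>' ` U'" by (auto simp: V_def)
  let ?g = "\<lambda>x. \<psi> (\<phi> x)"
  have g: "?g x \<in> U'" "\<phi>' (?g x) = \<phi> x" if "x \<in> V" for x
    using that V(2) hom by (auto simp: homeomorphism_def)
  have "open (?g ` V)"
  proof (rule invariance_of_domain[OF _ oV])
    show "continuous_on V ?g"
      by (rule continuous_on_compose2[OF homeomorphism_cont2[OF hom] continuous_on_subset[OF assms(3) V(1)] V(2)])
    show "inj_on ?g V"
    proof (rule inj_onI)
      fix x y assume xy: "x \<in> V" "y \<in> V" and e: "?g x = ?g y"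
      have "\<phi> x = \<phi> y" using arg_cong[OF e, of \<phi>'] unfolding g(2)[OF xy(1)] g(2)[OF xy(2)] .
      then show "x = y" using inj_onD[OF assms(4)] xy V(1) by blast
    qed
  qed
  then have "openin (top_of_set U') (?g ` V)" using g(1) by (auto intro: open_subset)
  then have "openin (top_of_set (\<phi>' ` U')) (\<phi>' ` ?g ` V)" by (rule homeomorphism_imp_open_map[OF hom])
  moreover have "\<phi>' ` ?g ` V = \<phi> ` V" unfolding image_image using g(2) by (auto intro: image_cong)
  ultimately have "openin (top_of_set S) (\<phi> ` V)" using openin_trans local_paramD(4)[OF lp(1)] by metis
  moreover have "p \<in> \<phi> ` V" using u lp(2) by (auto simp: V_def)
  ultimately show "\<exists>T. openin (top_of_set S) T \<and> p \<in> T \<and> T \<subseteq> \<phi> ` U" using V(1) by blast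
qed

text \<open>For a map into a set already known to be a surface, the homeomorphism and openness
  clauses of \<open>local_param\<close> are automatic. This is how restricted charts, graphs and
  finally the ruled map are recognized as charts.\<close>

lemma local_param_injective_immersion:
  assumes S: "smooth_surface S" and U: "open U" "smooth_on U \<phi>" "inj_on \<phi> U" "\<phi> ` U \<subseteq> S"
    and "\<And>u. u \<in> U \<Longrightarrow> inj (frechet_derivative \<phi> (at u))"
  shows "local_param S U \<phi>"
proof -
  have c: "continuous_on U \<phi>" using U by (simp add: smooth_on_continuous_on)
  have "openin (top_of_set (\<phi> ` U)) (\<phi> ` V)" if "openin (top_of_set U) V" for V
  proof (rule openin_subset_trans[OF _ _ U(4)])
    have V: "V \<subseteq> U" "open V" using that U(1) openin_imp_subset openin_open_trans by blast+
    show "openin (top_of_set S) (\<phi> ` V)"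
      by (rule openin_image_injective[OF S])
         (use V U c in \<open>auto intro: continuous_on_subset inj_on_subset\<close>)
  qed (use openin_imp_subset[OF that] in auto)
  then obtain \<psi> where "homeomorphism U (\<phi> ` U) \<phi> \<psi>"
    using homeomorphism_injective_open_map[OF c refl U(3)] by blast
  then show ?thesis
    unfolding local_param_def using assms openin_image_injective[OF S U(1) c U(3,4)] by blast
qed

text \<open>An image open in \<open>S\<close> is not obviously open in the larger \<open>S'\<close>;
  since the image and \<open>S'\<close> are both two-dimensional, invariance of domain closes the
  gap.\<close>

lemma local_param_mono:
  assumes "smooth_surface S'" "S \<subseteq> S'" "local_param S U \<phi>"
  shows "local_param S' U \<phi>"
  using local_paramD[OF assms(3)] assms by (intro local_param_injective_immersion) auto

lemma local_param_subset:
  assumes "smooth_surface S" "local_param S U \<phi>" "open V" "V \<subseteq> U"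
  shows "local_param S V \<phi>"
  using local_paramD[OF assms(2)] assms
  by (intro local_param_injective_immersion) (blast intro: smooth_on_subset inj_on_subset)+

lemma openin_subsurface:
  assumes "smooth_surface S" "smooth_surface S'" "S \<subseteq> S'"
  shows "openin (top_of_set S') S"
proof (subst openin_subopen, intro ballI)
  fix p assume "p \<in> S"
  then obtain U \<phi> where l: "local_param S U \<phi>" "p \<in> \<phi> ` U"
    using assms(1) unfolding smooth_surface_def by blast
  then show "\<exists>T. openin (top_of_set S') T \<and> p \<in> T \<and> T \<subseteq> S"
    using local_paramD(4)[OF local_param_mono[OF assms(2,3) l(1)]] local_paramD(5)[OF l(1)] by blast
qed

section \<open>Passage to a relatively open part of a surface\<close>

context
  fixes S' S0 :: "heis set"
  assumes S': "smooth_surface S'" and open_part: "openin (top_of_set S') S0"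
begin

lemma open_part_param_mono: "local_param S0 U \<phi> \<Longrightarrow> local_param S' U \<phi>"
  using openin_trans[OF _ open_part] by (auto simp: local_param_def)

lemma open_part_param:
  assumes "local_param S' U \<phi>" "p \<in> \<phi> ` U" "p \<in> S0"
  obtains V where "local_param S0 V \<phi>" "V \<subseteq> U" "p \<in> \<phi> ` V"
proof -
  let ?V = "U \<inter> \<phi> -` S0"
  note lp = local_paramD[OF assms(1)]
  have "openin (top_of_set U) ?V"
    by (rule continuous_openin_preimage[OF lp(7) _ open_part]) (use lp(5) in auto)
  then have "open ?V" using lp(1) openin_open_trans by blast
  then have l: "local_param S' ?V \<phi>" by (rule local_param_subset[OF S' assms(1)]) auto
  then have "local_param S0 ?V \<phi>"
    using openin_subset_trans[OF local_paramD(4)[OF l] _ openin_imp_subset[OF open_part]]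
    by (auto simp: local_param_def)
  then show ?thesis using that[of ?V] assms by auto
qed

lemma smooth_surface_open_part: "smooth_surface S0"
  unfolding smooth_surface_def
proof
  fix p assume p: "p \<in> S0"
  then have "p \<in> S'" using openin_imp_subset[OF open_part] by auto
  then obtain U \<phi> where "local_param S' U \<phi>" "p \<in> \<phi> ` U" using S' unfolding smooth_surface_def by blast
  then show "\<exists>U \<phi>. local_param S0 U \<phi> \<and> p \<in> \<phi> ` U" using open_part_param p by metis
qed

lemma tangent_space_open_part:
  assumes "p \<in> S0"
  shows "tangent_space S0 p = tangent_space S' p"
proof
  show "tangent_space S0 p \<subseteq> tangent_space S' p"
    unfolding tangent_space_def using open_part_param_mono by blast
  show "tangent_space S' p \<subseteq> tangent_space S0 p"
  proof
    fix v assume "v \<in> tangent_space S' p"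
    then obtain U \<phi> u w where *: "local_param S' U \<phi>" "u \<in> U" "\<phi> u = p" "v = frechet_derivative \<phi> (at u) w"
      unfolding tangent_space_def by blast
    then obtain V where V: "local_param S0 V \<phi>" "V \<subseteq> U" "p \<in> \<phi> ` V"
      using open_part_param[OF *(1) _ assms] by blast
    have "u \<in> V" using V(2,3) *(2,3) local_paramD(6)[OF *(1)] by (auto dest: inj_onD)
    then show "v \<in> tangent_space S0 p" unfolding tangent_space_def using * V by blast
  qed
qed

lemma regular_point_open_part: "p \<in> S0 \<Longrightarrow> regular_point S0 p \<longleftrightarrow> regular_point S' p"
  using tangent_space_open_part openin_imp_subset[OF open_part]
  by (auto simp: regular_point_def singular_point_def)

lemma characteristic_field_open_part:
  assumes "\<phi> ` U \<subseteq> S0"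
  shows "characteristic_field S0 U \<phi> e \<longleftrightarrow> characteristic_field S' U \<phi> e"
  unfolding characteristic_field_def
  using assms tangent_space_open_part regular_point_open_part by (auto simp: image_subset_iff)

lemma p_minimal_surface_open_part:
  assumes "p_minimal_surface S'"
  shows "p_minimal_surface S0"
  using assms smooth_surface_open_part open_part_param_mono characteristic_field_open_part local_paramD(5)
  unfolding p_minimal_surface_def by metis

lemma general_type_coords_open_part:
  assumes "local_param S0 D X"
  shows "general_type_coords S0 D X c1 c2 \<longleftrightarrow> general_type_coords S' D X c1 c2"
proof -
  have "X ` D \<subseteq> S0" using local_paramD(5)[OF assms] .
  then have "alpha_function S0 (X u) e = alpha_function S' (X u) e" if "u \<in> D" for u e
    using tangent_space_open_part that unfolding alpha_function_def by (auto simp: image_subset_iff)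
  then show ?thesis
    unfolding general_type_coords_def compatible_coords_def
    using assms open_part_param_mono[OF assms] characteristic_field_open_part[OF \<open>X ` D \<subseteq> S0\<close>]
    by (simp add: case_prod_beta cong: ball_cong)
qed

end

text \<open>\<open>tangent_space\<close> collects vectors from all charts through the point. That
  two charts give the same plane needs a differentiable transition map, obtained by flattening the
  second chart with a linear left inverse \<open>L\<close> of its differential:
  \<open>L \<circ> \<phi>'\<close> has the identity as derivative at \<open>u'\<close> and can be
  inverted smoothly.\<close>

lemma tangent_space_param_le:
  assumes l: "local_param S U \<phi>" and l': "local_param S U' \<phi>'" and u: "u \<in> U" "u' \<in> U'" "\<phi> u = \<phi>' u'"
  shows "frechet_derivative \<phi> (at u) w \<in> range (frechet_derivative \<phi>' (at u'))"
proof -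
  let ?D = "frechet_derivative \<phi>' (at u')"
  note d = local_paramD[OF l] and d' = local_paramD[OF l']
  have lin: "linear ?D" using d'(8)[OF u(2)] has_derivative_linear by blast
  obtain L where L: "linear L" "L \<circ> ?D = id"
    using linear_injective_left_inverse[OF lin d'(3)[OF u(2)]] by auto
  have bL: "bounded_linear L" using L(1) by (simp add: linear_conv_bounded_linear)
  let ?f = "\<lambda>x. L (\<phi>' x)"
  have sf: "smooth_on U' ?f" by (rule smooth_on_bounded_linear[OF bL d'(1,2)])
  have "(?f has_derivative (\<lambda>v. L (?D v))) (at u')"
    by (rule bounded_linear.has_derivative[OF bL d'(8)[OF u(2)]])
  moreover have "(\<lambda>v. L (?D v)) = (\<lambda>v. v)" using L(2) by (auto simp: fun_eq_iff)
  ultimately have "frechet_derivative ?f (at u') = (\<lambda>v. v)" using frechet_derivative_at by metis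
  then have "jac ?f u' \<noteq> 0" by simp
  then obtain V g where V: "open V" "u' \<in> V" "V \<subseteq> U'" "inj_on ?f V" "open (?f ` V)"
    "\<And>x. x \<in> V \<Longrightarrow> g (?f x) = x" "smooth_on (?f ` V) g"
    using smooth_local_inverse[OF d'(1) sf u(2)] by metis
  \<comment> \<open>Near \<open>u\<close>, the transition map is \<open>g \<circ> L \<circ> \<phi>\<close>, hence differentiable.\<close>
  have "openin (top_of_set S) (\<phi>' ` V)"
  proof -
    obtain \<psi> where "homeomorphism U' (\<phi>' ` U') \<phi>' \<psi>" using d'(9) ..
    then have "openin (top_of_set (\<phi>' ` U')) (\<phi>' ` V)"
      using V(1,3) open_subset homeomorphism_imp_open_map by metis
    then show ?thesis using openin_trans d'(4) by blast
  qed
  then have "openin (top_of_set U) (U \<inter> \<phi> -` (\<phi>' ` V))"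
    using continuous_openin_preimage[OF d(7)] d(5) by blast
  then have oW: "open (U \<inter> \<phi> -` (\<phi>' ` V))" (is "open ?W") using d(1) openin_open_trans by blast
  have uW: "u \<in> ?W" using u V(2) by auto
  have eq: "\<phi>' (g (L (\<phi> x))) = \<phi> x" if "x \<in> ?W" for x using that V(6) by auto
  have Lu: "L (\<phi> u) \<in> ?f ` V" "g (L (\<phi> u)) = u'" using V(2,6) u(3) by auto
  have 1: "((\<lambda>x. L (\<phi> x)) has_derivative (\<lambda>w. L (frechet_derivative \<phi> (at u) w))) (at u)"
    by (rule bounded_linear.has_derivative[OF bL d(8)[OF u(1)]])
  have 2: "(g has_derivative frechet_derivative g (at (L (\<phi> u)))) (at (L (\<phi> u)))"
    by (rule smooth_on_has_derivative[OF V(7) Lu(1)])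
  have 3: "((\<lambda>x. g (L (\<phi> x))) has_derivative
      (\<lambda>w. frechet_derivative g (at (L (\<phi> u))) (L (frechet_derivative \<phi> (at u) w)))) (at u)"
    using diff_chain_at[OF 1 2] by (simp add: o_def)
  have "((\<lambda>x. \<phi>' (g (L (\<phi> x)))) has_derivative
      (\<lambda>w. ?D (frechet_derivative g (at (L (\<phi> u))) (L (frechet_derivative \<phi> (at u) w))))) (at u)"
    using diff_chain_at[OF 3] d'(8)[OF u(2)] Lu(2) by (simp add: o_def)
  then have "(\<phi> has_derivative
      (\<lambda>w. ?D (frechet_derivative g (at (L (\<phi> u))) (L (frechet_derivative \<phi> (at u) w))))) (at u)"
    by (rule has_derivative_transform_within_open[OF _ oW uW eq])
  then show ?thesis using frechet_derivative_at by (metis rangeI)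
qed

lemma tangent_space_param:
  assumes "local_param S U \<phi>" "u \<in> U"
  shows "tangent_space S (\<phi> u) = range (frechet_derivative \<phi> (at u))"
proof
  show "range (frechet_derivative \<phi> (at u)) \<subseteq> tangent_space S (\<phi> u)"
    unfolding tangent_space_def using assms by blast
  show "tangent_space S (\<phi> u) \<subseteq> range (frechet_derivative \<phi> (at u))"
  proof
    fix v assume "v \<in> tangent_space S (\<phi> u)"
    then obtain U' \<phi>' u' w where "local_param S U' \<phi>'" "u' \<in> U'" "\<phi>' u' = \<phi> u"
      "v = frechet_derivative \<phi>' (at u') w" unfolding tangent_space_def by auto
    then show "v \<in> range (frechet_derivative \<phi> (at u))"
      using tangent_space_param_le[of S U' \<phi>' U \<phi> u' u w] assms by auto
  qed
qed

section \<open>Characteristic lines and the alpha function\<close>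

lemma contact_form_eq:
  "contact_form p v = snd (snd v) + fst p * fst (snd v) - fst (snd p) * fst v"
  by (cases p; cases v) auto

lemma from_frame_eq:
  "from_frame p w = (fst w, fst (snd w), fst (snd p) * fst w - fst p * fst (snd w) + snd (snd w))"
  by (cases p; cases w) (auto simp: from_frame_def T_def)

lemma J_eq: "J p v = (- fst (snd v), fst v, - fst (snd p) * fst (snd v) - fst p * fst v)"
  by (cases p; cases v) (auto simp: J_def to_frame_def from_frame_def)

lemma adapted_metric_eq:
  "adapted_metric p v v = (fst v)\<^sup>2 + (fst (snd v))\<^sup>2 + (contact_form p v)\<^sup>2"
  by (simp add: adapted_metric_def to_frame_def inner_prod_def power2_eq_square)

lemma contact_form_linear [simp]:
  "contact_form p (v + w) = contact_form p v + contact_form p w"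
  "contact_form p (v - w) = contact_form p v - contact_form p w"
  "contact_form p (r *\<^sub>R v) = r * contact_form p v"
  "contact_form p (- v) = - contact_form p v"
  "contact_form p 0 = 0"
  by (simp_all add: contact_form_eq algebra_simps)

lemma contact_form_J [simp]: "contact_form p (J p v) = 0"
  by (simp add: contact_form_eq J_eq)

lemma contact_form_from_frame [simp]: "contact_form p (from_frame p w) = snd (snd w)"
  by (simp add: contact_form_eq from_frame_eq algebra_simps)

lemma contact_form_T [simp]: "contact_form p T = 1"
  by (simp add: contact_form_eq T_def)

text \<open>\<open>dx\<close>, \<open>dy\<close> and \<Theta> form a coframe. Comparing vectors
  through \<Theta> instead of the third Euclidean component keeps horizontality visible in
  computations.\<close>

lemma heis_vector_eqI:
  "fst v = fst w \<Longrightarrow> fst (snd v) = fst (snd w) \<Longrightarrow> contact_form p v = contact_form p w \<Longrightarrow> v = w"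
  by (simp add: contact_form_eq prod_eq_iff)

lemma has_vector_derivative_partial_fst:
  assumes "(f has_derivative f') (at (x, y))"
  shows "((\<lambda>t. f (t, y)) has_vector_derivative f' (1, 0)) (at x within A)"
proof -
  have "((\<lambda>t. (t, y)) has_derivative (\<lambda>h. (h, 0))) (at x)"
    by (intro has_derivative_Pair has_derivative_ident has_derivative_const)
  then have "((\<lambda>t. f (t, y)) has_derivative (\<lambda>h. f' (h, 0))) (at x)"
    using diff_chain_at[of "\<lambda>t. (t, y)" "\<lambda>h. (h, 0)" x f f'] assms by (simp add: o_def)
  moreover have "(\<lambda>h. f' (h, 0)) = (\<lambda>h. h *\<^sub>R f' (1, 0))"
  proof
    show "f' (h, 0) = h *\<^sub>R f' (1, 0)" for h
      using linear_cmul[OF has_derivative_linear[OF assms], of h "(1, 0)"] by simp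
  qed
  ultimately show ?thesis
    unfolding has_vector_derivative_def by (metis has_derivative_at_withinI)
qed

lemma has_vector_derivative_partial_snd:
  assumes "(f has_derivative f') (at (x, y))"
  shows "((\<lambda>t. f (x, t)) has_vector_derivative f' (0, 1)) (at y within A)"
proof -
  have "((\<lambda>t. (x, t)) has_derivative (\<lambda>h. (0, h))) (at y)"
    by (intro has_derivative_Pair has_derivative_ident has_derivative_const)
  then have "((\<lambda>t. f (x, t)) has_derivative (\<lambda>h. f' (0, h))) (at y)"
    using diff_chain_at[of "\<lambda>t. (x, t)" "\<lambda>h. (0, h)" y f f'] assms by (simp add: o_def)
  moreover have "(\<lambda>h. f' (0, h)) = (\<lambda>h. h *\<^sub>R f' (0, 1))"
  proof
    show "f' (0, h) = h *\<^sub>R f' (0, 1)" for h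
      using linear_cmul[OF has_derivative_linear[OF assms], of h "(0, 1)"] by simp
  qed
  ultimately show ?thesis
    unfolding has_vector_derivative_def by (metis has_derivative_at_withinI)
qed

lemma characteristic_fieldD:
  assumes "characteristic_field S U \<phi> e" "u \<in> U"
  shows "regular_point S (\<phi> u)" "e u \<in> tangent_space S (\<phi> u)" "contact_form (\<phi> u) (e u) = 0"
    "(fst (e u))\<^sup>2 + (fst (snd (e u)))\<^sup>2 = 1"
  using assms by (auto simp: characteristic_field_def contact_plane_def adapted_metric_eq)

text \<open>Because \<open>E1\<close> and \<open>E2\<close> are parallel, \<open>H = 0\<close> says that the horizontal components of
  \<open>e\<^sub>1\<close> do not change in the direction of \<open>e\<^sub>1\<close>.\<close>

lemma p_minimal_characteristic_parallel:
  assumes S: "p_minimal_surface S" "local_param S U \<phi>" and e: "characteristic_field S U \<phi> e"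
    and u: "u \<in> U" and w: "e u = frechet_derivative \<phi> (at u) w"
  shows "fst (frechet_derivative e (at u) w) = 0" "fst (snd (frechet_derivative e (at u) w)) = 0"
proof -
  note d = local_paramD[OF S(2)]
  define a b where "a = (\<lambda>x. fst (e x))" and "b = (\<lambda>x. fst (snd (e x)))"
  define e' a' b' where "e' = frechet_derivative e (at u)"
    and "a' = (\<lambda>v. fst (e' v))" and "b' = (\<lambda>v. fst (snd (e' v)))"
  have de: "(e has_derivative e') (at u)" unfolding e'_def
    by (rule smooth_on_has_derivative[OF _ u]) (use e in \<open>simp add: characteristic_field_def\<close>)
  have da: "(a has_derivative a') (at u)" and db: "(b has_derivative b') (at u)"
    unfolding a_def b_def a'_def b'_def by (intro derivative_intros de)+
  have unit: "(a x)\<^sup>2 + (b x)\<^sup>2 = 1" if "x \<in> U" for x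
    using characteristic_fieldD(4)[OF e that] by (simp add: a_def b_def)
  have orth: "a u * a' w + b u * b' w = 0"
  proof -
    have "((\<lambda>x. (a x)\<^sup>2 + (b x)\<^sup>2) has_derivative (\<lambda>v. 2 * a u * a' v + 2 * b u * b' v)) (at u)"
      by (auto intro!: derivative_eq_intros da db simp: algebra_simps)
    then have "((\<lambda>x. 1) has_derivative (\<lambda>v. 2 * a u * a' v + 2 * b u * b' v)) (at u)"
      by (rule has_derivative_transform_within_open[OF _ d(1) u unit])
    then have "(\<lambda>v. 2 * a u * a' v + 2 * b u * b' v) = (\<lambda>v. 0)"
      using has_derivative_const has_derivative_unique by blast
    from fun_cong[OF this, of w] have "2 * (a u * a' w + b u * b' w) = 0"
      by (simp only: distrib_left mult.assoc)
    then show ?thesis by (simp only: mult_eq_0_iff zero_neq_numeral[symmetric] simp_thms)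
  qed
  have frame: "to_frame (\<phi> x) (J (\<phi> x) (e x)) = (- b x, a x, 0)" for x
    by (simp add: to_frame_def) (simp add: J_eq a_def b_def)
  have "((\<lambda>x. (- b x, a x, 0::real)) has_derivative (\<lambda>v. (- b' v, a' v, 0))) (at u)"
    by (intro has_derivative_Pair has_derivative_minus has_derivative_const da db)
  then have dJ: "frechet_derivative (\<lambda>x. to_frame (\<phi> x) (J (\<phi> x) (e x))) (at u) = (\<lambda>v. (- b' v, a' v, 0))"
    unfolding frame by (rule frechet_derivative_at[symmetric])
  have "inv (frechet_derivative \<phi> (at u)) (e u) = w"
    unfolding w by (rule inv_f_f[OF d(3)[OF u]])
  then have cov: "cov_deriv \<phi> (\<lambda>x. J (\<phi> x) (e x)) u (e u) = from_frame (\<phi> u) (- b' w, a' w, 0)"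
    by (simp add: cov_deriv_def dJ)
  define H where "H = a u * b' w - b u * a' w"
  have 1: "- b' w = - H * a u" "a' w = - H * b u"
  proof -
    have "- H * a u = - ((a u)\<^sup>2 * b' w - b u * (a u * a' w))"
      by (simp add: H_def algebra_simps power2_eq_square)
    also have "a u * a' w = - b u * b' w" using orth by simp
    also have "- ((a u)\<^sup>2 * b' w - b u * (- b u * b' w)) = - (((a u)\<^sup>2 + (b u)\<^sup>2) * b' w)"
      by (simp add: algebra_simps power2_eq_square)
    finally show "- b' w = - H * a u" using unit[OF u] by simp
    have "- H * b u = - (a u * (b u * b' w) - (b u)\<^sup>2 * a' w)"
      by (simp add: H_def algebra_simps power2_eq_square)
    also have "b u * b' w = - a u * a' w" using orth by simp
    also have "- (a u * (- a u * a' w) - (b u)\<^sup>2 * a' w) = ((a u)\<^sup>2 + (b u)\<^sup>2) * a' w"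
      by (simp add: algebra_simps power2_eq_square)
    finally show "a' w = - H * b u" using unit[OF u] by simp
  qed
  have ec: "contact_form (\<phi> u) (e u) = 0" by (rule characteristic_fieldD(3)[OF e u])
  have cov2: "cov_deriv \<phi> (\<lambda>x. J (\<phi> x) (e x)) u (e u) = - H *\<^sub>R e u"
    unfolding cov
    by (rule heis_vector_eqI[where p = "\<phi> u"])
       (use 1 ec in \<open>simp_all only: contact_form_from_frame contact_form_linear\<close>,
        simp_all add: from_frame_eq a_def b_def)
  \<comment> \<open>A nonzero \<open>e u\<close> makes the factor unique, which the
    \<open>THE\<close> in \<open>p_mean_curvature\<close> requires.\<close>
  have nz: "e u \<noteq> 0" using characteristic_fieldD(4)[OF e u] by auto
  have "p_mean_curvature \<phi> e u = H"
    unfolding p_mean_curvature_def cov2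
    by (rule the_equality) (use nz in \<open>auto simp: scaleR_cancel_right\<close>)
  then have "H = 0" using S e u unfolding p_minimal_surface_def by metis
  then show "fst (frechet_derivative e (at u) w) = 0" "fst (snd (frechet_derivative e (at u) w)) = 0"
    using 1 by (simp_all add: a'_def b'_def e'_def)
qed

section \<open>Coordinates along characteristic curves\<close>

locale characteristic_coords =
  fixes S :: "heis set" and D :: "(real \<times> real) set" and X :: "real \<times> real \<Rightarrow> heis"
  assumes param: "local_param S D X" and char_field: "characteristic_field S D X (coord_e1 X)"
begin

definition coord_y :: "real \<times> real \<Rightarrow> heis" where
  "coord_y u = frechet_derivative X (at u) (0, 1)"

definition Qf :: "real \<times> real \<Rightarrow> real" where
  "Qf u = contact_form (X u) (coord_y u)"

text \<open>The \<open>e\<^sub>2\<close>-component of \<^term>\<open>coord_y u\<close>.\<close>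

definition mf :: "real \<times> real \<Rightarrow> real" where
  "mf u = fst (coord_e1 X u) * fst (snd (coord_y u)) - fst (snd (coord_e1 X u)) * fst (coord_y u)"

lemmas paramD = local_paramD[OF param]
lemmas fieldD = characteristic_fieldD[OF char_field]

lemma derivative_eq:
  assumes "u \<in> D"
  shows "frechet_derivative X (at u) w = fst w *\<^sub>R coord_e1 X u + snd w *\<^sub>R coord_y u"
  unfolding coord_e1_def coord_y_def
  by (rule linear_real_pair[OF has_derivative_linear[OF paramD(8)[OF assms]]])

lemma tangent_space_eq:
  assumes "u \<in> D"
  shows "tangent_space S (X u) = {s *\<^sub>R coord_e1 X u + t *\<^sub>R coord_y u | s t. True}"
  unfolding tangent_space_param[OF param assms]
proof (intro set_eqI iffI)
  fix v assume "v \<in> {s *\<^sub>R coord_e1 X u + t *\<^sub>R coord_y u | s t. True}"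
  then obtain s t where "v = s *\<^sub>R coord_e1 X u + t *\<^sub>R coord_y u" by blast
  then have "v = frechet_derivative X (at u) (s, t)" by (simp add: derivative_eq[OF assms])
  then show "v \<in> range (frechet_derivative X (at u))" by blast
qed (use derivative_eq[OF assms] in blast)

text \<open>If \<Theta> kills \<open>coord_y\<close> as well as \<open>e1\<close>, the whole tangent
  plane is horizontal. Both planes have dimension two, so the point would be singular, against the
  regularity contained in \<open>characteristic_field\<close>.\<close>

lemma Qf_nonzero:
  assumes "u \<in> D"
  shows "Qf u \<noteq> 0"
proof
  assume Q: "Qf u = 0"
  define a b where "a = fst (coord_e1 X u)" and "b = fst (snd (coord_e1 X u))"
  define q r where "q = fst (coord_y u)" and "r = fst (snd (coord_y u))"
  note ec = fieldD(3)[OF assms]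
  have m: "mf u \<noteq> 0"
  proof
    assume m0: "mf u = 0"
    \<comment> \<open>Subtracting from \<open>coord_y\<close> its part along the unit vector
      \<open>e1\<close> leaves nothing when \<open>mf\<close> and \<open>Qf\<close> both vanish, so
      this would be a nonzero kernel vector of the differential.\<close>
    let ?w = "(- (a * q + b * r), 1::real)"
    have un: "a\<^sup>2 + b\<^sup>2 = 1" using fieldD(4)[OF assms] by (simp add: a_def b_def)
    have m: "a * r = b * q" using m0 by (simp add: mf_def a_def b_def q_def r_def)
    have "- (a * q + b * r) * a + q = 0" "- (a * q + b * r) * b + r = 0" using un m by algebra+
    then have "frechet_derivative X (at u) ?w = 0"
      unfolding derivative_eq[OF assms]
      by (intro heis_vector_eqI[where p = "X u"])
         (use Q ec in \<open>simp_all add: Qf_def a_def[symmetric] b_def[symmetric] q_def[symmetric] r_def[symmetric]\<close>)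
    moreover have "frechet_derivative X (at u) 0 = 0" by (simp add: derivative_eq[OF assms])
    ultimately have "?w = 0" by (intro injD[OF paramD(3)[OF assms]]) simp
    then show False by (simp add: prod_eq_iff)
  qed
  have "tangent_space S (X u) = contact_plane (X u)"
  proof
    show "tangent_space S (X u) \<subseteq> contact_plane (X u)"
      using ec Q by (auto simp: tangent_space_eq[OF assms] contact_plane_def Qf_def)
    show "contact_plane (X u) \<subseteq> tangent_space S (X u)"
    proof
      fix v assume v: "v \<in> contact_plane (X u)"
      have md: "mf u = a * r - b * q" by (simp add: mf_def a_def b_def q_def r_def)
      have "v = ((fst v * r - fst (snd v) * q) / mf u) *\<^sub>R coord_e1 X u
          + ((a * fst (snd v) - b * fst v) / mf u) *\<^sub>R coord_y u"
      proof (rule heis_vector_eqI[where p = "X u"])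
        show "contact_form (X u) v = contact_form (X u) (((fst v * r - fst (snd v) * q) / mf u) *\<^sub>R coord_e1 X u
          + ((a * fst (snd v) - b * fst v) / mf u) *\<^sub>R coord_y u)"
          using ec Q v by (simp add: contact_plane_def Qf_def)
      qed (use m in \<open>simp_all add: divide_simps a_def[symmetric] b_def[symmetric] q_def[symmetric] r_def[symmetric]\<close>,
        simp_all add: md algebra_simps)
      then show "v \<in> tangent_space S (X u)" unfolding tangent_space_eq[OF assms] by blast
    qed
  qed
  then show False using fieldD(1)[OF assms] by (auto simp: regular_point_def singular_point_def)
qed

text \<open>Write the vector as \<open>s\<close> times \<open>e1\<close> plus \<open>t\<close> times
  \<open>coord_y\<close>: \<Theta> forces \<open>t = 1 / Qf u\<close>, and the component along
  \<open>e2\<close> then gives \<open>z = t * mf u\<close>. The coefficient \<open>s\<close> cancels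
  the part of \<open>coord_y\<close> along \<open>e1\<close>, so existence and uniqueness for the
  \<open>THE\<close> in \<open>alpha_function\<close> come together.\<close>

lemma alpha_eq_iff:
  assumes "u \<in> D"
  shows "z *\<^sub>R J (X u) (coord_e1 X u) + T \<in> tangent_space S (X u) \<longleftrightarrow> z = mf u / Qf u"
proof -
  define a b where "a = fst (coord_e1 X u)" and "b = fst (snd (coord_e1 X u))"
  define q r where "q = fst (coord_y u)" and "r = fst (snd (coord_y u))"
  note ec = fieldD(3)[OF assms] and Q = Qf_nonzero[OF assms]
  have un: "a\<^sup>2 + b\<^sup>2 = 1" using fieldD(4)[OF assms] by (simp add: a_def b_def)
  have md: "mf u = a * r - b * q" by (simp add: mf_def a_def b_def q_def r_def)
  have eq: "z *\<^sub>R J (X u) (coord_e1 X u) + T = s *\<^sub>R coord_e1 X u + t *\<^sub>R coord_y u \<longleftrightarrow>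
     - z * b = s * a + t * q \<and> z * a = s * b + t * r \<and> 1 = t * Qf u" (is "?l = ?r \<longleftrightarrow> _") for s t
  proof -
    have J: "fst (J (X u) (coord_e1 X u)) = - b" "fst (snd (J (X u) (coord_e1 X u))) = a"
      by (simp_all add: J_eq a_def b_def)
    have "?l = ?r \<longleftrightarrow> fst ?l = fst ?r \<and> fst (snd ?l) = fst (snd ?r) \<and>
        contact_form (X u) ?l = contact_form (X u) ?r"
      using heis_vector_eqI by metis
    then show ?thesis using ec J
      by (simp add: Qf_def a_def[symmetric] b_def[symmetric] q_def[symmetric] r_def[symmetric])
         (simp add: T_def)
  qed
  show ?thesis
  proof
    assume "z *\<^sub>R J (X u) (coord_e1 X u) + T \<in> tangent_space S (X u)"
    then obtain s t where st: "- z * b = s * a + t * q" "z * a = s * b + t * r" "1 = t * Qf u"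
      using eq unfolding tangent_space_eq[OF assms] by blast
    have "z = z * (a\<^sup>2 + b\<^sup>2)" using un by simp
    also have "\<dots> = t * mf u" using st(1,2) unfolding md by algebra
    finally show "z = mf u / Qf u" using st(3) Q by (simp add: field_simps)
  next
    assume z: "z = mf u / Qf u"
    have "- mf u * b = - (a * q + b * r) * a + q" "mf u * a = - (a * q + b * r) * b + r"
      using un unfolding md by algebra+
    then have "- z * b = (- (a * q + b * r) / Qf u) * a + (1 / Qf u) * q \<and>
        z * a = (- (a * q + b * r) / Qf u) * b + (1 / Qf u) * r \<and> 1 = (1 / Qf u) * Qf u"
      using Q unfolding z by (simp add: field_simps)
    then show "z *\<^sub>R J (X u) (coord_e1 X u) + T \<in> tangent_space S (X u)"
      unfolding tangent_space_eq[OF assms] using eq by blast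
  qed
qed

text \<open>The version for \<open>- coord_e1\<close> serves to compare charts that traverse the
  same line in opposite directions.\<close>

lemma alpha_function_eq:
  assumes "u \<in> D"
  shows "alpha_function S (X u) (coord_e1 X u) = mf u / Qf u"
    and "alpha_function S (X u) (- coord_e1 X u) = - (mf u / Qf u)"
proof -
  show "alpha_function S (X u) (coord_e1 X u) = mf u / Qf u"
    unfolding alpha_function_def alpha_eq_iff[OF assms] by simp
  have "J (X u) (- coord_e1 X u) = - J (X u) (coord_e1 X u)" by (simp add: J_eq)
  then have "z *\<^sub>R J (X u) (- coord_e1 X u) + T \<in> tangent_space S (X u) \<longleftrightarrow> z = - (mf u / Qf u)" for z
    using alpha_eq_iff[OF assms, of "- z"] by (simp add: minus_equation_iff[of z] eq_commute)
  then show "alpha_function S (X u) (- coord_e1 X u) = - (mf u / Qf u)"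
    unfolding alpha_function_def by simp
qed

lemma characteristic_direction_unique:
  assumes "u \<in> D" "v \<in> tangent_space S (X u)" "contact_form (X u) v = 0" "(fst v)\<^sup>2 + (fst (snd v))\<^sup>2 = 1"
  shows "v = coord_e1 X u \<or> v = - coord_e1 X u"
proof -
  obtain s t where v: "v = s *\<^sub>R coord_e1 X u + t *\<^sub>R coord_y u"
    using assms(2) unfolding tangent_space_eq[OF assms(1)] by blast
  have "t * Qf u = 0" using assms(3) fieldD(3)[OF assms(1)] by (simp add: v Qf_def)
  then have v: "v = s *\<^sub>R coord_e1 X u" using Qf_nonzero[OF assms(1)] v by simp
  have "s\<^sup>2 * ((fst (coord_e1 X u))\<^sup>2 + (fst (snd (coord_e1 X u)))\<^sup>2) = 1"
    using assms(4) by (simp add: v power_mult_distrib algebra_simps)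
  then have "s = 1 \<or> s = -1" using fieldD(4)[OF assms(1)] by (simp add: power2_eq_1_iff)
  then show ?thesis using v by auto
qed

lemma coord_e1_smooth: "smooth_on D (coord_e1 X)"
  using char_field by (simp add: characteristic_field_def)

end

locale minimal_coords = characteristic_coords +
  assumes minimal: "p_minimal_surface S"
begin

text \<open>Minimality controls only the two horizontal components. The third follows by
  differentiating the identity that \<Theta> vanishes on \<open>e1\<close>: the change of base
  point, being along \<open>e1\<close> itself, contributes \<open>a * b - b * a = 0\<close>, with
  \<open>a\<close> and \<open>b\<close> the horizontal components of \<open>e1\<close>.\<close>

lemma coord_e1_derivative:
  assumes "u \<in> D"
  shows "frechet_derivative (coord_e1 X) (at u) (1, 0) = 0"
proof -
  let ?E = "coord_e1 X" and ?E' = "frechet_derivative (coord_e1 X) (at u)"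
  have w: "?E u = frechet_derivative X (at u) (1, 0)" by (simp add: coord_e1_def)
  note par = p_minimal_characteristic_parallel[OF minimal param char_field assms w]
  have dE: "(?E has_derivative ?E') (at u)" by (rule smooth_on_has_derivative[OF coord_e1_smooth assms])
  have dX: "(X has_derivative frechet_derivative X (at u)) (at u)" by (rule paramD(8)[OF assms])
  have "((\<lambda>x. contact_form (X x) (?E x)) has_derivative
      (\<lambda>v. snd (snd (?E' v)) + (fst (X u) * fst (snd (?E' v)) + fst (frechet_derivative X (at u) v) * fst (snd (?E u)))
         - (fst (snd (X u)) * fst (?E' v) + fst (snd (frechet_derivative X (at u) v)) * fst (?E u)))) (at u)"
    unfolding contact_form_eq by (intro derivative_intros dE dX)
  then have "((\<lambda>x. 0) has_derivative
      (\<lambda>v. snd (snd (?E' v)) + (fst (X u) * fst (snd (?E' v)) + fst (frechet_derivative X (at u) v) * fst (snd (?E u)))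
         - (fst (snd (X u)) * fst (?E' v) + fst (snd (frechet_derivative X (at u) v)) * fst (?E u)))) (at u)"
    by (rule has_derivative_transform_within_open[OF _ paramD(1) assms]) (simp add: fieldD(3))
  from fun_cong[OF has_derivative_unique[OF this has_derivative_const], of "(1, 0)"]
  show ?thesis using par by (simp add: w[symmetric] prod_eq_iff)
qed

text \<open>Constancy of \<open>e1\<close> along a characteristic curve makes the curve a straight
  segment. The hypothesis on the segment is there because horizontal slices of \<open>D\<close> need
  not be connected.\<close>

lemma line:
  assumes "\<And>t. t \<in> closed_segment x0 x \<Longrightarrow> (t, y) \<in> D"
  shows "coord_e1 X (x, y) = coord_e1 X (x0, y)" "X (x, y) = X (x0, y) + (x - x0) *\<^sub>R coord_e1 X (x0, y)"
proof -
  let ?I = "closed_segment x0 x"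
  have "\<exists>c. \<forall>t\<in>?I. coord_e1 X (t, y) = c"
  proof (rule has_vector_derivative_zero_constant)
    show "((\<lambda>t. coord_e1 X (t, y)) has_vector_derivative 0) (at s within ?I)" if "s \<in> ?I" for s
      using has_vector_derivative_partial_fst[OF smooth_on_has_derivative[OF coord_e1_smooth assms[OF that]]]
        coord_e1_derivative[OF assms[OF that]] by simp
  qed auto
  then have E: "coord_e1 X (t, y) = coord_e1 X (x0, y)" if "t \<in> ?I" for t
    using that by (metis ends_in_segment(1))
  show "coord_e1 X (x, y) = coord_e1 X (x0, y)" by (rule E) auto
  let ?f = "\<lambda>t. X (t, y) - (t - x0) *\<^sub>R coord_e1 X (x0, y)"
  have "\<exists>c. \<forall>t\<in>?I. ?f t = c"
  proof (rule has_vector_derivative_zero_constant)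
    fix s assume s: "s \<in> ?I"
    have "((\<lambda>t. X (t, y)) has_vector_derivative coord_e1 X (x0, y)) (at s within ?I)"
      using has_vector_derivative_partial_fst[OF paramD(8)[OF assms[OF s]]] E[OF s] by (simp add: coord_e1_def)
    then show "(?f has_vector_derivative 0) (at s within ?I)"
      by (auto intro!: derivative_eq_intros)
  qed auto
  then have "?f x = ?f x0" by (metis ends_in_segment)
  then show "X (x, y) = X (x0, y) + (x - x0) *\<^sub>R coord_e1 X (x0, y)" by (simp add: algebra_simps)
qed

end

lemma general_type_minimal_coords:
  assumes "p_minimal_surface S" "general_type_coords S D X c1 c2"
  shows "minimal_coords S D X"
  using assms by unfold_locales (auto simp: general_type_coords_def compatible_coords_def)

text \<open>With \<open>s = x + c\<^sub>1\<close>, the function \<open>g s = s / (s\<^sup>2 + c)\<close> satisfies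
  \<open>g' + 2 g\<^sup>2 = 1 / (s\<^sup>2 + c)\<close>, so the denominator of \<open>\<alpha>\<close> is determined by \<open>\<alpha>\<close> along the
  characteristic line.\<close>

lemma general_type_denominator_unique:
  assumes min: "p_minimal_surface S"
    and g: "general_type_coords S D X c1 c2" and g': "general_type_coords S D' X' d1 d2"
    and u: "(x, y) \<in> D" "(x', y') \<in> D'" "X (x, y) = X' (x', y')"
  shows "(x + c1 y)\<^sup>2 + c2 y = (x' + d1 y')\<^sup>2 + d2 y'"
proof -
  interpret A: minimal_coords S D X by (rule general_type_minimal_coords[OF min g])
  interpret B: minimal_coords S D' X' by (rule general_type_minimal_coords[OF min g'])
  define e where "e = coord_e1 X (x, y)"
  have "coord_e1 X' (x', y') = e \<or> coord_e1 X' (x', y') = - e"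
    unfolding e_def
    by (rule A.characteristic_direction_unique[OF u(1)]) (use B.fieldD[OF u(2)] u(3) in auto)
  then obtain \<epsilon> :: real where \<epsilon>: "\<epsilon> = 1 \<or> \<epsilon> = -1" and e': "coord_e1 X' (x', y') = \<epsilon> *\<^sub>R e" by force
  obtain r1 where r1: "r1 > 0" "ball (x, y) r1 \<subseteq> D" using A.paramD(1) u(1) open_contains_ball by blast
  obtain r2 where r2: "r2 > 0" "ball (x', y') r2 \<subseteq> D'" using B.paramD(1) u(2) open_contains_ball by blast
  define r where "r = min r1 r2"
  have in1: "(t, y) \<in> D" if "\<bar>t - x\<bar> < r" for t
    using that r1(2) by (auto simp: r_def dist_Pair_Pair dist_real_def abs_minus_commute subset_iff)
  have in2: "(t, y') \<in> D'" if "\<bar>t - x'\<bar> < r" for t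
    using that r2(2) by (auto simp: r_def dist_Pair_Pair dist_real_def abs_minus_commute subset_iff)
  define g where "g = (\<lambda>t. (x + t + c1 y) / ((x + t + c1 y)\<^sup>2 + c2 y))"
  define h where "h = (\<lambda>t. (x' + \<epsilon> * t + d1 y') / ((x' + \<epsilon> * t + d1 y')\<^sup>2 + d2 y'))"
  have gh: "g t = \<epsilon> * h t" if t: "\<bar>t\<bar> < r" for t
  proof -
    have seg: "s \<in> closed_segment z (z + k) \<Longrightarrow> \<bar>s - z\<bar> \<le> \<bar>k\<bar>" for s z k :: real
      by (auto simp: closed_segment_eq_real_ivl split: if_splits)
    have et: "\<bar>\<epsilon> * t\<bar> = \<bar>t\<bar>" using \<epsilon> by auto
    have s1: "(s, y) \<in> D" if "s \<in> closed_segment x (x + t)" for s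
      using seg[OF that] t by (intro in1) simp
    have s2: "(s, y') \<in> D'" if "s \<in> closed_segment x' (x' + \<epsilon> * t)" for s
      using seg[OF that] t et by (intro in2) simp
    have 1: "coord_e1 X (x + t, y) = e" "X (x + t, y) = X (x, y) + t *\<^sub>R e"
      using A.line[OF s1] by (auto simp: e_def)
    have 2: "coord_e1 X' (x' + \<epsilon> * t, y') = \<epsilon> *\<^sub>R e" "X' (x' + \<epsilon> * t, y') = X (x, y) + t *\<^sub>R e"
      using B.line[OF s2] \<epsilon> by (auto simp: e' u(3))
    have i1: "(x + t, y) \<in> D" and i2: "(x' + \<epsilon> * t, y') \<in> D'" using s1 s2 by auto
    have "g t = alpha_function S (X (x + t, y)) e"
      using \<open>general_type_coords S D X c1 c2\<close> i1 1 by (auto simp: general_type_coords_def g_def)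
    moreover have "h t = alpha_function S (X (x + t, y)) (\<epsilon> *\<^sub>R e)"
      using g' i2 2 1 by (auto simp: general_type_coords_def h_def)
    moreover have "alpha_function S (X (x + t, y)) (\<epsilon> *\<^sub>R e) = \<epsilon> * alpha_function S (X (x + t, y)) e"
      using \<epsilon> A.alpha_function_eq[OF i1] unfolding 1 by auto
    ultimately show ?thesis using \<epsilon> by auto
  qed
  let ?s = "x + c1 y" and ?s' = "x' + d1 y'"
  define U U' where "U = ?s\<^sup>2 + c2 y" and "U' = ?s'\<^sup>2 + d2 y'"
  have U: "U \<noteq> 0" "U' \<noteq> 0"
    using \<open>general_type_coords S D X c1 c2\<close> g' u by (auto simp: general_type_coords_def U_def U'_def)
  \<comment> \<open>The orientation enters twice, through \<alpha> and through the chain rule, so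
    only \<open>\<epsilon> * \<epsilon>\<close> survives in the derivative; likewise in the square
    of \<alpha>.\<close>
  have \<epsilon>2: "\<epsilon> * \<epsilon> = 1" using \<epsilon> by auto
  have dg: "(g has_real_derivative (U - ?s * (2 * ?s)) / (U * U)) (at 0)"
    unfolding g_def U_def
    by (rule derivative_eq_intros refl | use U in \<open>simp add: U_def\<close>)+
  have dh: "((\<lambda>t. \<epsilon> * h t) has_real_derivative \<epsilon> * (\<epsilon> * (U' - ?s' * (2 * ?s')) / (U' * U'))) (at 0)"
    unfolding h_def U'_def
    by (rule derivative_eq_intros refl | use U in \<open>simp add: U'_def algebra_simps\<close>)+
  have r: "r > 0" using r1 r2 by (simp add: r_def)
  have "(g has_real_derivative \<epsilon> * (\<epsilon> * (U' - ?s' * (2 * ?s')) / (U' * U'))) (at 0)"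
    by (rule has_field_derivative_transform_within_open[OF dh, of "{-r<..<r}"]) (use r gh in auto)
  then have "(U - ?s * (2 * ?s)) / (U * U) = \<epsilon> * (\<epsilon> * (U' - ?s' * (2 * ?s')) / (U' * U'))"
    using dg DERIV_unique by blast
  also have "\<dots> = (\<epsilon> * \<epsilon>) * ((U' - ?s' * (2 * ?s')) / (U' * U'))" by simp
  finally have A: "(U - ?s * (2 * ?s)) / (U * U) = (U' - ?s' * (2 * ?s')) / (U' * U')" using \<epsilon>2 by simp
  have "g 0 = \<epsilon> * h 0" using gh[of 0] r by simp
  then have "(g 0)\<^sup>2 = (\<epsilon> * \<epsilon>) * (h 0)\<^sup>2" by (simp add: power2_eq_square)
  then have B: "(?s / U)\<^sup>2 = (?s' / U')\<^sup>2" unfolding \<epsilon>2 by (simp add: g_def h_def U_def U'_def)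
  have id: "1 / V = (V - s * (2 * s)) / (V * V) + 2 * (s / V)\<^sup>2" if "V \<noteq> 0" for s V :: real
    using that by (simp add: divide_simps power2_eq_square)
  have "1 / U = 1 / U'" unfolding id[OF U(1), of ?s] id[OF U(2), of ?s'] A B ..
  then show ?thesis using U by (simp add: U_def U'_def)
qed

section \<open>Ruled extension across the boundary curve\<close>

text \<open>For a unit horizontal \<open>v\<close> this is the component of \<open>w\<close> along
  \<open>J v\<close>.\<close>

abbreviation cross :: "heis \<Rightarrow> heis \<Rightarrow> real" where
  "cross v w \<equiv> fst v * fst (snd w) - fst (snd v) * fst w"

lemma smooth_on_frechet_real:
  fixes f :: "real \<Rightarrow> 'a::euclidean_space"
  assumes "smooth_on U f" "t \<in> U"
  shows "(f has_derivative (\<lambda>h. h *\<^sub>R frechet_derivative f (at t) 1)) (at t)"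
proof -
  have d: "(f has_derivative frechet_derivative f (at t)) (at t)"
    by (rule smooth_on_has_derivative[OF assms])
  have "frechet_derivative f (at t) = (\<lambda>h. h *\<^sub>R frechet_derivative f (at t) 1)"
  proof
    show "frechet_derivative f (at t) h = h *\<^sub>R frechet_derivative f (at t) 1" for h
      using linear_cmul[OF has_derivative_linear[OF d], of h 1] by simp
  qed
  then show ?thesis using d by (simp only:)
qed

section \<open>Families of horizontal lines\<close>

locale line_family =
  fixes N :: "real set" and A v :: "real \<Rightarrow> heis"
  assumes open_N: "open N" and smooth_A: "smooth_on N A" and smooth_v: "smooth_on N v"
    and unit_v: "y \<in> N \<Longrightarrow> (fst (v y))\<^sup>2 + (fst (snd (v y)))\<^sup>2 = 1"
    and contact_v: "y \<in> N \<Longrightarrow> contact_form (A y) (v y) = 0"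
begin

definition Y :: "real \<times> real \<Rightarrow> heis" where "Y u = A (snd u) + fst u *\<^sub>R v (snd u)"

definition A' :: "real \<Rightarrow> heis" where "A' y = frechet_derivative A (at y) 1"
definition v' :: "real \<Rightarrow> heis" where "v' y = frechet_derivative v (at y) 1"

definition Yy :: "real \<times> real \<Rightarrow> heis" where "Yy u = A' (snd u) + fst u *\<^sub>R v' (snd u)"

definition m :: "real \<times> real \<Rightarrow> real" where "m u = cross (v (snd u)) (Yy u)"
definition Q :: "real \<times> real \<Rightarrow> real" where "Q u = contact_form (Y u) (Yy u)"
text \<open>As the horizontal part of \<open>v y\<close> has unit length, this is the rate at which
  the direction of the lines turns.\<close>

definition k :: "real \<Rightarrow> real" where "k y = cross (v y) (v' y)"

lemma open_strip: "open (UNIV \<times> N)"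
  using open_N by (simp add: open_Times)

lemma smooth_strip:
  assumes "smooth_on N g" shows "smooth_on (UNIV \<times> N) (\<lambda>u. g (snd u))"
  by (rule smooth_on_compose[OF open_strip open_N _ assms smooth_on_snd[OF open_strip smooth_on_id[OF open_strip]]])
    auto

lemma smooth_A': "smooth_on N A'" and smooth_v': "smooth_on N v'"
  unfolding A'_def v'_def by (intro smooth_on_frechet_derivative smooth_A smooth_v)+

lemma smooth_Y: "smooth_on (UNIV \<times> N) Y" and smooth_Yy: "smooth_on (UNIV \<times> N) Yy"
  unfolding Y_def Yy_def
  by (intro smooth_intros open_strip smooth_strip smooth_A smooth_v smooth_A' smooth_v')+

lemma has_derivative_A: "y \<in> N \<Longrightarrow> (A has_derivative (\<lambda>h. h *\<^sub>R A' y)) (at y)"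
  and has_derivative_v: "y \<in> N \<Longrightarrow> (v has_derivative (\<lambda>h. h *\<^sub>R v' y)) (at y)"
  unfolding A'_def v'_def by (auto intro: smooth_on_frechet_real smooth_A smooth_v)

lemma has_derivative_Y:
  assumes "snd u \<in> N"
  shows "(Y has_derivative (\<lambda>w. fst w *\<^sub>R v (snd u) + snd w *\<^sub>R Yy u)) (at u)"
proof -
  have s: "(snd has_derivative snd) (at u)" and f: "(fst has_derivative fst) (at u)"
    by (auto intro: derivative_eq_intros)
  have A: "((\<lambda>u. A (snd u)) has_derivative (\<lambda>w. snd w *\<^sub>R A' (snd u))) (at u)"
    using diff_chain_at[OF s has_derivative_A[OF assms]] by (simp add: o_def)
  have v: "((\<lambda>u. v (snd u)) has_derivative (\<lambda>w. snd w *\<^sub>R v' (snd u))) (at u)"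
    using diff_chain_at[OF s has_derivative_v[OF assms]] by (simp add: o_def)
  show ?thesis unfolding Y_def
    by (rule has_derivative_eq_rhs[OF has_derivative_add[OF A has_derivative_scaleR[OF f v]]])
       (auto simp: Yy_def algebra_simps)
qed

lemma coord_e1_Y: "snd u \<in> N \<Longrightarrow> coord_e1 Y u = v (snd u)"
  and frechet_Y_snd: "snd u \<in> N \<Longrightarrow> frechet_derivative Y (at u) (0, 1) = Yy u"
  using frechet_derivative_at[OF has_derivative_Y, of u] unfolding coord_e1_def by (auto dest: sym)

text \<open>Moving the base point along \<open>v\<close> changes the value of \<Theta> on
  \<open>v\<close> by a multiple of the cross product of \<open>v\<close> with itself. So a line
  that is horizontal at one point is horizontal throughout, which allows \<open>Y\<close> to be used
  for all \<open>x\<close>.\<close>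

lemma contact_Y_v: "snd u \<in> N \<Longrightarrow> contact_form (Y u) (v (snd u)) = 0"
  using contact_v[of "snd u"] by (simp add: Y_def contact_form_eq algebra_simps)

text \<open>In other words, \<Theta> at \<open>A y\<close> takes the value \<open>m (0, y)\<close>
  on \<open>v' y\<close>. This explains the factor 2 in the linear coefficient of \<open>Q\<close>:
  one summand comes from \<open>v'\<close>, an equal one from the motion of the base point.\<close>

lemma contact_v_derivative:
  assumes "y \<in> N"
  shows "snd (snd (v' y)) + fst (A y) * fst (snd (v' y)) - fst (snd (A y)) * fst (v' y)
     + fst (A' y) * fst (snd (v y)) - fst (snd (A' y)) * fst (v y) = 0"
proof -
  note dA = has_derivative_A[OF assms] and dv = has_derivative_v[OF assms]
  have "((\<lambda>y. contact_form (A y) (v y)) has_derivative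
     (\<lambda>h. snd (snd (h *\<^sub>R v' y)) + (fst (A y) * fst (snd (h *\<^sub>R v' y)) + fst (h *\<^sub>R A' y) * fst (snd (v y)))
       - (fst (snd (A y)) * fst (h *\<^sub>R v' y) + fst (snd (h *\<^sub>R A' y)) * fst (v y)))) (at y)"
    unfolding contact_form_eq by (intro derivative_intros dA dv)
  then have "((\<lambda>y. 0) has_derivative
     (\<lambda>h. snd (snd (h *\<^sub>R v' y)) + (fst (A y) * fst (snd (h *\<^sub>R v' y)) + fst (h *\<^sub>R A' y) * fst (snd (v y)))
       - (fst (snd (A y)) * fst (h *\<^sub>R v' y) + fst (snd (h *\<^sub>R A' y)) * fst (v y)))) (at y)"
    by (rule has_derivative_transform_within_open[OF _ open_N assms]) (simp add: contact_v)
  from fun_cong[OF has_derivative_unique[OF this has_derivative_const], of 1]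
  show ?thesis by simp
qed

text \<open>This is the structure equation \<open>Q\<^sub>x = 2 m\<close>, integrated.\<close>

lemma m_expand: "m (x, y) = m (0, y) + k y * x"
  and Q_expand: "y \<in> N \<Longrightarrow> Q (x, y) = Q (0, y) + 2 * m (0, y) * x + k y * x\<^sup>2"
proof -
  show "m (x, y) = m (0, y) + k y * x" by (simp add: m_def k_def Yy_def algebra_simps)
  assume "y \<in> N"
  then show "Q (x, y) = Q (0, y) + 2 * m (0, y) * x + k y * x\<^sup>2"
    using contact_v_derivative[of y]
    by (simp add: Q_def m_def k_def Yy_def Y_def contact_form_eq) algebra
qed

lemma inj_derivative_Y:
  assumes "snd u \<in> N" "m u \<noteq> 0 \<or> Q u \<noteq> 0"
  shows "inj (frechet_derivative Y (at u))"
proof -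
  have e: "frechet_derivative Y (at u) = (\<lambda>w. fst w *\<^sub>R v (snd u) + snd w *\<^sub>R Yy u)"
    by (rule frechet_derivative_at[OF has_derivative_Y[OF assms(1)], symmetric])
  have l: "linear (frechet_derivative Y (at u))"
    unfolding e by (rule has_derivative_linear[OF has_derivative_Y[OF assms(1)]])
  show ?thesis
  proof (subst linear_injective_0[OF l], intro allI impI)
    fix w assume "frechet_derivative Y (at u) w = 0"
    then have 0: "fst w *\<^sub>R v (snd u) + snd w *\<^sub>R Yy u = 0" by (simp add: e)
    have "contact_form (Y u) (fst w *\<^sub>R v (snd u) + snd w *\<^sub>R Yy u) = 0" by (simp add: 0)
    then have 1: "snd w * Q u = 0" by (simp add: contact_Y_v[OF assms(1)] Q_def)
    have "cross (v (snd u)) (fst w *\<^sub>R v (snd u) + snd w *\<^sub>R Yy u) = 0" by (simp add: 0)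
    then have 2: "snd w * m u = 0" by (simp add: m_def algebra_simps)
    have w: "snd w = 0" using 1 2 assms(2) by auto
    then have "fst w * fst (v (snd u)) = 0" "fst w * fst (snd (v (snd u))) = 0"
      using 0 by (auto simp: prod_eq_iff)
    then have "fst w = 0" using unit_v[OF assms(1)] by auto
    then show "w = 0" using w by (simp add: prod_eq_iff)
  qed
qed

lemma characteristic_coords_Y:
  assumes "local_param S D Y" "D \<subseteq> UNIV \<times> N" "\<And>u. u \<in> D \<Longrightarrow> Q u \<noteq> 0"
  shows "characteristic_coords S D Y"
    and "u \<in> D \<Longrightarrow> alpha_function S (Y u) (coord_e1 Y u) = m u / Q u"
proof -
  have N: "snd u \<in> N" if "u \<in> D" for u using assms(2) that by auto
  have tan: "frechet_derivative Y (at u) w \<in> tangent_space S (Y u)" if "u \<in> D" for u w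
    using tangent_space_param[OF assms(1) that] by blast
  have reg: "regular_point S (Y u)" if "u \<in> D" for u
  proof -
    have "Yy u \<in> tangent_space S (Y u)" using tan[OF that, of "(0, 1)"] frechet_Y_snd[OF N[OF that]] by simp
    moreover have "Yy u \<notin> contact_plane (Y u)" using assms(3)[OF that] by (simp add: contact_plane_def Q_def)
    ultimately show ?thesis
      using local_paramD(5)[OF assms(1)] that by (auto simp: regular_point_def singular_point_def)
  qed
  have "characteristic_field S D Y (coord_e1 Y)"
    unfolding characteristic_field_def
  proof (intro conjI ballI)
    show "smooth_on D (coord_e1 Y)"
      unfolding coord_e1_def by (intro smooth_on_frechet_derivative smooth_on_subset[OF smooth_Y assms(2)])
    fix u assume u: "u \<in> D"
    show "regular_point S (Y u)" by (rule reg[OF u])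
    show "coord_e1 Y u \<in> tangent_space S (Y u) \<inter> contact_plane (Y u)"
      using tan[OF u, of "(1, 0)"] contact_Y_v[OF N[OF u]] coord_e1_Y[OF N[OF u]]
      by (auto simp: contact_plane_def coord_e1_def)
    show "adapted_metric (Y u) (coord_e1 Y u) (coord_e1 Y u) = 1"
      using unit_v[OF N[OF u]] contact_Y_v[OF N[OF u]] by (simp add: coord_e1_Y[OF N[OF u]] adapted_metric_eq)
  qed
  then show c: "characteristic_coords S D Y" using assms(1) by unfold_locales
  interpret c: characteristic_coords S D Y by (rule c)
  show "alpha_function S (Y u) (coord_e1 Y u) = m u / Q u" if u: "u \<in> D"
    using c.alpha_function_eq(1)[OF u] coord_e1_Y[OF N[OF u]] frechet_Y_snd[OF N[OF u]]
    by (simp add: c.mf_def c.Qf_def c.coord_y_def m_def Q_def)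
qed

end

lemma quadratic_eq_0:
  fixes a b c s h :: real
  assumes "h \<noteq> 0" and P: "\<And>t. t \<in> {0, 1, 2} \<Longrightarrow> a + b * (s + t * h) + c * (s + t * h)\<^sup>2 = 0"
  shows "a = 0" "b = 0" "c = 0"
proof -
  note 0 = P[of 0, simplified] and 1 = P[of 1, simplified] and 2 = P[of 2, simplified]
  have "2 * c * h\<^sup>2 = 0" using 0 1 2 by (simp add: power2_eq_square) algebra
  then show c: "c = 0" using assms(1) by simp
  have "b * h = 0" using 0 1 by (simp add: c) algebra
  then show b: "b = 0" using assms(1) by simp
  show "a = 0" using 0 by (simp add: b c)
qed

text \<open>The curve \<open>x = f y\<close> is a part of the boundary of the coordinate domain \<open>D\<close>, which lies on the side
  of it given by the sign \<open>\<tau>\<close>; \<open>x1\<close> is the \<open>x\<close>-coordinate of a vertical segment inside \<open>D\<close>.\<close>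

locale collar =
  fixes S :: "heis set" and D X c1 c2 and f :: "real \<Rightarrow> real" and N :: "real set" and \<tau> \<delta> x1 :: real
  assumes minimal: "p_minimal_surface S" and general: "general_type_coords S D X c1 c2"
    and open_N: "open N" and cont_f: "continuous_on N f"
    and \<tau>: "\<tau> = 1 \<or> \<tau> = -1" and \<delta>: "\<delta> > 0"
    and side: "\<And>x y. y \<in> N \<Longrightarrow> \<bar>x - f y\<bar> < \<delta> \<Longrightarrow> (x, y) \<in> D \<longleftrightarrow> 0 < \<tau> * (x - f y)"
    and x1: "\<And>y. y \<in> N \<Longrightarrow> 0 < \<tau> * (x1 - f y) \<and> \<tau> * (x1 - f y) < \<delta>"
    and f_root: "\<And>y. y \<in> N \<Longrightarrow> (f y + c1 y)\<^sup>2 + c2 y = 0" "\<And>y. y \<in> N \<Longrightarrow> f y + c1 y \<noteq> 0"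
begin

sublocale X: minimal_coords S D X by (rule general_type_minimal_coords[OF minimal general])

definition K :: "(real \<times> real) set" where
  "K = {u. snd u \<in> N \<and> 0 < \<tau> * (fst u - f (snd u)) \<and> \<tau> * (fst u - f (snd u)) < \<delta>}"

lemma \<tau>_abs: "0 < \<tau> * t \<Longrightarrow> \<tau> * t < \<delta> \<Longrightarrow> \<bar>t\<bar> < \<delta>"
  using \<tau> by auto

lemma K_subset: "K \<subseteq> D"
  using side \<tau>_abs by (auto simp: K_def)

lemma open_K: "open K"
proof -
  let ?g = "\<lambda>u. \<tau> * (fst u - f (snd u))"
  have o: "open (UNIV \<times> N)" using open_N by (simp add: open_Times)
  have c: "continuous_on (UNIV \<times> N) ?g"
    by (intro continuous_intros continuous_on_compose2[OF cont_f]) auto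
  have "K = (UNIV \<times> N) \<inter> ?g -` {0<..<\<delta>}" by (auto simp: K_def)
  then show ?thesis using continuous_open_preimage[OF c o] by auto
qed

text \<open>The lines are read off along the straight segment \<open>x = x1\<close> inside
  \<open>D\<close>, because the boundary curve lies outside \<open>D\<close> and \<open>f\<close> is
  only assumed continuous. This makes \<open>v\<close> and \<open>A\<close> smooth on
  \<open>N\<close>; \<open>A\<close> is the point at parameter 0, which may itself lie outside
  \<open>D\<close>.\<close>

definition v :: "real \<Rightarrow> heis" where "v y = coord_e1 X (x1, y)"
definition A :: "real \<Rightarrow> heis" where "A y = X (x1, y) - x1 *\<^sub>R v y"

lemma x1_K: "y \<in> N \<Longrightarrow> (x1, y) \<in> K"
  using x1 by (simp add: K_def)

lemma x1_D: "y \<in> N \<Longrightarrow> (x1, y) \<in> D"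
  using x1_K K_subset by blast

sublocale line_family N A v
proof
  have im: "(\<lambda>y. (x1, y)) ` N \<subseteq> D" using x1_D by auto
  have s: "smooth_on N (\<lambda>y. (x1, y))" by (intro smooth_intros open_N)
  show sv: "smooth_on N v" unfolding v_def
    by (rule smooth_on_compose[OF open_N X.paramD(1) im X.coord_e1_smooth s])
  show "smooth_on N A" unfolding A_def
    by (intro smooth_intros open_N sv smooth_on_compose[OF open_N X.paramD(1) im X.paramD(2) s])
  show "open N" by (rule open_N)
  fix y assume y: "y \<in> N"
  show "(fst (v y))\<^sup>2 + (fst (snd (v y)))\<^sup>2 = 1" unfolding v_def by (rule X.fieldD(4)[OF x1_D[OF y]])
  show "contact_form (A y) (v y) = 0"
    using X.fieldD(3)[OF x1_D[OF y]]
    by (simp add: A_def v_def[symmetric] contact_form_eq algebra_simps)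
qed

lemma X_eq_Y:
  assumes "u \<in> K"
  shows "X u = Y u" "coord_e1 X u = v (snd u)"
proof -
  obtain x y where u: "u = (x, y)" by fastforce
  have y: "y \<in> N" using assms by (simp add: K_def u)
  have seg: "(t, y) \<in> D" if "t \<in> closed_segment x1 x" for t
  proof -
    have "\<tau> * t \<in> closed_segment (\<tau> * x1) (\<tau> * x)"
      using that \<tau> by (auto simp: closed_segment_eq_real_ivl split: if_splits)
    then have "0 < \<tau> * (t - f y)" "\<tau> * (t - f y) < \<delta>"
      using x1[OF y] assms by (auto simp: K_def u algebra_simps closed_segment_eq_real_ivl split: if_splits)
    then have "(t, y) \<in> K" using y by (simp add: K_def)
    then show ?thesis using K_subset by blast
  qed
  show "X u = Y u" "coord_e1 X u = v (snd u)"
    using X.line[OF seg] by (simp_all add: u Y_def A_def v_def algebra_simps)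
qed

lemma coord_y_eq: "u \<in> K \<Longrightarrow> X.coord_y u = Yy u"
proof -
  assume u: "u \<in> K"
  then have N: "snd u \<in> N" by (simp add: K_def)
  have "(X has_derivative (\<lambda>w. fst w *\<^sub>R v (snd u) + snd w *\<^sub>R Yy u)) (at u)"
    by (rule has_derivative_transform_within_open[OF has_derivative_Y[OF N] open_K u]) (simp add: X_eq_Y)
  from frechet_derivative_at[OF this] show ?thesis by (auto simp: X.coord_y_def dest: sym)
qed

lemma m_div_Q:
  assumes "u \<in> K"
  shows "Q u \<noteq> 0" "m u / Q u = (fst u + c1 (snd u)) / ((fst u + c1 (snd u))\<^sup>2 + c2 (snd u))"
    "(fst u + c1 (snd u))\<^sup>2 + c2 (snd u) \<noteq> 0"
proof -
  have D: "u \<in> D" using assms K_subset by auto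
  have "X.Qf u = Q u" "X.mf u = m u"
    by (simp_all add: X.Qf_def X.mf_def Q_def m_def coord_y_eq[OF assms] X_eq_Y[OF assms])
  then show "Q u \<noteq> 0" "m u / Q u = (fst u + c1 (snd u)) / ((fst u + c1 (snd u))\<^sup>2 + c2 (snd u))"
    "(fst u + c1 (snd u))\<^sup>2 + c2 (snd u) \<noteq> 0"
    using X.Qf_nonzero[OF D] X.alpha_function_eq(1)[OF D] general D
    by (auto simp: general_type_coords_def)
qed

text \<open>In the variable \<open>x + c1 y\<close>, \<open>m\<close> is affine and \<open>Q\<close>
  quadratic. Clearing denominators in the formula for \<alpha> cancels the cubic terms and leaves a
  quadratic identity, whose vanishing coefficients give \<open>n0 = 0\<close> and
  \<open>q = k y * c2 y\<close>.\<close>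

lemma m_Q_eq:
  assumes y: "y \<in> N"
  shows "m (x, y) = k y * (x + c1 y)" "Q (x, y) = k y * ((x + c1 y)\<^sup>2 + c2 y)" "k y \<noteq> 0"
proof -
  define n0 where "n0 = m (0, y) - k y * c1 y"
  define q where "q = Q (0, y) - 2 * m (0, y) * c1 y + k y * (c1 y)\<^sup>2"
  have m: "m (x, y) = n0 + k y * (x + c1 y)" for x
    by (subst m_expand) (simp add: n0_def algebra_simps)
  have Q: "Q (x, y) = q + 2 * n0 * (x + c1 y) + k y * (x + c1 y)\<^sup>2" for x
    by (subst Q_expand[OF y]) (simp add: n0_def q_def algebra_simps power2_eq_square)
  \<comment> \<open>The three sample points lie at horizontal distances \<open>\<delta> / 4\<close>,
    \<open>\<delta> / 2\<close> and \<open>3 * \<delta> / 4\<close> from the curve, well inside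
    \<open>K\<close>.\<close>
  define h s where "h = \<tau> * \<delta> / 4" and "s = f y + c1 y + h"
  have h: "h \<noteq> 0" using \<tau> \<delta> by (auto simp: h_def)
  have inK: "(s + t * h - c1 y, y) \<in> K" if "t \<in> {0, 1, 2}" for t
  proof -
    have "\<tau> * (s + t * h - c1 y - f y) = \<delta> * (1 + t) / 4"
      using \<tau> by (auto simp: s_def h_def field_simps)
    then show ?thesis using that \<delta> y by (auto simp: K_def)
  qed
  have eq: "n0 * c2 y + (k y * c2 y - q) * (s + t * h) + (- n0) * (s + t * h)\<^sup>2 = 0" if t: "t \<in> {0, 1, 2}" for t
  proof -
    let ?s = "s + t * h"
    have "Q (?s - c1 y, y) \<noteq> 0" "?s\<^sup>2 + c2 y \<noteq> 0"
      "m (?s - c1 y, y) / Q (?s - c1 y, y) = ?s / (?s\<^sup>2 + c2 y)"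
      using m_div_Q[OF inK[OF t]] by simp_all
    then have "m (?s - c1 y, y) * (?s\<^sup>2 + c2 y) = ?s * Q (?s - c1 y, y)"
      by (simp add: frac_eq_eq)
    then have "(n0 + k y * ?s) * (?s\<^sup>2 + c2 y) = ?s * (q + 2 * n0 * ?s + k y * ?s\<^sup>2)"
      unfolding m Q by simp
    then show ?thesis by (simp add: power2_eq_square algebra_simps)
  qed
  have n0: "n0 = 0" and q: "q = k y * c2 y" using quadratic_eq_0[OF h eq] by auto
  show "m (x, y) = k y * (x + c1 y)" using m[of x] n0 by simp
  show Q': "Q (x, y) = k y * ((x + c1 y)\<^sup>2 + c2 y)" for x
    using Q[of x] n0 q by (simp add: algebra_simps)
  show "k y \<noteq> 0" using m_div_Q(1)[OF inK[of 0]] Q' by auto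
qed

lemma Q_boundary: "y \<in> N \<Longrightarrow> Q (f y, y) = 0" and m_boundary: "y \<in> N \<Longrightarrow> m (f y, y) \<noteq> 0"
  using m_Q_eq f_root by auto

end

section \<open>Passing through the singular curve\<close>

lemma has_real_derivative_locally_zero:
  fixes g :: "real \<Rightarrow> real"
  assumes "(g has_real_derivative d) (at t)" "open A" "t \<in> A" "\<And>s. s \<in> A \<Longrightarrow> g s = 0"
  shows "d = 0"
proof -
  have "((\<lambda>s. 0) has_real_derivative d) (at t)"
    by (rule has_field_derivative_transform_within_open[OF assms(1-3)]) (simp add: assms(4))
  then show ?thesis using DERIV_const DERIV_unique by blast
qed

lemma linear_bound_at_0:
  fixes g g' :: "real \<Rightarrow> real"
  assumes "\<And>t. t \<in> {0..h} \<Longrightarrow> (g has_real_derivative g' t) (at t)"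
    and "continuous_on {0..h} g'" "g 0 = 0"
  shows "\<exists>M. \<forall>t\<in>{0..h}. \<bar>g t\<bar> \<le> M * t"
proof -
  have "compact (g' ` {0..h})" by (intro compact_continuous_image assms(2)) auto
  then have "bounded (g' ` {0..h})" by (rule compact_imp_bounded)
  then obtain M where M: "\<And>t. t \<in> {0..h} \<Longrightarrow> \<bar>g' t\<bar> \<le> M" unfolding bounded_iff by force
  have "\<bar>g t\<bar> \<le> M * t" if t: "t \<in> {0..h}" for t
    using field_differentiable_bound[of "{0..h}" g g' M 0 t] assms(1) M t assms(3) by (auto intro: has_field_derivative_at_within)
  then show ?thesis by blast
qed

text \<open>The ratio \<open>r = a / b\<close> satisfies \<open>r' = r (\<alpha>\<^sub>2 - r \<beta>\<^sub>2) / b\<close>.  Near \<open>t = 0\<close> one has \<open>b \<ge> t\<close>,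
  \<open>r = O(t)\<close> and \<open>\<alpha>\<^sub>2 = O(t)\<close>, so this is a linear equation with bounded coefficient and
  zero initial value.\<close>

lemma degenerate_ode_zero:
  fixes a b \<alpha>1 \<alpha>2 \<beta>1 \<beta>2 :: "real \<Rightarrow> real" and h M :: real
  assumes da: "\<And>t. t \<in> {0..h} \<Longrightarrow> (a has_real_derivative \<alpha>1 t) (at t)"
    and db: "\<And>t. t \<in> {0..h} \<Longrightarrow> (b has_real_derivative \<beta>1 t) (at t)"
    and 0: "a 0 = 0" "b 0 = 0"
    and \<alpha>1: "\<And>t. t \<in> {0..h} \<Longrightarrow> \<bar>\<alpha>1 t\<bar> \<le> M * t" and \<alpha>2: "\<And>t. t \<in> {0..h} \<Longrightarrow> \<bar>\<alpha>2 t\<bar> \<le> M * t"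
    and \<beta>1: "\<And>t. t \<in> {0..h} \<Longrightarrow> \<beta>1 t \<ge> 1" and \<beta>2: "\<And>t. t \<in> {0..h} \<Longrightarrow> \<bar>\<beta>2 t\<bar> \<le> M"
    and eq: "\<And>t. t \<in> {0<..h} \<Longrightarrow> (b t)\<^sup>2 * \<alpha>1 t - a t * b t * (\<alpha>2 t + \<beta>1 t) + (a t)\<^sup>2 * \<beta>2 t = 0"
    and t: "t \<in> {0..h}"
  shows "a t = 0"
proof (cases "t = 0")
  case False
  then have tp: "t \<in> {0<..h}" and h: "h > 0" using t by auto
  have M: "M \<ge> 0" using \<beta>2[of 0] h by simp
  have b: "b s \<ge> s" if "s \<in> {0..h}" for s
  proof -
    have "b 0 - 0 \<le> b s - s"
    proof (rule DERIV_nonneg_imp_nondecreasing[where f = "\<lambda>t. b t - t"])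
      fix x assume "0 \<le> x" "x \<le> s"
      then have "x \<in> {0..h}" using that by auto
      then have "((\<lambda>t. b t - t) has_real_derivative \<beta>1 x - 1) (at x)" "\<beta>1 x - 1 \<ge> 0"
        using db \<beta>1 by (auto intro!: derivative_eq_intros)
      then show "\<exists>y. ((\<lambda>t. b t - t) has_real_derivative y) (at x) \<and> 0 \<le> y" by blast
    qed (use that in auto)
    then show ?thesis using 0 by simp
  qed
  \<comment> \<open>Integrating the bound \<open>M * t\<close> on the derivative makes
    \<open>a\<close> vanish to second order while \<open>b\<close> vanishes only to first, which is
    why the quotient tends to zero.\<close>
  have a: "\<bar>a s\<bar> \<le> (M * s) * s" if s: "s \<in> {0..h}" for s
  proof -
    have "norm (a s - a 0) \<le> (M * s) * norm (s - 0)"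
    proof (rule field_differentiable_bound[of "{0..s}" a \<alpha>1])
      show "(a has_field_derivative \<alpha>1 x) (at x within {0..s})" if "x \<in> {0..s}" for x
        using da[of x] that s by (auto intro: has_field_derivative_at_within)
      show "norm (\<alpha>1 x) \<le> M * s" if "x \<in> {0..s}" for x
        using \<alpha>1[of x] mult_left_mono[of x s M] M that s by auto
    qed (use s in auto)
    then show ?thesis using 0 s by simp
  qed
  define r where "r = (\<lambda>s. a s / b s)"
  define C where "C = M + M * M"
  define r' where "r' s = (\<alpha>1 s * b s - a s * \<beta>1 s) / (b s * b s)" for s
  have dr: "(r has_real_derivative r' s) (at s)" if s: "s \<in> {0<..h}" for s
    unfolding r_def r'_def
  proof (rule DERIV_divide)
    show "(a has_field_derivative \<alpha>1 s) (at s)" "(b has_field_derivative \<beta>1 s) (at s)"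
      using da[of s] db[of s] s by auto
    show "b s \<noteq> 0" using b[of s] s by auto
  qed
  have rb: "\<bar>r s\<bar> \<le> M * s" if s: "s \<in> {0<..h}" for s
  proof -
    have "\<bar>a s\<bar> \<le> (M * s) * b s"
      using a[of s] mult_left_mono[OF b[of s], of "M * s"] M s by auto
    then show ?thesis using b[of s] s by (simp add: r_def abs_divide divide_le_eq)
  qed
  have r'b: "\<bar>r' s\<bar> \<le> C * \<bar>r s\<bar>" if s: "s \<in> {0<..h}" for s
  proof -
    have bs: "b s \<ge> s" "s > 0" using b[of s] s by auto
    \<comment> \<open>Dividing the quadratic equation by \<open>(b s)\<^sup>2\<close> expresses
      \<open>\<alpha>1 s\<close> through \<open>r s\<close>. In the quotient rule the
      \<open>\<beta>1\<close> terms then cancel, and the factor divided by \<open>b s\<close> is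
      itself \<open>O(s)\<close>.\<close>
    have "r' s = r s * (\<alpha>2 s - r s * \<beta>2 s) / b s"
      using eq[OF s] bs unfolding r_def r'_def
      by (simp add: divide_simps power2_eq_square) algebra
    then have "\<bar>r' s\<bar> = \<bar>r s\<bar> * (\<bar>\<alpha>2 s - r s * \<beta>2 s\<bar> / b s)" using bs by (simp add: abs_mult)
    moreover have "\<bar>\<alpha>2 s - r s * \<beta>2 s\<bar> \<le> C * b s"
    proof -
      have "\<bar>\<alpha>2 s - r s * \<beta>2 s\<bar> \<le> \<bar>\<alpha>2 s\<bar> + \<bar>r s\<bar> * \<bar>\<beta>2 s\<bar>"
        using abs_triangle_ineq4[of "\<alpha>2 s" "r s * \<beta>2 s"] by (simp add: abs_mult)
      also have "\<dots> \<le> M * s + (M * s) * M"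
        by (intro add_mono mult_mono \<alpha>2 \<beta>2 rb) (use s M in auto)
      also have "\<dots> = C * s" by (simp add: C_def algebra_simps)
      also have "\<dots> \<le> C * b s" using bs M by (intro mult_left_mono) (auto simp: C_def)
      finally show ?thesis .
    qed
    ultimately show ?thesis
      using bs mult_left_mono[of "\<bar>\<alpha>2 s - r s * \<beta>2 s\<bar> / b s" C "\<bar>r s\<bar>"]
      by (simp add: divide_le_eq mult.commute)
  qed
  \<comment> \<open>The Gronwall quantity: nonincreasing for positive \<open>s\<close>, with limit
    zero at 0 because \<open>r\<close> is \<open>O(s)\<close>. A right-hand limit is taken since at
    0 itself \<open>r\<close> is a quotient of zeros.\<close>
  define G where "G = (\<lambda>s. (r s)\<^sup>2 * exp (- (2 * C * s)))"
  have mono: "G t \<le> G s" if s: "0 < s" "s < t" for s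
  proof (rule DERIV_nonpos_imp_nonincreasing[of s t G])
    fix x assume x: "s \<le> x" "x \<le> t"
    then have xh: "x \<in> {0<..h}" using s tp by auto
    note dr[OF xh]
    then have "(G has_real_derivative (2 * (r x * r' x - C * (r x)\<^sup>2)) * exp (- (2 * C * x))) (at x)"
      unfolding G_def by (auto intro!: derivative_eq_intros simp: algebra_simps power2_eq_square)
    moreover have "r x * r' x \<le> C * (r x)\<^sup>2"
      using mult_left_mono[OF r'b[OF xh], of "\<bar>r x\<bar>"] abs_ge_self[of "r x * r' x"]
      by (auto simp: abs_mult power2_eq_square mult.left_commute)
    then have "(2 * (r x * r' x - C * (r x)\<^sup>2)) * exp (- (2 * C * x)) \<le> 0"
      by (intro mult_nonpos_nonneg[of "2 * _"]) simp_all
    ultimately show "\<exists>y. (G has_real_derivative y) (at x) \<and> y \<le> 0"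
      by blast
  qed (use s in auto)
  have "G t \<le> 0"
  proof (rule tendsto_lowerbound[of "\<lambda>s. (M * s)\<^sup>2" 0 "at_right 0"])
    show "((\<lambda>s. (M * s)\<^sup>2) \<longlongrightarrow> 0) (at_right 0)" by (auto intro!: tendsto_eq_intros)
    show "\<forall>\<^sub>F s in at_right 0. G t \<le> (M * s)\<^sup>2"
      unfolding eventually_at_right_field
    proof (intro exI[of _ t] conjI allI impI)
      fix s assume s: "0 < s" "s < t"
      have "G s \<le> (M * s)\<^sup>2 * 1"
        unfolding G_def using rb[of s] s tp M
        by (intro mult_mono abs_le_square_iff[THEN iffD1]) (auto simp: C_def abs_mult)
      then show "G t \<le> (M * s)\<^sup>2" using mono[OF s] by simp
    qed (use tp in auto)
  qed auto
  then have "r t = 0" unfolding G_def by (simp add: mult_le_0_iff)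
  then show ?thesis using b[of t] tp by (auto simp: r_def)
qed (use 0 in auto)

section \<open>Minimal graphs over the plane\<close>

locale minimal_graph =
  fixes S' :: "heis set" and V :: "(real \<times> real) set" and h :: "real \<times> real \<Rightarrow> real"
  assumes minimal': "p_minimal_surface S'" and smooth_h: "smooth_on V h"
    and graph_param: "local_param S' V (\<lambda>p. (fst p, snd p, h p))"
begin

abbreviation gr :: "real \<times> real \<Rightarrow> heis" where "gr p \<equiv> (fst p, snd p, h p)"

definition hx where "hx p = frechet_derivative h (at p) (1, 0)"
definition hy where "hy p = frechet_derivative h (at p) (0, 1)"

text \<open>The contact form restricted to the graph is \<open>F1 dx + F2 dy\<close>.\<close>

definition F1 where "F1 p = hx p - snd p"
definition F2 where "F2 p = hy p + fst p"

definition F1x where "F1x p = frechet_derivative F1 (at p) (1, 0)"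
definition F1y where "F1y p = frechet_derivative F1 (at p) (0, 1)"
definition F2x where "F2x p = frechet_derivative F2 (at p) (1, 0)"
definition F2y where "F2y p = frechet_derivative F2 (at p) (0, 1)"

lemmas graphD = local_paramD[OF graph_param]

lemma open_V: "open V" by (rule graphD(1))

lemma smooth_hx: "smooth_on V hx" and smooth_hy: "smooth_on V hy"
  unfolding hx_def hy_def by (intro smooth_on_frechet_derivative smooth_h)+

lemma smooth_F1: "smooth_on V F1" and smooth_F2: "smooth_on V F2"
  unfolding F1_def F2_def by (intro smooth_intros open_V smooth_hx smooth_hy)+

lemma smooth_F1x: "smooth_on V F1x" and smooth_F1y: "smooth_on V F1y"
  and smooth_F2x: "smooth_on V F2x" and smooth_F2y: "smooth_on V F2y"
  unfolding F1x_def F1y_def F2x_def F2y_def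
  by (intro smooth_on_frechet_derivative smooth_F1 smooth_F2)+

lemma has_derivative_partials:
  fixes g :: "real \<times> real \<Rightarrow> real"
  assumes "smooth_on V g" "p \<in> V"
  shows "(g has_derivative (\<lambda>w. fst w * frechet_derivative g (at p) (1, 0)
     + snd w * frechet_derivative g (at p) (0, 1))) (at p)"
proof -
  have d: "(g has_derivative frechet_derivative g (at p)) (at p)"
    by (rule smooth_on_has_derivative[OF assms])
  have "frechet_derivative g (at p) = (\<lambda>w. fst w * frechet_derivative g (at p) (1, 0)
     + snd w * frechet_derivative g (at p) (0, 1))"
  proof
    show "frechet_derivative g (at p) w = fst w * frechet_derivative g (at p) (1, 0)
     + snd w * frechet_derivative g (at p) (0, 1)" for w
      using linear_real_pair[OF has_derivative_linear[OF d], of w] by simp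
  qed
  then show ?thesis using d by (simp only:)
qed

lemma
  assumes "p \<in> V"
  shows has_derivative_h: "(h has_derivative (\<lambda>w. fst w * hx p + snd w * hy p)) (at p)"
    and has_derivative_F1: "(F1 has_derivative (\<lambda>w. fst w * F1x p + snd w * F1y p)) (at p)"
    and has_derivative_F2: "(F2 has_derivative (\<lambda>w. fst w * F2x p + snd w * F2y p)) (at p)"
  unfolding hx_def hy_def F1x_def F1y_def F2x_def F2y_def
  by (intro has_derivative_partials smooth_h smooth_F1 smooth_F2 assms)+

lemma frechet_gr:
  assumes "p \<in> V"
  shows "frechet_derivative gr (at p) w = (fst w, snd w, fst w * hx p + snd w * hy p)"
proof -
  have "(gr has_derivative (\<lambda>w. (fst w, snd w, fst w * hx p + snd w * hy p))) (at p)"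
    by (intro has_derivative_Pair has_derivative_h assms derivative_intros)
  from frechet_derivative_at[OF this] show ?thesis by (auto dest: sym)
qed

lemma contact_form_gr:
  "p \<in> V \<Longrightarrow> contact_form (gr p) (frechet_derivative gr (at p) w) = fst w * F1 p + snd w * F2 p"
  by (simp add: frechet_gr contact_form_eq F1_def F2_def algebra_simps)

text \<open>The rotated vector \<open>(- F2 p, F1 p)\<close> spans the kernel of the restricted
  contact form, so \<open>e\<close> below is the characteristic field. By
  \<open>p_minimal_characteristic_parallel\<close> its direction, equivalently that of
  \<open>F\<close>, is constant along itself.\<close>

lemma minimal_equation:
  assumes p: "p \<in> V" and F: "F1 p \<noteq> 0 \<or> F2 p \<noteq> 0"
  shows "F1 p * (F1 p * F2y p - F2 p * F2x p) - F2 p * (F1 p * F1y p - F2 p * F1x p) = 0"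
proof -
  define n where "n = (\<lambda>p. sqrt ((F1 p)\<^sup>2 + (F2 p)\<^sup>2))"
  define V0 where "V0 = V \<inter> (\<lambda>p. (F1 p)\<^sup>2 + (F2 p)\<^sup>2) -` {0<..}"
  have V0: "V0 \<subseteq> V" and pV0: "p \<in> V0" using p F by (auto simp: V0_def sum_power2_gt_zero_iff)
  have smF: "smooth_on V (\<lambda>p. (F1 p)\<^sup>2 + (F2 p)\<^sup>2)"
    unfolding power2_eq_square by (intro smooth_intros open_V smooth_F1 smooth_F2)
  have oV0: "open V0"
    unfolding V0_def
    by (rule continuous_open_preimage[OF smooth_on_continuous_on[OF smF] open_V]) simp
  have npos: "n q > 0" if "q \<in> V0" for q using that by (simp add: V0_def n_def)
  have smn: "smooth_on V0 n"
    unfolding n_def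
    by (rule smooth_on_sqrt[OF oV0 smooth_on_subset[OF smF V0]]) (simp add: V0_def)
  define f1 f2 where "f1 = (\<lambda>q. F1 q / n q)" and "f2 = (\<lambda>q. F2 q / n q)"
  have smf: "smooth_on V0 f1" "smooth_on V0 f2"
    unfolding f1_def f2_def
    by (intro smooth_on_divide oV0 smn smooth_on_subset[OF smooth_F1 V0] smooth_on_subset[OF smooth_F2 V0],
        use npos in force)+
  define w where "w = (\<lambda>q. (- f2 q, f1 q))"
  define e where "e q = (- f2 q, f1 q, - f2 q * hx q + f1 q * hy q)" for q
  have ew: "e q = frechet_derivative gr (at q) (w q)" if "q \<in> V" for q
    by (simp add: frechet_gr[OF that] e_def w_def)
  have lp: "local_param S' V0 gr"
    using local_param_subset[OF _ graph_param oV0 V0] minimal' by (simp add: p_minimal_surface_def)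
  have unit: "(f1 q)\<^sup>2 + (f2 q)\<^sup>2 = 1" if "q \<in> V0" for q
  proof -
    have "(n q)\<^sup>2 = (F1 q)\<^sup>2 + (F2 q)\<^sup>2" by (simp add: n_def)
    then show ?thesis using npos[OF that]
      by (simp add: f1_def f2_def power_divide add_divide_distrib[symmetric] del: sum_power2_eq_zero_iff)
         (metis less_irrefl power2_eq_iff_nonneg zero_eq_power2)
  qed
  have "characteristic_field S' V0 gr e"
    unfolding characteristic_field_def
  proof (intro conjI ballI)
    show "smooth_on V0 e"
      unfolding e_def
      by (intro smooth_intros oV0 smf smooth_on_subset[OF smooth_hx V0] smooth_on_subset[OF smooth_hy V0])
    fix q assume q: "q \<in> V0"
    then have qV: "q \<in> V" using V0 by auto
    have tan: "tangent_space S' (gr q) = range (frechet_derivative gr (at q))"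
      by (rule tangent_space_param[OF lp q])
    have ec: "contact_form (gr q) (e q) = 0"
      unfolding ew[OF qV] contact_form_gr[OF qV] by (simp add: w_def f1_def f2_def)
    show "regular_point S' (gr q)"
    proof -
      have "F1 q \<noteq> 0 \<or> F2 q \<noteq> 0" using q by (auto simp: V0_def)
      then obtain z where "contact_form (gr q) (frechet_derivative gr (at q) z) \<noteq> 0"
        using contact_form_gr[OF qV, of "(1, 0)"] contact_form_gr[OF qV, of "(0, 1)"]
        by (simp del: split_paired_All) metis
      then have "tangent_space S' (gr q) \<noteq> contact_plane (gr q)"
        unfolding tan contact_plane_def by blast
      then show ?thesis
        using local_paramD(5)[OF lp] q by (auto simp: regular_point_def singular_point_def)
    qed
    show "e q \<in> tangent_space S' (gr q) \<inter> contact_plane (gr q)"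
      unfolding tan using ec ew[OF qV] by (auto simp: contact_plane_def)
    show "adapted_metric (gr q) (e q) (e q) = 1"
      using ec unit[OF q] by (simp add: adapted_metric_eq e_def add.commute)
  qed
  note par = p_minimal_characteristic_parallel[OF minimal' lp this pV0 ew[OF p]]
  have d1: "(f1 has_derivative frechet_derivative f1 (at p)) (at p)"
    and d2: "(f2 has_derivative frechet_derivative f2 (at p)) (at p)"
    and dn: "(n has_derivative frechet_derivative n (at p)) (at p)"
    by (rule smooth_on_has_derivative[OF _ pV0], intro smf smn)+
  have de: "(e has_derivative frechet_derivative e (at p)) (at p)"
    using smooth_on_has_derivative[of V0 e] \<open>characteristic_field S' V0 gr e\<close> pV0
    by (simp add: characteristic_field_def)
  have "((\<lambda>q. fst (e q)) has_derivative (\<lambda>w. fst (frechet_derivative e (at p) w))) (at p)"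
    "((\<lambda>q. fst (snd (e q))) has_derivative (\<lambda>w. fst (snd (frechet_derivative e (at p) w)))) (at p)"
    by (intro derivative_intros de)+
  moreover have "(\<lambda>q. fst (e q)) = (\<lambda>q. - f2 q)" "(\<lambda>q. fst (snd (e q))) = f1" by (auto simp: e_def)
  ultimately have "(\<lambda>w. fst (frechet_derivative e (at p) w)) = (\<lambda>w. - frechet_derivative f2 (at p) w)"
    "(\<lambda>w. fst (snd (frechet_derivative e (at p) w))) = frechet_derivative f1 (at p)"
    using has_derivative_unique[OF _ has_derivative_minus[OF d2]] has_derivative_unique[OF _ d1] by simp_all
  then have f0: "frechet_derivative f1 (at p) (w p) = 0" "frechet_derivative f2 (at p) (w p) = 0"
    using par by (metis, metis neg_equal_0_iff_equal)
  \<comment> \<open>Since \<open>F = n f\<close> with \<open>f\<close> constant along \<open>w\<close>, the derivative of \<open>F\<close> along \<open>w\<close> is a multiple of \<open>f\<close>.\<close>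
  have Fn: "F1 q = n q * f1 q" "F2 q = n q * f2 q" if "q \<in> V0" for q
    using npos[OF that] by (simp_all add: f1_def f2_def)
  let ?n' = "frechet_derivative n (at p) (w p)"
  have "(F1 has_derivative (\<lambda>w. n p * frechet_derivative f1 (at p) w + frechet_derivative n (at p) w * f1 p)) (at p)"
    by (rule has_derivative_transform_within_open[OF has_derivative_mult[OF dn d1] oV0 pV0]) (simp add: Fn)
  from has_derivative_unique[OF this has_derivative_F1[OF p], THEN fun_cong, of "w p"]
  have 1: "?n' * f1 p = fst (w p) * F1x p + snd (w p) * F1y p" using f0 by simp
  have "(F2 has_derivative (\<lambda>w. n p * frechet_derivative f2 (at p) w + frechet_derivative n (at p) w * f2 p)) (at p)"
    by (rule has_derivative_transform_within_open[OF has_derivative_mult[OF dn d2] oV0 pV0]) (simp add: Fn)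
  from has_derivative_unique[OF this has_derivative_F2[OF p], THEN fun_cong, of "w p"]
  have 2: "?n' * f2 p = fst (w p) * F2x p + snd (w p) * F2y p" using f0 by simp
  have "f1 p * (f1 p * F2y p - f2 p * F2x p) - f2 p * (f1 p * F1y p - f2 p * F1x p) = 0"
    using 1 2 by (simp add: w_def) algebra
  then have "n p * n p * (f1 p * (f1 p * F2y p - f2 p * F2x p) - f2 p * (f1 p * F1y p - f2 p * F1x p)) = 0"
    by simp
  then show ?thesis unfolding Fn[OF pV0] by (simp add: algebra_simps)
qed

end

section \<open>One-sided limits at the boundary curve\<close>

context collar
begin

text \<open>Continuity is asked for only on \<open>K\<close> together with the boundary point, since
  quantities built from charts of \<open>S'\<close> make sense only where \<open>Y\<close> is
  already known to lie in \<open>S'\<close>.\<close>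

lemma boundary_limit_zero:
  fixes g :: "real \<times> real \<Rightarrow> real"
  assumes y: "y \<in> N" and B: "open B" "(f y, y) \<in> B"
    and g: "continuous_on (B \<inter> insert (f y, y) K) g" "\<And>u. u \<in> B \<inter> K \<Longrightarrow> g u = 0"
  shows "g (f y, y) = 0"
proof -
  let ?\<gamma> = "\<lambda>t. (f y + \<tau> * t, y)"
  have lim: "(?\<gamma> \<longlongrightarrow> (f y, y)) (at_right 0)" by (auto intro!: tendsto_eq_intros)
  have "\<forall>\<^sub>F t in at_right 0. ?\<gamma> t \<in> B" using topological_tendstoD[OF lim B] .
  moreover have "\<forall>\<^sub>F t in at_right 0. ?\<gamma> t \<in> K"
    unfolding eventually_at_right_field
    by (rule exI[of _ \<delta>]) (use \<tau> \<delta> y in \<open>auto simp: K_def\<close>)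
  ultimately have ev: "\<forall>\<^sub>F t in at_right 0. ?\<gamma> t \<in> B \<inter> K" by eventually_elim auto
  have "((\<lambda>t. g (?\<gamma> t)) \<longlongrightarrow> g (f y, y)) (at_right 0)"
    by (rule continuous_on_tendsto_compose[OF g(1) lim _ eventually_mono[OF ev]]) (use B in auto)
  moreover have "\<forall>\<^sub>F t in at_right 0. g (?\<gamma> t) = 0" using ev by eventually_elim (rule g(2))
  ultimately have "((\<lambda>t. 0) \<longlongrightarrow> g (f y, y)) (at_right (0::real))" by (rule Lim_transform_eventually)
  then show ?thesis using tendsto_unique[OF trivial_limit_at_right_real tendsto_const] by metis
qed

abbreviation P :: "real \<times> real \<Rightarrow> real \<times> real" where
  "P u \<equiv> (fst (Y u), fst (snd (Y u)))"

lemma smooth_P: "smooth_on (UNIV \<times> N) P"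
  by (intro smooth_intros open_strip smooth_Y)

text \<open>The Jacobian of the projection \<open>P\<close> is \<open>m\<close>, which stays nonzero
  at the curve where \<open>Q\<close> vanishes; so \<open>Y\<close> is injective there even after
  projection to the plane.\<close>

lemma P_injective_near_boundary:
  assumes "y \<in> N"
  obtains r where "r > 0" "ball (f y, y) r \<subseteq> UNIV \<times> N" "inj_on P (ball (f y, y) r)"
proof (rule smooth_on_locally_injective[OF open_strip smooth_P])
  let ?u = "(f y, y)"
  show u: "?u \<in> UNIV \<times> N" using assms by simp
  have "(P has_derivative (\<lambda>w. (fst (fst w *\<^sub>R v (snd ?u) + snd w *\<^sub>R Yy ?u),
      fst (snd (fst w *\<^sub>R v (snd ?u) + snd w *\<^sub>R Yy ?u))))) (at ?u)"
    using assms by (intro has_derivative_Pair has_derivative_fst has_derivative_snd has_derivative_Y) simp_all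
  from frechet_derivative_at[OF this, symmetric]
  have "jac P ?u = m ?u" by (simp add: m_def)
  then show "jac P ?u \<noteq> 0" using m_boundary[OF assms] by simp
qed (use that in blast)

end

section \<open>Comparison of the ruled map with the graph\<close>

locale crossing = collar S D X c1 c2 f N \<tau> \<delta> x1 + minimal_graph S' V h
  for S D X c1 c2 f N \<tau> \<delta> x1 S' V h +
  fixes W :: "heis set"
  assumes S_subset: "S \<subseteq> S'" and curve: "\<And>y. y \<in> N \<Longrightarrow> Y (f y, y) \<in> S'"
    and open_W: "open W" and W: "S' \<inter> W \<subseteq> gr ` V"
begin

text \<open>On this open set the graph data can be evaluated at \<open>P u\<close> whether or not
  \<open>Y u\<close> belongs to \<open>S'\<close>. This makes it possible to follow \<open>F\<close>
  along a line not yet known to stay in the surface.\<close>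

definition Om where "Om = {u \<in> UNIV \<times> N. Y u \<in> W \<and> P u \<in> V}"

lemma open_Om: "open Om"
proof -
  have 1: "open ((UNIV \<times> N) \<inter> Y -` W)"
    by (rule continuous_open_preimage[OF smooth_on_continuous_on[OF smooth_Y] open_strip open_W])
  have 2: "open ((UNIV \<times> N) \<inter> P -` V)"
    by (rule continuous_open_preimage[OF smooth_on_continuous_on[OF smooth_P] open_strip open_V])
  have "Om = ((UNIV \<times> N) \<inter> Y -` W) \<inter> ((UNIV \<times> N) \<inter> P -` V)" by (auto simp: Om_def)
  then show ?thesis using 1 2 by auto
qed

lemma Om_subset: "Om \<subseteq> UNIV \<times> N" by (auto simp: Om_def)

lemma Om_N: "u \<in> Om \<Longrightarrow> snd u \<in> N" by (auto simp: Om_def)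

lemma Y_in_graph: "Y u \<in> S' \<Longrightarrow> Y u \<in> W \<Longrightarrow> P u \<in> V \<and> snd (snd (Y u)) = h (P u)"
  using W by (fastforce simp: prod_eq_iff)

lemma Y_in_graph_iff: "P u \<in> V \<Longrightarrow> snd (snd (Y u)) = h (P u) \<Longrightarrow> Y u \<in> S'"
proof -
  assume *: "P u \<in> V" "snd (snd (Y u)) = h (P u)"
  have "Y u = gr (P u)" by (simp add: prod_eq_iff *(2))
  then show "Y u \<in> S'" using graphD(5) *(1) by auto
qed

lemma K_S': "u \<in> K \<Longrightarrow> Y u \<in> S'"
  using X_eq_Y(1) K_subset X.paramD(5) S_subset by (metis image_subset_iff subsetD)

lemma smooth_strip_Om: "smooth_on (UNIV \<times> N) g \<Longrightarrow> smooth_on Om g"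
  using smooth_on_subset Om_subset by blast

lemma smooth_comp_P: "smooth_on V g \<Longrightarrow> smooth_on Om (\<lambda>u. g (P u))"
  by (rule smooth_on_compose[OF open_Om open_V _ _ smooth_strip_Om[OF smooth_P]]) (auto simp: Om_def)

definition Fd :: "real \<times> real \<Rightarrow> heis \<Rightarrow> real" where
  "Fd u w = F1 (P u) * fst w + F2 (P u) * fst (snd w)"

text \<open>This is \<open>DF(w) \<bullet> z\<close>, with the direction of differentiation first.
  The form is not symmetric: its antisymmetric part reflects the twisting of the contact
  planes.\<close>

definition Bd :: "real \<times> real \<Rightarrow> heis \<Rightarrow> heis \<Rightarrow> real" where
  "Bd u w z = (fst w * F1x (P u) + fst (snd w) * F1y (P u)) * fst z
    + (fst w * F2x (P u) + fst (snd w) * F2y (P u)) * fst (snd z)"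

lemma smooth_Fd: "smooth_on Om w \<Longrightarrow> smooth_on Om (\<lambda>u. Fd u (w u))"
  unfolding Fd_def by (intro smooth_intros open_Om smooth_comp_P smooth_F1 smooth_F2)

lemma smooth_Bd: "smooth_on Om w \<Longrightarrow> smooth_on Om z \<Longrightarrow> smooth_on Om (\<lambda>u. Bd u (w u) (z u))"
  unfolding Bd_def
  by (intro smooth_intros open_Om smooth_comp_P smooth_F1x smooth_F1y smooth_F2x smooth_F2y)

definition Rv :: "real \<Rightarrow> heis" where "Rv y = (- fst (snd (v y)), fst (v y), 0)"

lemma smooth_Om:
  "smooth_on Om (\<lambda>u. v (snd u))" "smooth_on Om (\<lambda>u. Rv (snd u))" "smooth_on Om Yy"
  "smooth_on Om (\<lambda>u. v' (snd u))"
  unfolding Rv_def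
  by (intro smooth_strip_Om smooth_strip smooth_Yy smooth_intros open_N smooth_v smooth_v')+

lemma derivative_comp_P:
  fixes g :: "real \<times> real \<Rightarrow> real"
  assumes u: "(x, y) \<in> Om" and g: "(g has_derivative (\<lambda>w. fst w * gx + snd w * gy)) (at (P (x, y)))"
  shows "((\<lambda>t. g (P (t, y))) has_real_derivative fst (v y) * gx + fst (snd (v y)) * gy) (at x)"
    and "((\<lambda>t. g (P (x, t))) has_real_derivative
       fst (Yy (x, y)) * gx + fst (snd (Yy (x, y))) * gy) (at y)"
proof -
  let ?u = "(x, y)"
  let ?d = "\<lambda>w. (fst (fst w *\<^sub>R v y + snd w *\<^sub>R Yy ?u), fst (snd (fst w *\<^sub>R v y + snd w *\<^sub>R Yy ?u)))"
  have "(P has_derivative ?d) (at ?u)"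
    using has_derivative_Y[of ?u] Om_N[OF u]
    by (intro has_derivative_Pair has_derivative_fst has_derivative_snd) simp_all
  from diff_chain_at[OF this g]
  have d: "((\<lambda>u. g (P u)) has_derivative (\<lambda>w. fst (?d w) * gx + snd (?d w) * gy)) (at ?u)"
    by (simp only: o_def)
  show "((\<lambda>t. g (P (t, y))) has_real_derivative fst (v y) * gx + fst (snd (v y)) * gy) (at x)"
    using has_vector_derivative_partial_fst[OF d] by (simp add: has_real_derivative_iff_has_vector_derivative)
  show "((\<lambda>t. g (P (x, t))) has_real_derivative
       fst (Yy ?u) * gx + fst (snd (Yy ?u)) * gy) (at y)"
    using has_vector_derivative_partial_snd[OF d] by (simp add: has_real_derivative_iff_has_vector_derivative)
qed

lemma derivative_fst_snd:
  assumes "(g has_vector_derivative g') (at t)"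
  shows "((\<lambda>t. fst (g t)) has_real_derivative fst g') (at t)"
    "((\<lambda>t. fst (snd (g t))) has_real_derivative fst (snd g')) (at t)"
    "((\<lambda>t. snd (snd (g t))) has_real_derivative snd (snd g')) (at t)"
proof -
  have d: "(g has_derivative (\<lambda>h. h *\<^sub>R g')) (at t)" using assms by (simp add: has_vector_derivative_def)
  note e = has_derivative_fst[OF d] has_derivative_fst[OF has_derivative_snd[OF d]]
    has_derivative_snd[OF has_derivative_snd[OF d]]
  show "((\<lambda>t. fst (g t)) has_real_derivative fst g') (at t)"
    "((\<lambda>t. fst (snd (g t))) has_real_derivative fst (snd g')) (at t)"
    "((\<lambda>t. snd (snd (g t))) has_real_derivative snd (snd g')) (at t)"
    using e by (simp_all add: has_real_derivative_iff_has_vector_derivative has_vector_derivative_def)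
qed

lemma vector_derivative_Y:
  assumes "y \<in> N"
  shows "((\<lambda>t. Y (t, y)) has_vector_derivative v y) (at x)"
    "((\<lambda>t. Y (x, t)) has_vector_derivative Yy (x, y)) (at y)"
  using has_vector_derivative_partial_fst[OF has_derivative_Y[of "(x, y)"]]
    has_vector_derivative_partial_snd[OF has_derivative_Y[of "(x, y)"]] assms by auto

lemma vector_derivative_v: "y \<in> N \<Longrightarrow> (v has_vector_derivative v' y) (at y)"
  unfolding has_vector_derivative_def by (rule has_derivative_v)

lemma vector_derivative_Yy: "((\<lambda>t. Yy (t, y)) has_vector_derivative v' y) (at x)"
  unfolding Yy_def by (auto intro!: derivative_eq_intros)

lemma Q_x:
  assumes "y \<in> N"
  shows "((\<lambda>t. Q (t, y)) has_real_derivative 2 * m (x, y)) (at x)"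
proof -
  have Q: "(\<lambda>t. Q (t, y)) = (\<lambda>t. Q (0, y) + 2 * m (0, y) * t + k y * t\<^sup>2)"
    by (rule ext) (rule Q_expand[OF assms])
  have "((\<lambda>t. Q (0, y) + 2 * m (0, y) * t + k y * t\<^sup>2) has_real_derivative
      2 * (m (0, y) + k y * x)) (at x)"
    by (auto intro!: derivative_eq_intros)
  then show ?thesis unfolding Q m_expand[of x y, symmetric] .
qed

lemma open_slices:
  assumes "(x, y) \<in> Om \<inter> K"
  obtains A1 A2 where "open A1" "x \<in> A1" "\<And>t. t \<in> A1 \<Longrightarrow> (t, y) \<in> Om \<inter> K"
    "open A2" "y \<in> A2" "\<And>t. t \<in> A2 \<Longrightarrow> (x, t) \<in> Om \<inter> K"
proof -
  have "open (Om \<inter> K)" using open_Om open_K by auto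
  then obtain A1 A2 where "open A1" "open A2" "x \<in> A1" "y \<in> A2" "A1 \<times> A2 \<subseteq> Om \<inter> K"
    using assms by (auto elim: open_prod_elim)
  then show ?thesis using that by blast
qed

text \<open>On \<open>K\<close> the height of \<open>Y\<close> equals \<open>h \<circ> P\<close>.
  Differentiating in \<open>x\<close> and in \<open>y\<close> says that \<open>v\<close> and
  \<open>Yy\<close> are the lifts of their planar parts to the graph, where \<open>Fd\<close>
  computes \<Theta>.\<close>

lemma Fd_on_K:
  assumes u: "u \<in> Om \<inter> K"
  shows "Fd u (v (snd u)) = 0" "Fd u (Yy u) = Q u"
proof -
  obtain x y where xy: "u = (x, y)" by fastforce
  have y: "y \<in> N" using Om_N u xy by auto
  obtain A1 A2 where A: "open A1" "x \<in> A1" "\<And>t. t \<in> A1 \<Longrightarrow> (t, y) \<in> Om \<inter> K"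
    "open A2" "y \<in> A2" "\<And>t. t \<in> A2 \<Longrightarrow> (x, t) \<in> Om \<inter> K" using open_slices u xy by metis
  have z: "h (P q) - snd (snd (Y q)) = 0" if "q \<in> Om \<inter> K" for q
    using Y_in_graph[of q] K_S'[of q] that by (auto simp: Om_def)
  have o: "(x, y) \<in> Om" and PV: "P (x, y) \<in> V" using u xy by (auto simp: Om_def)
  note dh = derivative_comp_P[OF o has_derivative_h[OF PV]]
  have "fst (v y) * hx (P u) + fst (snd (v y)) * hy (P u) - snd (snd (v y)) = 0"
    unfolding xy
    by (rule has_real_derivative_locally_zero[OF DERIV_diff[OF dh(1) derivative_fst_snd(3)[OF vector_derivative_Y(1)[OF y]]] A(1,2)])
       (rule z[OF A(3)])
  then show "Fd u (v (snd u)) = 0"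
    using contact_Y_v[of u] y by (simp add: Fd_def F1_def F2_def contact_form_eq xy algebra_simps)
  have "fst (Yy u) * hx (P u) + fst (snd (Yy u)) * hy (P u) - snd (snd (Yy u)) = 0"
    unfolding xy
    by (rule has_real_derivative_locally_zero[OF DERIV_diff[OF dh(2) derivative_fst_snd(3)[OF vector_derivative_Y(2)[OF y]]] A(4,5)])
       (rule z[OF A(6)])
  then show "Fd u (Yy u) = Q u"
    by (simp add: Fd_def F1_def F2_def Q_def contact_form_eq algebra_simps)
qed

lemma Bd_on_K:
  assumes u: "u \<in> Om \<inter> K"
  shows "Bd u (v (snd u)) (v (snd u)) = 0" "Bd u (Yy u) (v (snd u)) + Fd u (v' (snd u)) = 0"
    "Bd u (v (snd u)) (Yy u) + Fd u (v' (snd u)) - 2 * m u = 0"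
proof -
  obtain x y where xy: "u = (x, y)" by fastforce
  have y: "y \<in> N" using Om_N u xy by auto
  obtain A1 A2 where A: "open A1" "x \<in> A1" "\<And>t. t \<in> A1 \<Longrightarrow> (t, y) \<in> Om \<inter> K"
    "open A2" "y \<in> A2" "\<And>t. t \<in> A2 \<Longrightarrow> (x, t) \<in> Om \<inter> K" using open_slices u xy by metis
  have o: "(x, y) \<in> Om" and PV: "P (x, y) \<in> V" using u xy by (auto simp: Om_def)
  note d1 = derivative_comp_P[OF o has_derivative_F1[OF PV]]
    and d2 = derivative_comp_P[OF o has_derivative_F2[OF PV]]
  note dv = derivative_fst_snd[OF vector_derivative_v[OF y]]
    and dYy = derivative_fst_snd[OF vector_derivative_Yy[of y x]]
  have 1: "((\<lambda>t. Fd (t, y) (v y)) has_real_derivative Bd u (v y) (v y)) (at x)"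
    unfolding Fd_def Bd_def xy
    by (rule DERIV_cong, rule DERIV_add; (rule DERIV_mult[OF d1(1) DERIV_const] DERIV_mult[OF d2(1) DERIV_const])?)
       (simp add: algebra_simps)
  show "Bd u (v (snd u)) (v (snd u)) = 0"
    using has_real_derivative_locally_zero[OF 1 A(1,2)] Fd_on_K(1)[OF A(3)] xy by simp
  have 2: "((\<lambda>t. Fd (x, t) (v t)) has_real_derivative Bd u (Yy u) (v y) + Fd u (v' y)) (at y)"
    unfolding Fd_def Bd_def xy
    by (rule DERIV_cong[OF DERIV_add[OF DERIV_mult[OF d1(2) dv(1)] DERIV_mult[OF d2(2) dv(2)]]])
       (simp add: algebra_simps)
  show "Bd u (Yy u) (v (snd u)) + Fd u (v' (snd u)) = 0"
    using has_real_derivative_locally_zero[OF 2 A(4,5)] Fd_on_K(1)[OF A(6)] xy by simp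
  have 3: "((\<lambda>t. Fd (t, y) (Yy (t, y)) - Q (t, y)) has_real_derivative
      Bd u (v y) (Yy u) + Fd u (v' y) - 2 * m u) (at x)"
    unfolding Fd_def Bd_def xy
    by (rule DERIV_cong[OF DERIV_diff[OF DERIV_add[OF DERIV_mult[OF d1(1) dYy(1)] DERIV_mult[OF d2(1) dYy(2)]] Q_x[OF y]]])
       (simp add: algebra_simps)
  show "Bd u (v (snd u)) (Yy u) + Fd u (v' (snd u)) - 2 * m u = 0"
    using has_real_derivative_locally_zero[OF 3 A(1,2)] Fd_on_K(2)[OF A(3)] xy by simp
qed

text \<open>Only one-sided information enters, by passing to the limit from \<open>K\<close>. As
  \<open>m\<close> is nonzero, the planar parts of \<open>v\<close> and \<open>Yy\<close> form a
  basis, so \<open>F\<close> vanishes at the curve, and three of the four entries of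
  \<open>DF\<close> with respect to \<open>v\<close> and \<open>Rv\<close> are determined.\<close>

lemma on_boundary:
  assumes y: "y \<in> N" and u: "(f y, y) \<in> Om"
  shows "Fd (f y, y) w = 0" "Bd (f y, y) (v y) (v y) = 0" "Bd (f y, y) (Rv y) (v y) = 0"
    "Bd (f y, y) (v y) (Rv y) = 2"
proof -
  let ?u = "(f y, y)"
  have lim: "g ?u = 0" if "smooth_on Om g" "\<And>u. u \<in> Om \<inter> K \<Longrightarrow> g u = 0" for g :: "real \<times> real \<Rightarrow> real"
    by (rule boundary_limit_zero[OF y open_Om u])
       (use that smooth_on_continuous_on continuous_on_subset in blast)+
  have sQ: "smooth_on Om Q"
    unfolding Q_def contact_form_eq
    by (intro smooth_intros open_Om smooth_Om smooth_strip_Om smooth_Y)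
  have sm: "smooth_on Om m"
    unfolding m_def by (intro smooth_intros open_Om smooth_Om)
  have mb: "m ?u \<noteq> 0" by (rule m_boundary[OF y])
  have 1: "Fd ?u (v y) = 0" using lim[OF smooth_Fd[OF smooth_Om(1)]] Fd_on_K by simp
  have "Fd ?u (Yy ?u) - Q ?u = 0"
    using lim[OF smooth_on_diff[OF open_Om smooth_Fd[OF smooth_Om(3)] sQ]] Fd_on_K by simp
  then have 2: "Fd ?u (Yy ?u) = 0" using Q_boundary[OF y] by simp
  have "F1 (P ?u) * m ?u = 0" "F2 (P ?u) * m ?u = 0"
    using 1 2 by (simp_all add: Fd_def m_def) algebra+
  then have F: "F1 (P ?u) = 0" "F2 (P ?u) = 0" using mb by auto
  then show F0: "Fd ?u w = 0" for w by (simp add: Fd_def)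
  show Bvv: "Bd ?u (v y) (v y) = 0"
    using lim[OF smooth_Bd[OF smooth_Om(1,1)]] Bd_on_K by simp
  have B2: "Bd ?u (Yy ?u) (v y) = 0"
    using lim[OF smooth_on_add[OF open_Om smooth_Bd[OF smooth_Om(3,1)] smooth_Fd[OF smooth_Om(4)]]]
      Bd_on_K F0 by simp
  have sm2: "smooth_on Om (\<lambda>u. 2 * m u)" by (intro smooth_intros open_Om sm)
  have B3: "Bd ?u (v y) (Yy ?u) = 2 * m ?u"
    using lim[OF smooth_on_diff[OF open_Om smooth_on_add[OF open_Om smooth_Bd[OF smooth_Om(1,3)]
      smooth_Fd[OF smooth_Om(4)]] sm2]] Bd_on_K F0 by simp
  define l where "l = fst (v y) * fst (Yy ?u) + fst (snd (v y)) * fst (snd (Yy ?u))"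
  have e: "fst (Yy ?u) = l * fst (v y) + m ?u * fst (Rv y)"
    "fst (snd (Yy ?u)) = l * fst (snd (v y)) + m ?u * fst (snd (Rv y))"
    using unit_v[OF y] by (simp_all add: l_def m_def Rv_def) algebra+
  have "Bd ?u (Yy ?u) (v y) = l * Bd ?u (v y) (v y) + m ?u * Bd ?u (Rv y) (v y)"
    unfolding Bd_def e by (simp add: algebra_simps)
  then show "Bd ?u (Rv y) (v y) = 0" using B2 Bvv mb by simp
  have "Bd ?u (v y) (Yy ?u) = l * Bd ?u (v y) (v y) + m ?u * Bd ?u (v y) (Rv y)"
    unfolding Bd_def e by (simp add: algebra_simps)
  then show "Bd ?u (v y) (Rv y) = 2" using B3 Bvv mb by simp
qed

text \<open>Substitute \<open>F = (F \<bullet> v) v + (F \<bullet> Rv) Rv\<close> into the quadratic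
  equation. The result has the form demanded by \<open>degenerate_ode_zero\<close>, with
  \<open>a = F \<bullet> v\<close> and \<open>b = F \<bullet> Rv\<close>; at \<open>F = 0\<close> it
  is trivial, so singular points cause no exception.\<close>

lemma minimal_equation_frame:
  assumes "u \<in> Om"
  shows "(Fd u (Rv (snd u)))\<^sup>2 * Bd u (v (snd u)) (v (snd u))
     - Fd u (v (snd u)) * Fd u (Rv (snd u)) * (Bd u (Rv (snd u)) (v (snd u)) + Bd u (v (snd u)) (Rv (snd u)))
     + (Fd u (v (snd u)))\<^sup>2 * Bd u (Rv (snd u)) (Rv (snd u)) = 0"
proof -
  let ?p = "P u" and ?v = "v (snd u)"
  have p: "?p \<in> V" using assms by (auto simp: Om_def)
  have min: "F1 ?p * (F1 ?p * F2y ?p - F2 ?p * F2x ?p) - F2 ?p * (F1 ?p * F1y ?p - F2 ?p * F1x ?p) = 0"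
    using minimal_equation[OF p] by (cases "F1 ?p = 0 \<and> F2 ?p = 0") auto
  obtain a where a: "a = fst ?v" by blast
  obtain b where b: "b = fst (snd ?v)" by blast
  have un: "a\<^sup>2 + b\<^sup>2 = 1" using unit_v[OF Om_N[OF assms]] by (simp add: a b)
  obtain X Y A B C D where n: "X = F1 ?p" "Y = F2 ?p" "A = F1x ?p" "B = F1y ?p" "C = F2x ?p" "D = F2y ?p"
    by blast
  show ?thesis
    using min un unfolding Fd_def Bd_def Rv_def fst_conv snd_conv n[symmetric] a[symmetric] b[symmetric]
    by algebra
qed

section \<open>Continuation of a single line beyond the curve\<close>

context
  fixes y t1
  assumes y: "y \<in> N" and line: "\<And>t. t \<in> {0..t1} \<Longrightarrow> (f y - \<tau> * t, y) \<in> Om"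
begin

lemma derivative_along_line:
  assumes "((\<lambda>x. g (x, y)) has_real_derivative d) (at (f y - \<tau> * t))"
  shows "((\<lambda>t. g (f y - \<tau> * t, y)) has_real_derivative - \<tau> * d) (at t)"
proof -
  have "((\<lambda>t. f y - \<tau> * t) has_real_derivative - \<tau>) (at t)" by (auto intro!: derivative_eq_intros)
  from DERIV_chain2[OF assms this] show ?thesis by (simp add: mult.commute)
qed

lemma continuous_along_line: "smooth_on Om g \<Longrightarrow> continuous_on {0..t1} (\<lambda>t. g (f y - \<tau> * t, y))"
  by (rule continuous_on_compose2[OF smooth_on_continuous_on[of Om g]])
     (use line in \<open>auto intro!: continuous_intros\<close>)

lemma bound_along_line:
  fixes g :: "real \<times> real \<Rightarrow> real"
  assumes "smooth_on Om g" "g (f y, y) = 0"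
  shows "\<exists>M. \<forall>t\<in>{0..t1}. \<bar>g (f y - \<tau> * t, y)\<bar> \<le> M * t"
proof (rule linear_bound_at_0)
  show "((\<lambda>t. g (f y - \<tau> * t, y)) has_real_derivative
      - \<tau> * frechet_derivative g (at (f y - \<tau> * t, y)) (1, 0)) (at t)" if "t \<in> {0..t1}" for t
    using has_vector_derivative_partial_fst[OF smooth_on_has_derivative[OF assms(1) line[OF that]]]
    by (intro derivative_along_line) (simp add: has_real_derivative_iff_has_vector_derivative)
  show "continuous_on {0..t1} (\<lambda>t. - \<tau> * frechet_derivative g (at (f y - \<tau> * t, y)) (1, 0))"
    by (intro continuous_intros continuous_along_line[where g = "\<lambda>u. frechet_derivative g (at u) (1, 0)"]
        smooth_on_frechet_derivative assms)
qed (use assms in simp)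

text \<open>The entries of \<open>Bd\<close> at \<open>(v, v)\<close> and \<open>(Rv, v)\<close>
  vanish on the curve, hence are \<open>O(t)\<close>; with the lower bound on the entry at
  \<open>(v, Rv)\<close> these are the hypotheses of \<open>degenerate_ode_zero\<close>.\<close>

lemma horizontal_along_line:
  assumes B: "\<And>t. t \<in> {0..t1} \<Longrightarrow> Bd (f y - \<tau> * t, y) (v y) (Rv y) \<ge> 1" and t: "t \<in> {0..t1}"
  shows "Fd (f y - \<tau> * t, y) (v y) = 0"
proof -
  let ?\<gamma> = "\<lambda>t. (f y - \<tau> * t, y)"
  have t1: "0 \<in> {0..t1}" using t by auto
  have uO: "(f y, y) \<in> Om" using line[OF t1] by simp
  have sv: "smooth_on Om (\<lambda>u. Bd u (v (snd u)) (v (snd u)))" "smooth_on Om (\<lambda>u. Bd u (Rv (snd u)) (v (snd u)))"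
    "smooth_on Om (\<lambda>u. Bd u (Rv (snd u)) (Rv (snd u)))"
    by (intro smooth_Bd smooth_Om)+
  obtain M1 where M1: "\<And>t. t \<in> {0..t1} \<Longrightarrow> \<bar>Bd (?\<gamma> t) (v y) (v y)\<bar> \<le> M1 * t"
    using bound_along_line[OF sv(1)] on_boundary(2)[OF y uO] unfolding snd_conv by blast
  obtain M2 where M2: "\<And>t. t \<in> {0..t1} \<Longrightarrow> \<bar>Bd (?\<gamma> t) (Rv y) (v y)\<bar> \<le> M2 * t"
    using bound_along_line[OF sv(2)] on_boundary(3)[OF y uO] unfolding snd_conv by blast
  have "continuous_on {0..t1} (\<lambda>t. Bd (?\<gamma> t) (Rv y) (Rv y))"
    using continuous_along_line[OF sv(3)] by simp
  then have "bounded ((\<lambda>t. Bd (?\<gamma> t) (Rv y) (Rv y)) ` {0..t1})"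
    by (intro compact_imp_bounded compact_continuous_image) auto
  then obtain M3 where M3: "\<And>t. t \<in> {0..t1} \<Longrightarrow> \<bar>Bd (?\<gamma> t) (Rv y) (Rv y)\<bar> \<le> M3"
    unfolding bounded_iff by force
  define M where "M = max M1 (max M2 M3)"
  \<comment> \<open>The point moves with velocity \<open>- \<tau>\<close> in \<open>x\<close>; the
    same factor in front makes the derivative exactly \<open>Bd\<close>, so that \<open>b\<close>
    increases whichever side \<open>D\<close> lies on.\<close>
  have dF: "((\<lambda>t. - \<tau> * Fd (?\<gamma> t) w) has_real_derivative Bd (?\<gamma> t) (v y) w) (at t)" if t: "t \<in> {0..t1}" for t w
  proof -
    have PV: "P (?\<gamma> t) \<in> V" using line[OF t] by (auto simp: Om_def)
    note d1 = derivative_comp_P(1)[OF line[OF t] has_derivative_F1[OF PV]]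
      and d2 = derivative_comp_P(1)[OF line[OF t] has_derivative_F2[OF PV]]
    have "((\<lambda>x. Fd (x, y) w) has_real_derivative Bd (?\<gamma> t) (v y) w) (at (f y - \<tau> * t))"
      unfolding Fd_def Bd_def
      by (rule DERIV_cong[OF DERIV_add[OF DERIV_mult[OF d1 DERIV_const] DERIV_mult[OF d2 DERIV_const]]])
         (simp add: algebra_simps)
    from DERIV_cmult[OF derivative_along_line[OF this], of "- \<tau>"] show ?thesis using \<tau> by auto
  qed
  have "- \<tau> * Fd (?\<gamma> t) (v y) = 0"
  proof (rule degenerate_ode_zero[where b = "\<lambda>t. - \<tau> * Fd (?\<gamma> t) (Rv y)" and h = t1 and M = M, OF dF dF])
    fix s assume s: "s \<in> {0<..t1}"
    then have "?\<gamma> s \<in> Om" by (intro line) auto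
    from minimal_equation_frame[OF this] show
      "(- \<tau> * Fd (?\<gamma> s) (Rv y))\<^sup>2 * Bd (?\<gamma> s) (v y) (v y)
       - - \<tau> * Fd (?\<gamma> s) (v y) * (- \<tau> * Fd (?\<gamma> s) (Rv y)) * (Bd (?\<gamma> s) (Rv y) (v y) + Bd (?\<gamma> s) (v y) (Rv y))
       + (- \<tau> * Fd (?\<gamma> s) (v y))\<^sup>2 * Bd (?\<gamma> s) (Rv y) (Rv y) = 0"
      using \<tau> by auto
  next
    fix s assume s: "s \<in> {0..t1}"
    have "M1 * s \<le> M * s" "M2 * s \<le> M * s" using s by (auto simp: M_def intro: mult_right_mono)
    then show "\<bar>Bd (?\<gamma> s) (v y) (v y)\<bar> \<le> M * s" "\<bar>Bd (?\<gamma> s) (Rv y) (v y)\<bar> \<le> M * s"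
      using M1[OF s] M2[OF s] by auto
    show "\<bar>Bd (?\<gamma> s) (Rv y) (Rv y)\<bar> \<le> M" using M3[OF s] by (auto simp: M_def)
  qed (use t B on_boundary[OF y uO] in auto)
  then show ?thesis using \<tau> by auto
qed

text \<open>Up to sign, the difference of heights between graph and line has derivative
  \<open>Fd\<close> on \<open>v\<close> minus \<Theta> on \<open>v\<close>. Both are zero, and the
  difference starts at zero because the curve lies in \<open>S'\<close>.\<close>

lemma line_in_surface:
  assumes B: "\<And>t. t \<in> {0..t1} \<Longrightarrow> Bd (f y - \<tau> * t, y) (v y) (Rv y) \<ge> 1" and t: "t \<in> {0..t1}"
  shows "Y (f y - \<tau> * t, y) \<in> S'"
proof -
  let ?\<gamma> = "\<lambda>t. (f y - \<tau> * t, y)"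
  let ?g = "\<lambda>t. h (P (?\<gamma> t)) - snd (snd (Y (?\<gamma> t)))"
  have d: "(?g has_real_derivative 0) (at s)" if s: "s \<in> {0..t1}" for s
  proof -
    have PV: "P (?\<gamma> s) \<in> V" using line[OF s] by (auto simp: Om_def)
    note dh = derivative_comp_P(1)[OF line[OF s] has_derivative_h[OF PV]]
    have "((\<lambda>x. h (P (x, y)) - snd (snd (Y (x, y)))) has_real_derivative 0) (at (f y - \<tau> * s))"
    proof (rule DERIV_cong[OF DERIV_diff[OF dh derivative_fst_snd(3)[OF vector_derivative_Y(1)[OF y]]]])
      show "fst (v y) * hx (P (?\<gamma> s)) + fst (snd (v y)) * hy (P (?\<gamma> s)) - snd (snd (v y)) = 0"
        using horizontal_along_line[OF B s] contact_Y_v[of "?\<gamma> s"] y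
        by (simp add: Fd_def F1_def F2_def contact_form_eq algebra_simps)
    qed
    from derivative_along_line[OF this] show ?thesis by simp
  qed
  have "\<exists>c. \<forall>s\<in>{0..t1}. ?g s = c"
  proof (rule has_vector_derivative_zero_constant)
    show "(?g has_vector_derivative 0) (at s within {0..t1})" if "s \<in> {0..t1}" for s
      using has_vector_derivative_at_within[OF d[OF that, unfolded has_real_derivative_iff_has_vector_derivative]] .
  qed (use convex_real_interval in auto)
  then obtain c where c: "\<And>s. s \<in> {0..t1} \<Longrightarrow> ?g s = c" by blast
  have "?g t = ?g 0" using c[OF t] c[of 0] t by simp
  moreover have "(f y, y) \<in> Om" using line[of 0] t by auto
  then have "?g 0 = 0" using Y_in_graph[OF curve[OF y]] by (auto simp: Om_def)
  ultimately show ?thesis using line[OF t] by (intro Y_in_graph_iff) (auto simp: Om_def)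
qed

end

lemma local_extension:
  assumes y0: "y0 \<in> N" and W0: "Y (f y0, y0) \<in> W"
  obtains \<eta> \<delta>' where "\<eta> > 0" "\<delta>' > 0" "\<delta>' \<le> \<delta>" "ball y0 \<eta> \<subseteq> N"
    "inj_on Y {u. snd u \<in> ball y0 \<eta> \<and> \<bar>fst u - f (snd u)\<bar> < \<delta>'}"
    "Y ` {u. snd u \<in> ball y0 \<eta> \<and> \<bar>fst u - f (snd u)\<bar> < \<delta>'} \<subseteq> S'"
proof -
  let ?u0 = "(f y0, y0)"
  have u0: "?u0 \<in> Om" using Y_in_graph[OF curve[OF y0] W0] W0 y0 by (auto simp: Om_def)
  \<comment> \<open>The entry equals 2 on the curve, so by continuity it stays above the bound 1
    required along the lines.\<close>
  define Om1 where "Om1 = Om \<inter> (\<lambda>u. Bd u (v (snd u)) (Rv (snd u))) -` {1<..}"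
  have o1: "open Om1" unfolding Om1_def
    by (intro continuous_open_preimage smooth_on_continuous_on smooth_Bd smooth_Om open_Om) auto
  have u1: "?u0 \<in> Om1" using u0 on_boundary[OF y0 u0] by (simp add: Om1_def)
  obtain r1 where r1: "r1 > 0" "ball ?u0 r1 \<subseteq> Om1" using o1 u1 open_contains_ball by blast
  obtain r2 where r2: "r2 > 0" "inj_on P (ball ?u0 r2)" using P_injective_near_boundary[OF y0] .
  define r where "r = min r1 r2"
  have r: "r > 0" using r1 r2 by (simp add: r_def)
  obtain e1 where e1: "e1 > 0" "ball y0 e1 \<subseteq> N" using open_N y0 open_contains_ball by blast
  have "continuous (at y0) f" using cont_f open_N y0 by (simp add: continuous_on_eq_continuous_at)
  then obtain e2 where e2: "e2 > 0" "\<And>y. dist y y0 < e2 \<Longrightarrow> dist (f y) (f y0) < r / 4"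
    using r unfolding continuous_at_eps_delta by (metis zero_less_divide_iff zero_less_numeral)
  define \<eta> where "\<eta> = min (min e1 e2) (r / 4)"
  define \<delta>' where "\<delta>' = min \<delta> (r / 4)"
  let ?B = "{u. snd u \<in> ball y0 \<eta> \<and> \<bar>fst u - f (snd u)\<bar> < \<delta>'}"
  have B: "?B \<subseteq> ball ?u0 r"
  proof
    fix u assume u: "u \<in> ?B"
    obtain x y where xy: "u = (x, y)" by fastforce
    have 1: "\<bar>y - y0\<bar> < r / 4" "\<bar>x - f y\<bar> < r / 4" "\<bar>f y - f y0\<bar> < r / 4"
      using u e2(2)[of y] by (auto simp: xy \<eta>_def \<delta>'_def dist_real_def abs_minus_commute)
    have "dist ?u0 u \<le> \<bar>x - f y0\<bar> + \<bar>y - y0\<bar>"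
      using sqrt_sum_squares_le_sum_abs[of "f y0 - x" "y0 - y"]
      by (simp add: xy dist_Pair_Pair dist_real_def abs_minus_commute power2_commute)
    also have "\<dots> < r" using 1 r by linarith
    finally show "u \<in> ball ?u0 r" by simp
  qed
  show ?thesis
  proof (rule that)
    show "\<eta> > 0" "\<delta>' > 0" "\<delta>' \<le> \<delta>" "ball y0 \<eta> \<subseteq> N"
      using e1 e2 r \<delta> by (auto simp: \<eta>_def \<delta>'_def)
    have "?B \<subseteq> ball ?u0 r2" using B by (auto simp: r_def)
    then have "inj_on P ?B" by (rule inj_on_subset[OF r2(2)])
    then show "inj_on Y ?B" by (auto simp: inj_on_def)
    show "Y ` ?B \<subseteq> S'"
    proof (rule image_subsetI)
      fix u assume u: "u \<in> ?B"
      obtain x y where xy: "u = (x, y)" by fastforce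
      have y: "y \<in> N" "y \<in> ball y0 \<eta>" using u \<open>ball y0 \<eta> \<subseteq> N\<close> by (auto simp: xy)
      show "Y u \<in> S'"
      proof (cases "0 < \<tau> * (x - f y)")
        case True
        then have "u \<in> K" using u y \<tau> by (auto simp: K_def xy \<delta>'_def)
        then show ?thesis by (rule K_S')
      next
        case False
        define t1 where "t1 = - \<tau> * (x - f y)"
        have x: "x = f y - \<tau> * t1" using \<tau> by (auto simp: t1_def)
        have t1: "0 \<le> t1" "t1 < \<delta>'" using False u \<tau> by (auto simp: t1_def xy)
        have inB: "(f y - \<tau> * t, y) \<in> Om1" if "t \<in> {0..t1}" for t
        proof -
          have "(f y - \<tau> * t, y) \<in> ?B" using that t1 y \<tau> by auto
          then have "(f y - \<tau> * t, y) \<in> ball ?u0 r" using B by blast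
          then show ?thesis using r1(2) by (auto simp: r_def)
        qed
        have "Y (f y - \<tau> * t1, y) \<in> S'"
        proof (rule line_in_surface[OF y(1), of t1])
          show "(f y - \<tau> * t, y) \<in> Om" "1 \<le> Bd (f y - \<tau> * t, y) (v y) (Rv y)" if "t \<in> {0..t1}" for t
            using inB[OF that] by (auto simp: Om1_def)
        qed (use t1 in auto)
        then show ?thesis by (simp add: xy x)
      qed
    qed
  qed
qed

end

section \<open>The ruled map as a chart across the curve\<close>

context collar
begin

lemma boundary_value:
  assumes y: "y \<in> N" and L: "(X \<longlongrightarrow> L) (at (f y, y) within D)"
  shows "Y (f y, y) = L"
proof -
  let ?\<gamma> = "\<lambda>t. (f y + \<tau> * t, y)"
  have lim: "(?\<gamma> \<longlongrightarrow> (f y, y)) (at_right 0)" by (auto intro!: tendsto_eq_intros)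
  have ev: "\<forall>\<^sub>F t in at_right 0. ?\<gamma> t \<in> K"
    unfolding eventually_at_right_field
    by (rule exI[of _ \<delta>]) (use \<tau> \<delta> y in \<open>auto simp: K_def\<close>)
  have "filterlim ?\<gamma> (at (f y, y) within D) (at_right 0)"
    unfolding filterlim_at
  proof
    show "\<forall>\<^sub>F t in at_right 0. ?\<gamma> t \<in> D \<and> ?\<gamma> t \<noteq> (f y, y)"
      using ev by eventually_elim (use K_subset in \<open>auto simp: K_def\<close>)
  qed (rule lim)
  then have 1: "((\<lambda>t. X (?\<gamma> t)) \<longlongrightarrow> L) (at_right 0)" by (rule filterlim_compose[OF L])
  have "isCont Y (f y, y)"
    using smooth_on_continuous_on[OF smooth_Y] y unfolding continuous_on_eq_continuous_at[OF open_strip] by blast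
  then have "((\<lambda>t. Y (?\<gamma> t)) \<longlongrightarrow> Y (f y, y)) (at_right 0)" by (rule isCont_tendsto_compose[OF _ lim])
  moreover have "\<forall>\<^sub>F t in at_right 0. Y (?\<gamma> t) = X (?\<gamma> t)"
    using ev by eventually_elim (simp add: X_eq_Y)
  ultimately have "((\<lambda>t. X (?\<gamma> t)) \<longlongrightarrow> Y (f y, y)) (at_right 0)" by (rule Lim_transform_eventually)
  then show ?thesis using tendsto_unique[OF trivial_limit_at_right_real _ 1] by blast
qed

text \<open>A common zero of \<open>m\<close> and \<open>Q\<close> would need
  \<open>x + c1 y = 0\<close> and \<open>c2 y = 0\<close>, but \<open>c2 y\<close> is minus the
  square of the nonzero \<open>f y + c1 y\<close>.\<close>

lemma Y_immersion:
  assumes "snd u \<in> N"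
  shows "inj (frechet_derivative Y (at u))"
proof (rule inj_derivative_Y[OF assms])
  obtain x y where u: "u = (x, y)" by fastforce
  have y: "y \<in> N" using assms u by simp
  have "c2 y \<noteq> 0" using f_root[OF y] by fastforce
  then show "m u \<noteq> 0 \<or> Q u \<noteq> 0" using m_Q_eq(1,2)[OF y, of x] m_Q_eq(3)[OF y]
    by (cases "x + c1 y = 0") (auto simp: u)
qed

text \<open>The tangent plane of \<open>S'\<close> at a boundary point contains the limits of the tangent vectors
  \<open>v\<close> and \<open>Yy\<close>, hence is the contact plane and is transverse to \<open>T\<close>.\<close>

lemma graph_near_boundary:
  assumes S': "p_minimal_surface S'" and sub: "S \<subseteq> S'" and y0: "y0 \<in> N" and q0: "Y (f y0, y0) \<in> S'"
  obtains V h W where "minimal_graph S' V h" "open W" "Y (f y0, y0) \<in> W"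
    "S' \<inter> W \<subseteq> (\<lambda>p. (fst p, snd p, h p)) ` V"
proof -
  let ?p0 = "(f y0, y0)" and ?q0 = "Y (f y0, y0)"
  have smS': "smooth_surface S'" using S' by (simp add: p_minimal_surface_def)
  obtain U \<phi> where lp: "local_param S' U \<phi>" and "?q0 \<in> \<phi> ` U"
    using smS' q0 unfolding smooth_surface_def by blast
  then obtain u0 where u0: "u0 \<in> U" "\<phi> u0 = ?q0" by auto
  note d = local_paramD[OF lp]
  obtain \<psi> where hom: "homeomorphism U (\<phi> ` U) \<phi> \<psi>" using d(9) ..
  then have \<psi>: "\<psi> (\<phi> u) = u" if "u \<in> U" for u using that by (auto simp: homeomorphism_def)
  define a b where "a = (\<lambda>u. frechet_derivative \<phi> (at u) (1, 0))"
    and "b = (\<lambda>u. frechet_derivative \<phi> (at u) (0, 1))"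
  \<comment> \<open>\<open>N1\<close>, \<open>N2\<close>, \<open>N3\<close> are the entries of the
    cross product of the two columns of the differential, and \<open>nd\<close> is the resulting
    normal functional of the tangent plane.\<close>
  define N1 where "N1 u = fst (snd (a u)) * snd (snd (b u)) - snd (snd (a u)) * fst (snd (b u))" for u
  define N2 where "N2 u = snd (snd (a u)) * fst (b u) - fst (a u) * snd (snd (b u))" for u
  define N3 where "N3 u = fst (a u) * fst (snd (b u)) - fst (snd (a u)) * fst (b u)" for u
  define nd where "nd u w = N1 u * fst w + N2 u * fst (snd w) + N3 u * snd (snd w)" for u and w :: heis
  have rep: "frechet_derivative \<phi> (at u) w = fst w *\<^sub>R a u + snd w *\<^sub>R b u" if "u \<in> U" for u w
    unfolding a_def b_def by (rule linear_real_pair[OF has_derivative_linear[OF d(8)[OF that]]])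
  have nd0: "nd u (frechet_derivative \<phi> (at u) w) = 0" if "u \<in> U" for u w
    by (simp add: rep[OF that] nd_def N1_def N2_def N3_def algebra_simps)
  have sa: "smooth_on U a" and sb: "smooth_on U b"
    unfolding a_def b_def by (intro smooth_on_frechet_derivative d(2))+
  have sN: "smooth_on U N1" "smooth_on U N2" "smooth_on U N3"
    unfolding N1_def N2_def N3_def by (intro smooth_intros d(1) sa sb)+
  obtain W1 where W1: "open W1" "\<phi> ` U = S' \<inter> W1" using d(4) unfolding openin_open by auto
  define B where "B = (UNIV \<times> N) \<inter> Y -` W1"
  have oB: "open B" unfolding B_def
    by (rule continuous_open_preimage[OF smooth_on_continuous_on[OF smooth_Y] open_strip W1(1)])
  have "\<phi> u0 \<in> S' \<inter> W1" using u0(1) W1(2) by blast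
  then have pB: "?p0 \<in> B" using y0 u0(2) by (auto simp: B_def)
  have lpX: "local_param S' D X" by (rule local_param_mono[OF smS' sub X.param])
  have KS': "Y u \<in> S'" if "u \<in> K" for u
    using that X_eq_Y(1) K_subset X.paramD(5) sub by (metis image_subset_iff subsetD)
  have BU: "Y u \<in> \<phi> ` U" if "u \<in> B \<inter> insert ?p0 K" for u
    using that KS' q0 unfolding W1(2) by (auto simp: B_def)
  \<comment> \<open>The functional \<open>nd\<close> is transported along \<open>Y\<close> by the
    inverse chart. It kills tangent vectors of \<open>S\<close> on \<open>K\<close>, and continuity
    carries this to the boundary point.\<close>
  have lim: "nd u0 (w ?p0) = 0"
    if sw: "smooth_on (UNIV \<times> N) w" and wK: "\<And>u. u \<in> K \<Longrightarrow> w u \<in> range (frechet_derivative X (at u))" for w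
  proof -
    let ?g = "\<lambda>u. nd (\<psi> (Y u)) (w u)"
    have c\<psi>: "continuous_on (B \<inter> insert ?p0 K) (\<lambda>u. \<psi> (Y u))"
    proof (rule continuous_on_compose2[OF homeomorphism_cont2[OF hom]])
      show "continuous_on (B \<inter> insert ?p0 K) Y"
        by (rule continuous_on_subset[OF smooth_on_continuous_on[OF smooth_Y]]) (auto simp: B_def)
    qed (use BU in blast)
    have cN: "continuous_on (B \<inter> insert ?p0 K) (\<lambda>u. n (\<psi> (Y u)))" if "smooth_on U n" for n :: "real \<times> real \<Rightarrow> real"
      by (rule continuous_on_compose2[OF smooth_on_continuous_on[OF that] c\<psi>])
         (use BU \<psi> in force)
    have cw: "continuous_on (B \<inter> insert ?p0 K) w"
      by (rule continuous_on_subset[OF smooth_on_continuous_on[OF sw]]) (auto simp: B_def)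
    have "?g ?p0 = 0"
    proof (rule boundary_limit_zero[OF y0 oB pB])
      show "continuous_on (B \<inter> insert ?p0 K) ?g"
        unfolding nd_def by (intro continuous_intros cN sN cw)
      fix u assume u: "u \<in> B \<inter> K"
      then have uD: "u \<in> D" using K_subset by auto
      obtain x where x: "x \<in> U" "\<phi> x = Y u" using BU[of u] u by auto
      have "range (frechet_derivative X (at u)) = range (frechet_derivative \<phi> (at x))"
        using tangent_space_param[OF lpX uD] tangent_space_param[OF lp x(1)] x(2) X_eq_Y(1) u by simp
      then obtain z where "w u = frechet_derivative \<phi> (at x) z" using wK u by blast
      then show "?g u = 0" using nd0[OF x(1)] \<psi>[OF x(1)] x(2) by simp
    qed
    then show ?thesis using \<psi>[OF u0(1)] u0(2) by simp
  qed
  have 1: "nd u0 (v y0) = 0"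
  proof -
    have "v (snd u) \<in> range (frechet_derivative X (at u))" if "u \<in> K" for u
      using X_eq_Y(2)[OF that] unfolding coord_e1_def by (metis rangeI)
    from lim[OF smooth_strip[OF smooth_v] this] show ?thesis by simp
  qed
  have 2: "nd u0 (Yy ?p0) = 0"
    by (rule lim[OF smooth_Yy]) (auto simp: coord_y_eq[symmetric] X.coord_y_def)
  \<comment> \<open>A vertical tangent plane would have a horizontal Euclidean normal, orthogonal to
    the planar parts of \<open>v\<close> and \<open>Yy\<close>. These span the plane as
    \<open>m\<close> is nonzero, so the whole normal would vanish and the columns would be
    dependent.\<close>
  have N3: "N3 u0 \<noteq> 0"
  proof
    assume z: "N3 u0 = 0"
    have "N1 u0 * m ?p0 = 0" "N2 u0 * m ?p0 = 0"
      using 1 2 z by (simp_all add: nd_def m_def) algebra+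
    then have z12: "N1 u0 = 0" "N2 u0 = 0" using m_boundary[OF y0] by auto
    define s where "s = a u0 \<bullet> a u0"
    define t where "t = a u0 \<bullet> b u0"
    have "s *\<^sub>R b u0 = t *\<^sub>R a u0"
      using z z12 unfolding s_def t_def N1_def N2_def N3_def
      by (simp add: prod_eq_iff inner_prod_def) algebra
    then have "frechet_derivative \<phi> (at u0) (- t, s) = 0" by (simp add: rep[OF u0(1)])
    moreover have "frechet_derivative \<phi> (at u0) (0, 0) = 0" by (simp add: rep[OF u0(1)])
    ultimately have "(- t, s) = (0, 0)" by (intro injD[OF d(3)[OF u0(1)]]) simp
    then have "a u0 = 0" by (simp add: s_def)
    then have "frechet_derivative \<phi> (at u0) (1, 0) = 0" by (simp add: a_def)
    then have "(1, 0) = ((0, 0) :: real \<times> real)"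
      using \<open>frechet_derivative \<phi> (at u0) (0, 0) = 0\<close> by (intro injD[OF d(3)[OF u0(1)]]) simp
    then show False by simp
  qed
  \<comment> \<open>The Jacobian of the projected chart is \<open>N3\<close>, so the chart can be
    reparametrized by its first two coordinates, and the third becomes the function
    \<open>h\<close>.\<close>
  define \<rho> where "\<rho> = (\<lambda>u. (fst (\<phi> u), fst (snd (\<phi> u))))"
  have s\<rho>: "smooth_on U \<rho>" unfolding \<rho>_def by (intro smooth_intros d(1,2))
  have "jac \<rho> u0 = N3 u0"
  proof -
    have "(\<rho> has_derivative (\<lambda>w. (fst (frechet_derivative \<phi> (at u0) w),
        fst (snd (frechet_derivative \<phi> (at u0) w))))) (at u0)"
      unfolding \<rho>_def
      by (intro has_derivative_Pair has_derivative_fst has_derivative_snd d(8)[OF u0(1)])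
    from frechet_derivative_at[OF this, symmetric]
    show ?thesis by (simp add: N3_def a_def b_def algebra_simps)
  qed
  then have "jac \<rho> u0 \<noteq> 0" using N3 by simp
  then obtain V0 g where V0: "open V0" "u0 \<in> V0" "V0 \<subseteq> U" "inj_on \<rho> V0" "open (\<rho> ` V0)"
    "\<And>x. x \<in> V0 \<Longrightarrow> g (\<rho> x) = x" "smooth_on (\<rho> ` V0) g"
    using smooth_local_inverse[OF d(1) s\<rho> u0(1)] by metis
  define V where "V = \<rho> ` V0"
  define h where "h = (\<lambda>p. snd (snd (\<phi> (g p))))"
  let ?gr = "\<lambda>p. (fst p, snd p, h p)"
  have gr: "?gr (\<rho> x) = \<phi> x" if "x \<in> V0" for x
    by (simp add: h_def V0(6)[OF that]) (simp add: \<rho>_def)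
  have im: "?gr ` V = \<phi> ` V0" unfolding V_def image_image using gr by (auto intro: image_cong)
  have oV: "open V" using V0 by (simp add: V_def)
  have sh: "smooth_on V h"
    unfolding h_def
    by (intro smooth_on_snd oV smooth_on_compose[OF oV d(1) _ d(2)]) (use V0 in \<open>auto simp: V_def\<close>)
  have "local_param S' V ?gr"
  proof (rule local_param_injective_immersion[OF smS' oV])
    show "smooth_on V ?gr" by (intro smooth_intros oV sh)
    show "?gr ` V \<subseteq> S'" unfolding im using V0(3) d(5) by auto
    fix p assume p: "p \<in> V"
    have "(?gr has_derivative (\<lambda>w. (fst w, snd w, frechet_derivative h (at p) w))) (at p)"
      by (intro has_derivative_Pair smooth_on_has_derivative[OF sh p] derivative_intros)
    from frechet_derivative_at[OF this, symmetric]
    show "inj (frechet_derivative ?gr (at p))" by (simp add: inj_on_def prod_eq_iff)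
  qed (auto simp: inj_on_def prod_eq_iff)
  then have "minimal_graph S' V h" using S' sh by unfold_locales
  moreover have "openin (top_of_set S') (\<phi> ` V0)"
    by (rule openin_image_injective[OF smS' V0(1)])
       (use V0(3) d(5,6,7) in \<open>auto intro: continuous_on_subset inj_on_subset\<close>)
  then obtain W where "open W" "\<phi> ` V0 = S' \<inter> W" unfolding openin_open by auto
  moreover have "?q0 \<in> \<phi> ` V0" using V0(2) u0(2) by force
  ultimately show ?thesis using that im by auto
qed

lemma extension_param:
  assumes S': "p_minimal_surface S'" "S \<subseteq> S'" and curve: "\<And>y. y \<in> N \<Longrightarrow> Y (f y, y) \<in> S'" and y0: "y0 \<in> N"
  obtains \<eta> \<delta>' where "\<eta> > 0" "\<delta>' > 0" "\<delta>' \<le> \<delta>" "ball y0 \<eta> \<subseteq> N"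
    "local_param S' {u. snd u \<in> ball y0 \<eta> \<and> \<bar>fst u - f (snd u)\<bar> < \<delta>'} Y"
proof -
  obtain V h W where *: "minimal_graph S' V h" "open W" "Y (f y0, y0) \<in> W"
    "S' \<inter> W \<subseteq> (\<lambda>p. (fst p, snd p, h p)) ` V"
    using graph_near_boundary[OF S' y0 curve[OF y0]] by blast
  interpret G: minimal_graph S' V h by (rule *(1))
  interpret C: crossing S D X c1 c2 f N \<tau> \<delta> x1 S' V h W
    by unfold_locales (use S' curve * in auto)
  obtain \<eta> \<delta>' where e: "\<eta> > 0" "\<delta>' > 0" "\<delta>' \<le> \<delta>" "ball y0 \<eta> \<subseteq> N"
    "inj_on Y {u. snd u \<in> ball y0 \<eta> \<and> \<bar>fst u - f (snd u)\<bar> < \<delta>'}" (is "inj_on Y ?B")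
    "Y ` {u. snd u \<in> ball y0 \<eta> \<and> \<bar>fst u - f (snd u)\<bar> < \<delta>'} \<subseteq> S'"
    using C.local_extension[OF y0 *(3)] by blast
  have o: "open (UNIV \<times> ball y0 \<eta>)" by (simp add: open_Times)
  have "continuous_on (UNIV \<times> ball y0 \<eta>) (\<lambda>u. \<bar>fst u - f (snd u)\<bar>)"
    by (intro continuous_intros continuous_on_compose2[OF cont_f]) (use e(4) in auto)
  then have "open ((UNIV \<times> ball y0 \<eta>) \<inter> (\<lambda>u. \<bar>fst u - f (snd u)\<bar>) -` {..<\<delta>'})"
    by (rule continuous_open_preimage[OF _ o]) auto
  moreover have "?B = (UNIV \<times> ball y0 \<eta>) \<inter> (\<lambda>u. \<bar>fst u - f (snd u)\<bar>) -` {..<\<delta>'}" by auto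
  ultimately have oB: "open ?B" by simp
  have BN: "?B \<subseteq> UNIV \<times> N" using e(4) by auto
  have "local_param S' ?B Y"
  proof (rule local_param_injective_immersion[OF _ oB smooth_on_subset[OF smooth_Y BN] e(5,6)])
    show "inj (frechet_derivative Y (at u))" if "u \<in> ?B" for u
      by (rule Y_immersion) (use that BN in auto)
  qed (use S' in \<open>simp add: p_minimal_surface_def\<close>)
  then show ?thesis using that e by blast
qed

end

section \<open>The other side of the singular curve\<close>

text \<open>The hypothesis \<open>small\<close> keeps the strip away from the second zero of the
  denominator. The clauses on tangent spaces record that the boundary point is singular in
  \<open>S'\<close> and the new half is regular; they later keep the new half disjoint from the
  whole curve.\<close>

lemma (in collar) other_half:
  assumes S': "p_minimal_surface S'" "S \<subseteq> S'" and curve: "\<And>y. y \<in> N \<Longrightarrow> Y (f y, y) \<in> S'" and y0: "y0 \<in> N"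
    and small: "\<And>y. y \<in> N \<Longrightarrow> \<delta> \<le> \<bar>f y + c1 y\<bar>"
  obtains D' W where "general_type_coords S' D' Y c1 c2"
    "\<And>u. u \<in> D' \<Longrightarrow> snd u \<in> N \<and> 0 < - \<tau> * (fst u - f (snd u)) \<and> - \<tau> * (fst u - f (snd u)) < \<delta>"
    "open W" "Y (f y0, y0) \<in> W" "Y (f y0, y0) \<in> closure (Y ` D')" "Y ` D' \<subseteq> W"
    "S' \<inter> W \<subseteq> S \<union> (\<lambda>y. Y (f y, y)) ` N \<union> Y ` D'"
    "tangent_space S' (Y (f y0, y0)) \<subseteq> contact_plane (Y (f y0, y0))"
    "\<And>u. u \<in> D' \<Longrightarrow> \<not> tangent_space S' (Y u) \<subseteq> contact_plane (Y u)"
proof -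
  let ?q0 = "Y (f y0, y0)"
  have smS': "smooth_surface S'" using S' by (simp add: p_minimal_surface_def)
  obtain \<eta> \<delta>' where e: "\<eta> > 0" "\<delta>' > 0" "\<delta>' \<le> \<delta>" "ball y0 \<eta> \<subseteq> N"
    and lpB: "local_param S' {u. snd u \<in> ball y0 \<eta> \<and> \<bar>fst u - f (snd u)\<bar> < \<delta>'} Y" (is "local_param S' ?B Y")
    using extension_param[OF S' curve y0] by blast
  define D' where "D' = {u. snd u \<in> ball y0 \<eta> \<and> - \<tau> * (fst u - f (snd u)) \<in> {0<..<\<delta>'}}"
  have D'B: "D' \<subseteq> ?B" using \<tau> by (auto simp: D'_def)
  have D'N: "D' \<subseteq> UNIV \<times> N" using e(4) by (auto simp: D'_def)
  have cf: "continuous_on (UNIV \<times> ball y0 \<eta>) (\<lambda>u. f (snd u))"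
    by (rule continuous_on_compose2[OF cont_f]) (use e(4) in \<open>auto intro: continuous_intros\<close>)
  have "open ((UNIV \<times> ball y0 \<eta>) \<inter> (\<lambda>u. - \<tau> * (fst u - f (snd u))) -` {0<..<\<delta>'})"
    by (rule continuous_open_preimage) (intro continuous_intros cf open_Times open_UNIV open_ball open_greaterThanLessThan)+
  moreover have "D' = (UNIV \<times> ball y0 \<eta>) \<inter> (\<lambda>u. - \<tau> * (fst u - f (snd u))) -` {0<..<\<delta>'}"
    by (auto simp: D'_def)
  ultimately have oD': "open D'" by simp
  have lp: "local_param S' D' Y" by (rule local_param_subset[OF smS' lpB oD' D'B])
  have D'f: "snd u \<in> N" "0 < - \<tau> * (fst u - f (snd u))" "- \<tau> * (fst u - f (snd u)) < \<delta>" if "u \<in> D'" for u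
    using that e by (auto simp: D'_def)
  have den: "(fst u + c1 (snd u))\<^sup>2 + c2 (snd u) \<noteq> 0" if u: "u \<in> D'" for u
  proof -
    note y = D'f(1)[OF u]
    define t \<rho> where "t = - \<tau> * (fst u - f (snd u))" and "\<rho> = f (snd u) + c1 (snd u)"
    have t: "0 < t" "t < \<delta>" using D'f(2,3)[OF u] by (auto simp: t_def)
    have e: "fst u + c1 (snd u) = \<rho> - \<tau> * t" using \<tau> by (auto simp: t_def \<rho>_def)
    have "\<rho>\<^sup>2 + c2 (snd u) = 0" using f_root(1)[OF y] by (simp add: \<rho>_def)
    then have "(fst u + c1 (snd u))\<^sup>2 + c2 (snd u) = (\<rho> - \<tau> * t)\<^sup>2 - \<rho>\<^sup>2"
      unfolding e by simp
    \<comment> \<open>The zeros of the denominator are \<open>2 * \<bar>\<rho>\<bar>\<close> apart;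
      since \<open>t < \<delta>\<close> and \<open>\<delta> \<le> \<bar>\<rho>\<bar>\<close>, the
      second factor cannot vanish.\<close>
    also have "\<dots> = t * (t - 2 * \<tau> * \<rho>)" using \<tau> by (auto simp: power2_eq_square algebra_simps)
    finally show ?thesis using t small[OF y] \<tau> by (auto simp: \<rho>_def)
  qed
  have Q0: "Q u \<noteq> 0" if u: "u \<in> D'" for u
    using den[OF u] m_Q_eq(2)[OF D'f(1)[OF u], of "fst u"] m_Q_eq(3)[OF D'f(1)[OF u]] by simp
  have lim: "((\<lambda>t. (f y0 - \<tau> * t, y0)) \<longlongrightarrow> (f y0, y0)) (at_right 0)" by (auto intro!: tendsto_eq_intros)
  have ev: "\<forall>\<^sub>F t in at_right 0. (f y0 - \<tau> * t, y0) \<in> D'"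
    unfolding eventually_at_right_field
    by (rule exI[of _ \<delta>']) (use \<tau> e in \<open>auto simp: D'_def\<close>)
  have "D' \<noteq> {}" using eventually_happens[OF ev] trivial_limit_at_right_real by blast
  have "connected D'"
  proof -
    let ?R = "{t. 0 < - \<tau> * t \<and> - \<tau> * t < \<delta>'} \<times> ball y0 \<eta>"
    let ?s = "\<lambda>u. (f (snd u) + fst u, snd u)"
    have "{t. 0 < - \<tau> * t \<and> - \<tau> * t < \<delta>'} = (if \<tau> = 1 then {-\<delta>'<..<0} else {0<..<\<delta>'})"
      using \<tau> by auto
    then have "convex ?R" by (auto intro: convex_Times convex_real_interval)
    then have R: "connected ?R" by (rule convex_connected)
    have c: "continuous_on ?R ?s"
      by (intro continuous_intros continuous_on_subset[OF cf]) auto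
    have im: "?s ` ?R = D'"
    proof
      show "D' \<subseteq> ?s ` ?R"
      proof
        fix u assume "u \<in> D'"
        then show "u \<in> ?s ` ?R"
          by (intro image_eqI[of _ _ "(fst u - f (snd u), snd u)"]) (auto simp: D'_def)
      qed
    qed (auto simp: D'_def)
    show ?thesis using connected_continuous_image[OF c R] unfolding im .
  qed
  have cc: "characteristic_coords S' D' Y" by (rule characteristic_coords_Y(1)[OF lp D'N Q0])
  have snd_D: "snd ` D' \<subseteq> snd ` D"
  proof
    fix y assume "y \<in> snd ` D'"
    then have "y \<in> N" using D'N by auto
    then show "y \<in> snd ` D" using x1_D[of y] by force
  qed
  have gen: "general_type_coords S' D' Y c1 c2"
    unfolding general_type_coords_def compatible_coords_def
  proof (intro conjI)
    show "local_param S' D' Y" by (rule lp)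
    show "characteristic_field S' D' Y (coord_e1 Y)" using cc by (simp add: characteristic_coords_def)
    show "smooth_on (snd ` D') c1" "smooth_on (snd ` D') c2"
      using general smooth_on_subset[OF _ snd_D] by (auto simp: general_type_coords_def)
    show "\<forall>y\<in>snd ` D'. c2 y \<noteq> 0" using general snd_D unfolding general_type_coords_def by blast
    show "\<forall>(x, y)\<in>D'. (x + c1 y)\<^sup>2 + c2 y \<noteq> 0 \<and>
        alpha_function S' (Y (x, y)) (coord_e1 Y (x, y)) = (x + c1 y) / ((x + c1 y)\<^sup>2 + c2 y)"
    proof (intro ballI, clarify, intro conjI)
      fix x y assume u: "(x, y) \<in> D'"
      show 1: "(x + c1 y)\<^sup>2 + c2 y \<noteq> 0" using den[OF u] by simp
      have y: "y \<in> N" using D'f(1)[OF u] by simp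
      show "alpha_function S' (Y (x, y)) (coord_e1 Y (x, y)) = (x + c1 y) / ((x + c1 y)\<^sup>2 + c2 y)"
        using characteristic_coords_Y(2)[OF lp D'N Q0 u] m_Q_eq[OF y] by simp
    qed
  qed (use \<open>connected D'\<close> \<open>D' \<noteq> {}\<close> in auto)
  have u0B: "(f y0, y0) \<in> ?B" using e by simp
  obtain W where W: "open W" "Y ` ?B = S' \<inter> W" using local_paramD(4)[OF lpB] unfolding openin_open by auto
  have Ylim: "((\<lambda>t. Y (f y0 - \<tau> * t, y0)) \<longlongrightarrow> ?q0) (at_right 0)"
  proof (rule isCont_tendsto_compose[OF _ lim])
    show "isCont Y (f y0, y0)"
      using smooth_on_continuous_on[OF smooth_Y] y0 unfolding continuous_on_eq_continuous_at[OF open_strip] by blast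
  qed
  show ?thesis
  proof (rule that[OF gen _ W(1)])
    show "snd u \<in> N \<and> 0 < - \<tau> * (fst u - f (snd u)) \<and> - \<tau> * (fst u - f (snd u)) < \<delta>" if "u \<in> D'" for u
      using D'f[OF that] by blast
    show "?q0 \<in> W" using imageI[OF u0B, of Y] unfolding W(2) by blast
    show "?q0 \<in> closure (Y ` D')"
    proof (rule Lim_in_closed_set[OF closed_closure _ trivial_limit_at_right_real Ylim])
      show "\<forall>\<^sub>F t in at_right 0. Y (f y0 - \<tau> * t, y0) \<in> closure (Y ` D')"
        using ev by eventually_elim (rule subsetD[OF closure_subset], rule imageI)
    qed
    show "Y ` D' \<subseteq> W" using image_mono[OF D'B, of Y] unfolding W(2) by blast
    show "S' \<inter> W \<subseteq> S \<union> (\<lambda>y. Y (f y, y)) ` N \<union> Y ` D'"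
      unfolding W(2)[symmetric]
    proof (rule image_subsetI)
      fix u assume u: "u \<in> ?B"
      obtain x y where xy: "u = (x, y)" by fastforce
      have y: "y \<in> N" using u e(4) by (auto simp: xy)
      consider "0 < \<tau> * (x - f y)" | "x = f y" | "0 < - \<tau> * (x - f y)" using \<tau> by force
      then show "Y u \<in> S \<union> (\<lambda>y. Y (f y, y)) ` N \<union> Y ` D'"
      proof cases
        case 1
        then have "u \<in> K" using u y \<tau> e(3) by (auto simp: K_def xy)
        then have "X u \<in> S" using K_subset X.paramD(5) by blast
        then show ?thesis using X_eq_Y(1)[OF \<open>u \<in> K\<close>] by simp
      next
        case 3
        then have "u \<in> D'" using u \<tau> by (auto simp: D'_def xy)
        then show ?thesis by blast
      qed (use y xy in auto)
    qed
    show "tangent_space S' ?q0 \<subseteq> contact_plane ?q0"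
    proof -
      have "frechet_derivative Y (at (f y0, y0)) = (\<lambda>w. fst w *\<^sub>R v y0 + snd w *\<^sub>R Yy (f y0, y0))"
        using frechet_derivative_at[OF has_derivative_Y[of "(f y0, y0)"]] y0 by simp
      moreover have "contact_form ?q0 (v y0) = 0" "contact_form ?q0 (Yy (f y0, y0)) = 0"
        using contact_Y_v[of "(f y0, y0)"] Q_boundary[OF y0] y0 by (simp_all add: Q_def)
      ultimately show ?thesis
        unfolding tangent_space_param[OF lpB u0B] by (auto simp: contact_plane_def)
    qed
    show "\<not> tangent_space S' (Y u) \<subseteq> contact_plane (Y u)" if u: "u \<in> D'" for u
    proof -
      have "Yy u \<in> tangent_space S' (Y u)"
        unfolding tangent_space_param[OF lp u] frechet_Y_snd[OF D'f(1)[OF u], symmetric] by blast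
      moreover have "Yy u \<notin> contact_plane (Y u)" using Q0[OF u] by (simp add: contact_plane_def Q_def)
      ultimately show ?thesis by blast
    qed
  qed
qed

section \<open>The collar at a point of the singular curve and its side\<close>

lemma collar_exists:
  assumes S: "p_minimal_surface S" and gen: "general_type_coords S D X c1 c2"
    and c2: "\<And>y. y \<in> snd ` D \<Longrightarrow> c2 y < 0" and s: "s = 1 \<or> s = -1"
    and I: "open I" "y0 \<in> I" and bd: "bounded_by_graph_at D (sing_root s c1 c2) y0"
  obtains N \<tau> \<delta> x1 where "collar S D X c1 c2 (sing_root s c1 c2) N \<tau> \<delta> x1" "y0 \<in> N" "N \<subseteq> I"
    "N \<subseteq> snd ` D" "\<And>y. y \<in> N \<Longrightarrow> \<delta> \<le> sqrt (- c2 y)"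
proof -
  let ?f = "sing_root s c1 c2"
  interpret X: minimal_coords S D X by (rule general_type_minimal_coords[OF S gen])
  obtain \<epsilon> \<tau> where \<epsilon>: "\<epsilon> > 0" and \<tau>: "\<tau> = 1 \<or> \<tau> = (-1::real)"
    and side: "\<And>x y. (x, y) \<in> ball (?f y0, y0) \<epsilon> \<Longrightarrow> (x, y) \<in> D \<longleftrightarrow> 0 < \<tau> * (x - ?f y)"
  proof -
    obtain \<epsilon> where "\<epsilon> > 0" and *: "(\<forall>(x, y)\<in>ball (?f y0, y0) \<epsilon>. (x, y) \<in> D \<longleftrightarrow> x > ?f y) \<or>
      (\<forall>(x, y)\<in>ball (?f y0, y0) \<epsilon>. (x, y) \<in> D \<longleftrightarrow> x < ?f y)"
      using bd unfolding bounded_by_graph_at_def by blast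
    from * show ?thesis
    proof
      assume "\<forall>(x, y)\<in>ball (?f y0, y0) \<epsilon>. (x, y) \<in> D \<longleftrightarrow> x > ?f y"
      then show ?thesis using that[of \<epsilon> 1] \<open>\<epsilon> > 0\<close> by fastforce
    next
      assume "\<forall>(x, y)\<in>ball (?f y0, y0) \<epsilon>. (x, y) \<in> D \<longleftrightarrow> x < ?f y"
      then show ?thesis using that[of \<epsilon> "-1"] \<open>\<epsilon> > 0\<close> by fastforce
    qed
  qed
  have oD: "open (snd ` D)" using X.paramD(1) by (rule open_image_snd)
  have y0D: "y0 \<in> snd ` D"
  proof -
    have "(?f y0 + \<tau> * (\<epsilon> / 2), y0) \<in> D"
      using side[of "?f y0 + \<tau> * (\<epsilon> / 2)" y0] \<tau> \<epsilon> by (auto simp: dist_Pair_Pair dist_real_def)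
    then show ?thesis by force
  qed
  have cc: "continuous_on (snd ` D) c1" "continuous_on (snd ` D) c2"
    using gen by (auto simp: general_type_coords_def intro: smooth_on_continuous_on)
  have cR: "continuous_on (snd ` D) (\<lambda>y. sqrt (- c2 y))" by (intro continuous_intros cc)
  have cf: "continuous_on (snd ` D) ?f" unfolding sing_root_def by (intro continuous_intros cc)
  \<comment> \<open>Half the distance between the two zeros at \<open>y0\<close>. On
    \<open>?N\<close> the corresponding quantity changes by less than \<open>R / 2\<close>, so a
    \<delta> of at most \<open>R / 2\<close> stays below \<open>sqrt (- c2 y)\<close>.\<close>
  define R where "R = sqrt (- c2 y0)"
  have R: "R > 0" using c2[OF y0D] by (simp add: R_def)
  define \<delta> where "\<delta> = min (\<epsilon> / 4) (R / 2)"
  have \<delta>: "\<delta> > 0" using \<epsilon> R by (simp add: \<delta>_def)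
  have "isCont ?f y0" "isCont (\<lambda>y. sqrt (- c2 y)) y0"
    using cf cR y0D unfolding continuous_on_eq_continuous_at[OF oD] by blast+
  then obtain e1 e2 where e1: "e1 > 0" "\<And>y. dist y y0 < e1 \<Longrightarrow> dist (?f y) (?f y0) < \<delta> / 2"
    and e2: "e2 > 0" "\<And>y. dist y y0 < e2 \<Longrightarrow> dist (sqrt (- c2 y)) R < R / 2"
    unfolding continuous_at_eps_delta R_def[symmetric] using \<delta> R
    by (metis half_gt_zero)
  have "open (I \<inter> snd ` D)" "y0 \<in> I \<inter> snd ` D" using I oD y0D by auto
  then obtain e3 where e3: "e3 > 0" "ball y0 e3 \<subseteq> I \<inter> snd ` D" using open_contains_ball by metis
  define e where "e = min (min e1 e2) (min e3 (\<epsilon> / 4))"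
  let ?N = "ball y0 e"
  have N: "?N \<subseteq> I" "?N \<subseteq> snd ` D" using e3(2) by (auto simp: e_def)
  have fN: "\<bar>?f y - ?f y0\<bar> < \<delta> / 2" if "y \<in> ?N" for y
    using e1(2)[of y] that by (simp add: e_def dist_real_def abs_minus_commute)
  show ?thesis
  proof (rule that)
    show "collar S D X c1 c2 ?f ?N \<tau> \<delta> (?f y0 + \<tau> * (\<delta> / 2))"
    proof
      show "continuous_on ?N ?f" by (rule continuous_on_subset[OF cf N(2)])
      show "(x, y) \<in> D \<longleftrightarrow> 0 < \<tau> * (x - ?f y)" if y: "y \<in> ?N" and x: "\<bar>x - ?f y\<bar> < \<delta>" for x y
      proof (rule side)
        have 1: "\<bar>y - y0\<bar> < \<epsilon> / 4" using y by (simp add: e_def dist_real_def abs_minus_commute)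
        have "dist (?f y0, y0) (x, y) \<le> \<bar>x - ?f y0\<bar> + \<bar>y - y0\<bar>"
          using sqrt_sum_squares_le_sum_abs[of "?f y0 - x" "y0 - y"]
          by (simp add: dist_Pair_Pair dist_real_def abs_minus_commute power2_commute)
        also have "\<dots> < \<epsilon>"
        proof -
          have "\<delta> \<le> \<epsilon> / 4" by (simp add: \<delta>_def)
          moreover have "\<bar>x - ?f y0\<bar> \<le> \<bar>x - ?f y\<bar> + \<bar>?f y - ?f y0\<bar>" by simp
          ultimately show ?thesis using 1 fN[OF y] x \<epsilon> by argo
        qed
        finally show "(x, y) \<in> ball (?f y0, y0) \<epsilon>" by simp
      qed
      show "0 < \<tau> * (?f y0 + \<tau> * (\<delta> / 2) - ?f y) \<and> \<tau> * (?f y0 + \<tau> * (\<delta> / 2) - ?f y) < \<delta>"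
        if "y \<in> ?N" for y
        using fN[OF that] \<tau> \<delta> by (auto simp: abs_if split: if_splits)
      fix y assume "y \<in> ?N"
      then have "c2 y < 0" using c2 N by blast
      then show "(?f y + c1 y)\<^sup>2 + c2 y = 0" "?f y + c1 y \<noteq> 0"
        using s by (auto simp: sing_root_def)
    qed (use S gen \<tau> \<delta> in auto)
    show "y0 \<in> ?N" using e1 e2 e3 \<epsilon> by (simp add: e_def)
    show "\<delta> \<le> sqrt (- c2 y)" if "y \<in> ?N" for y
    proof -
      have "\<delta> \<le> R / 2" by (simp add: \<delta>_def)
      moreover have "\<bar>sqrt (- c2 y) - R\<bar> < R / 2"
        using e2(2)[of y] that by (simp add: e_def dist_real_def abs_minus_commute)
      ultimately show ?thesis by argo
    qed
  qed (use N in auto)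
qed

text \<open>Both directions of the theorem are treated at once: \<epsilon> is the sign of the
  denominator on \<open>D\<close>, 1 for type II and \<open>-1\<close> for type III. The formula
  \<open>x = sing_root s c1 c2 y - \<epsilon> * s * t\<close> describes the inner side of the root
  for \<open>\<epsilon> = 1\<close> and the outer side for \<open>\<epsilon> = -1\<close>.\<close>

lemma other_half_exists:
  assumes S: "p_minimal_surface S" and gen: "general_type_coords S D X c1 c2"
    and c2: "\<And>y. y \<in> snd ` D \<Longrightarrow> c2 y < 0" and s: "s = 1 \<or> s = -1"
    and I: "open I" "y0 \<in> I" and bd: "bounded_by_graph_at D (sing_root s c1 c2) y0"
    and \<sigma>: "\<And>y. y \<in> I \<Longrightarrow> (X \<longlongrightarrow> \<sigma> y) (at (sing_root s c1 c2 y, y) within D)"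
    and S': "p_minimal_surface S'" "S \<subseteq> S'" "\<sigma> ` I \<subseteq> S'"
    and \<epsilon>: "\<epsilon> = 1 \<or> \<epsilon> = -1" and sgn: "\<And>x y. (x, y) \<in> D \<Longrightarrow> 0 < \<epsilon> * ((x + c1 y)\<^sup>2 + c2 y)"
  shows "\<exists>D' Y W. general_type_coords S' D' Y c1 c2 \<and>
    (\<forall>(x, y)\<in>D'. c2 y < 0 \<and> (\<exists>t. 0 < t \<and> t < sqrt (- c2 y) \<and> x = sing_root s c1 c2 y - \<epsilon> * s * t)) \<and>
    open W \<and> \<sigma> y0 \<in> W \<and> \<sigma> y0 \<in> closure (Y ` D') \<and> Y ` D' \<subseteq> W \<and> S' \<inter> W \<subseteq> S \<union> \<sigma> ` I \<union> Y ` D' \<and>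
    tangent_space S' (\<sigma> y0) \<subseteq> contact_plane (\<sigma> y0) \<and>
    (\<forall>u\<in>D'. \<not> tangent_space S' (Y u) \<subseteq> contact_plane (Y u))"
proof -
  let ?f = "sing_root s c1 c2"
  obtain N \<tau> \<delta> x1 where c: "collar S D X c1 c2 ?f N \<tau> \<delta> x1" and N: "y0 \<in> N" "N \<subseteq> I" "N \<subseteq> snd ` D"
    and small: "\<And>y. y \<in> N \<Longrightarrow> \<delta> \<le> sqrt (- c2 y)"
    using collar_exists[OF S gen c2 s I bd] by blast
  interpret collar S D X c1 c2 ?f N \<tau> \<delta> x1 by (rule c)
  have Y\<sigma>: "Y (?f y, y) = \<sigma> y" if "y \<in> N" for y
    using boundary_value[OF that \<sigma>] N that by blast
  have neg: "c2 y < 0" if "y \<in> N" for y using c2 N that by blast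
  have root: "\<bar>?f y + c1 y\<bar> = sqrt (- c2 y)" if "y \<in> N" for y
    using s neg[OF that] by (auto simp: sing_root_def)
  \<comment> \<open>The sign of the denominator decides on which side of the root \<open>D\<close>
    lies: on the wrong side, a point at small distance \<open>t\<close> has denominator
    \<open>t * (t - 2 * \<epsilon> * R)\<close>, of sign opposite to \<epsilon>.\<close>
  have \<tau>s: "\<tau> = \<epsilon> * s"
  proof (rule ccontr)
    assume "\<tau> \<noteq> \<epsilon> * s"
    then have \<tau>': "s * \<tau> = - \<epsilon>" using \<tau> s \<epsilon> by auto
    define R t where "R = sqrt (- c2 y0)" and "t = \<delta> / 2"
    have t: "0 < t" "t < \<delta>" "t < R" using \<delta> small[OF N(1)] by (auto simp: t_def R_def)
    have R2: "R\<^sup>2 = - c2 y0" using neg[OF N(1)] by (simp add: R_def)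
    have "(?f y0 + \<tau> * t, y0) \<in> D"
      using side[OF N(1), of "?f y0 + \<tau> * t"] \<tau> t by auto
    from sgn[OF this] have "0 < \<epsilon> * ((s * R + \<tau> * t)\<^sup>2 - R\<^sup>2)"
      by (simp add: sing_root_def R_def[symmetric] R2)
    also have "(s * R + \<tau> * t)\<^sup>2 - R\<^sup>2 = (s * s - 1) * R\<^sup>2 + 2 * (s * \<tau>) * R * t + (\<tau> * \<tau>) * t\<^sup>2"
      by (simp add: power2_eq_square algebra_simps)
    also have "\<dots> = t * (t - 2 * \<epsilon> * R)" using \<tau>' \<tau> s by (auto simp: power2_eq_square algebra_simps)
    finally have "0 < t * (\<epsilon> * (t - 2 * \<epsilon> * R))" by (simp add: mult.left_commute)
    then have "0 < \<epsilon> * (t - 2 * \<epsilon> * R)" using t(1) by (simp add: zero_less_mult_iff)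
    then show False using \<epsilon> t by auto
  qed
  obtain D' W where *: "general_type_coords S' D' Y c1 c2"
    "\<And>u. u \<in> D' \<Longrightarrow> snd u \<in> N \<and> 0 < - \<tau> * (fst u - ?f (snd u)) \<and> - \<tau> * (fst u - ?f (snd u)) < \<delta>"
    "open W" "Y (?f y0, y0) \<in> W" "Y (?f y0, y0) \<in> closure (Y ` D')" "Y ` D' \<subseteq> W"
    "S' \<inter> W \<subseteq> S \<union> (\<lambda>y. Y (?f y, y)) ` N \<union> Y ` D'"
    "tangent_space S' (Y (?f y0, y0)) \<subseteq> contact_plane (Y (?f y0, y0))"
    "\<And>u. u \<in> D' \<Longrightarrow> \<not> tangent_space S' (Y u) \<subseteq> contact_plane (Y u)"
  proof (rule other_half[OF S'(1,2) _ N(1)])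
    show "Y (?f y, y) \<in> S'" if "y \<in> N" for y using Y\<sigma>[OF that] S'(3) N that by auto
    show "\<delta> \<le> \<bar>?f y + c1 y\<bar>" if "y \<in> N" for y using small[OF that] root[OF that] by simp
  qed blast
  have pts: "\<forall>(x, y)\<in>D'. c2 y < 0 \<and> (\<exists>t. 0 < t \<and> t < sqrt (- c2 y) \<and> x = ?f y - \<epsilon> * s * t)"
  proof (clarify, intro conjI)
    fix x y assume u: "(x, y) \<in> D'"
    have y: "y \<in> N" and t: "0 < - \<tau> * (x - ?f y)" "- \<tau> * (x - ?f y) < \<delta>" using *(2)[OF u] by auto
    show "c2 y < 0" by (rule neg[OF y])
    show "\<exists>t. 0 < t \<and> t < sqrt (- c2 y) \<and> x = ?f y - \<epsilon> * s * t"
      by (rule exI[of _ "- \<tau> * (x - ?f y)"]) (use t small[OF y] \<tau> \<tau>s[symmetric] in auto)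
  qed
  have "(\<lambda>y. Y (?f y, y)) ` N \<subseteq> \<sigma> ` I" using Y\<sigma> N by auto
  then have W': "S' \<inter> W \<subseteq> S \<union> \<sigma> ` I \<union> Y ` D'" using *(7) by blast
  show ?thesis
    by (rule exI[of _ D'], rule exI[of _ Y], rule exI[of _ W])
       (use *(1,3,4,5,6,8,9) pts W' in \<open>unfold Y\<sigma>[OF N(1)], blast\<close>)
qed

text \<open>\<open>W\<close> is the union of the local neighbourhoods, and the other side becomes
  the union \<open>H\<close> of the half strips. \<open>other_side\<close> removes all of
  \<open>S\<close> and of the curve, so \<open>H\<close> must avoid them globally: a point of
  \<open>H\<close> in \<open>S\<close> would carry denominators of both signs, and a point of
  \<open>H\<close> on the curve would be regular and singular at once.\<close>

lemma other_side_opposite_sign: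
  assumes S: "p_minimal_surface S" and gen: "general_type_coords S D X c1 c2"
    and c2: "\<And>y. y \<in> snd ` D \<Longrightarrow> c2 y < 0" and s: "s = 1 \<or> s = -1"
    and I: "open I" "I \<noteq> {}" and bd: "\<And>y. y \<in> I \<Longrightarrow> bounded_by_graph_at D (sing_root s c1 c2) y"
    and \<sigma>: "\<And>y. y \<in> I \<Longrightarrow> (X \<longlongrightarrow> \<sigma> y) (at (sing_root s c1 c2 y, y) within D)"
    and S': "p_minimal_surface S'" "S \<subseteq> S'" "\<sigma> ` I \<subseteq> S'"
    and \<epsilon>: "\<epsilon> = 1 \<or> \<epsilon> = -1"
    and sgn: "\<And>p. p \<in> S \<Longrightarrow> \<exists>D X c1 c2. general_type_coords S D X c1 c2 \<and> p \<in> X ` D \<and>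
      (\<forall>(x, y)\<in>D. 0 < \<epsilon> * ((x + c1 y)\<^sup>2 + c2 y))"
  obtains W where "open W" "\<sigma> ` I \<subseteq> W" "\<sigma> ` I \<subseteq> closure (other_side S (\<sigma> ` I) S' W)"
    "p_minimal_surface (other_side S (\<sigma> ` I) S' W)" "other_side S (\<sigma> ` I) S' W \<noteq> {}"
    "\<forall>p\<in>other_side S (\<sigma> ` I) S' W. regular_point (other_side S (\<sigma> ` I) S' W) p \<and>
       (\<exists>D' Y. general_type_coords (other_side S (\<sigma> ` I) S' W) D' Y c1 c2 \<and> p \<in> Y ` D' \<and>
       (\<forall>(x, y)\<in>D'. c2 y < 0 \<and>
          (\<exists>t. 0 < t \<and> t < sqrt (- c2 y) \<and> x = sing_root s c1 c2 y - \<epsilon> * s * t)))"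
proof -
  let ?f = "sing_root s c1 c2" and ?C = "\<sigma> ` I"
  have smS: "smooth_surface S" and smS': "smooth_surface S'"
    using S S' by (auto simp: p_minimal_surface_def)
  have oS: "openin (top_of_set S') S" by (rule openin_subsurface[OF smS smS' S'(2)])
  \<comment> \<open>The chart at the curve need not be among those that give \<open>S\<close> its
    type; uniqueness of the denominator transfers the sign to it.\<close>
  have sgnD: "0 < \<epsilon> * ((x + c1 y)\<^sup>2 + c2 y)" if u: "(x, y) \<in> D" for x y
  proof -
    have "X (x, y) \<in> S"
      using gen u local_paramD(5) by (fastforce simp: general_type_coords_def compatible_coords_def)
    then obtain D1 X1 d1 d2 where g1: "general_type_coords S D1 X1 d1 d2" and p: "X (x, y) \<in> X1 ` D1"
      and sg: "\<forall>(x, y)\<in>D1. 0 < \<epsilon> * ((x + d1 y)\<^sup>2 + d2 y)" using sgn by meson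
    obtain x' y' where u': "(x', y') \<in> D1" "X (x, y) = X1 (x', y')" using p by auto
    have "(x + c1 y)\<^sup>2 + c2 y = (x' + d1 y')\<^sup>2 + d2 y'"
      by (rule general_type_denominator_unique[OF S gen g1 u u'])
    then show ?thesis using sg u'(1) by auto
  qed
  define pr where "pr y0 D' Y W \<longleftrightarrow> general_type_coords S' D' Y c1 c2 \<and>
    (\<forall>(x, y)\<in>D'. c2 y < 0 \<and> (\<exists>t. 0 < t \<and> t < sqrt (- c2 y) \<and> x = ?f y - \<epsilon> * s * t)) \<and>
    open W \<and> \<sigma> y0 \<in> W \<and> \<sigma> y0 \<in> closure (Y ` D') \<and> Y ` D' \<subseteq> W \<and> S' \<inter> W \<subseteq> S \<union> ?C \<union> Y ` D' \<and>
    tangent_space S' (\<sigma> y0) \<subseteq> contact_plane (\<sigma> y0) \<and>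
    (\<forall>u\<in>D'. \<not> tangent_space S' (Y u) \<subseteq> contact_plane (Y u))"
    for y0 and D' :: "(real \<times> real) set" and Y :: "real \<times> real \<Rightarrow> heis" and W
  have "\<exists>D' Y W. pr y0 D' Y W" if "y0 \<in> I" for y0
    unfolding pr_def
    using other_half_exists[OF S gen c2 s I(1) that bd[OF that] \<sigma> S' \<epsilon> sgnD] .
  then obtain DD YY WW where pr: "\<And>y. y \<in> I \<Longrightarrow> pr y (DD y) (YY y) (WW y)" by metis
  define W where "W = (\<Union>y\<in>I. WW y)"
  define H where "H = (\<Union>y\<in>I. YY y ` DD y)"
  have lp: "local_param S' (DD y) (YY y)" if "y \<in> I" for y
    using pr[OF that] by (simp add: pr_def general_type_coords_def compatible_coords_def)
  have HS': "YY y ` DD y \<subseteq> S'" if "y \<in> I" for y using local_paramD(5)[OF lp[OF that]] .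
  have HS: "YY y u \<notin> S" if y: "y \<in> I" and u: "u \<in> DD y" for y u
  proof
    assume "YY y u \<in> S"
    then obtain D1 X1 d1 d2 where g1: "general_type_coords S D1 X1 d1 d2" and p: "YY y u \<in> X1 ` D1"
      and sg: "\<forall>(x, y)\<in>D1. 0 < \<epsilon> * ((x + d1 y)\<^sup>2 + d2 y)" using sgn by meson
    obtain x' y' where u': "(x', y') \<in> D1" "YY y u = X1 (x', y')" using p by auto
    obtain x z where xz: "u = (x, z)" by fastforce
    have "local_param S D1 X1" using g1 by (simp add: general_type_coords_def compatible_coords_def)
    from general_type_coords_open_part[OF smS' oS this] g1
    have g1': "general_type_coords S' D1 X1 d1 d2" by simp
    have g: "general_type_coords S' (DD y) (YY y) c1 c2" using pr[OF y] by (simp add: pr_def)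
    have "(x + c1 z)\<^sup>2 + c2 z = (x' + d1 y')\<^sup>2 + d2 y'"
      by (rule general_type_denominator_unique[OF S'(1) g g1' _ u'(1)]) (use u u'(2) xz in auto)
    then have pos: "0 < \<epsilon> * ((x + c1 z)\<^sup>2 + c2 z)" using sg u'(1) by auto
    define R where "R = sqrt (- c2 z)"
    obtain t where t: "c2 z < 0" "0 < t" "t < R" "x = ?f z - \<epsilon> * s * t"
      using pr[OF y] u by (auto simp: pr_def xz R_def)
    have R2: "R\<^sup>2 = - c2 z" using t(1) by (simp add: R_def)
    have "x + c1 z = s * (R - \<epsilon> * t)" by (simp add: t(4) sing_root_def R_def algebra_simps)
    then have "(x + c1 z)\<^sup>2 + c2 z = (R - \<epsilon> * t)\<^sup>2 - R\<^sup>2" using s R2 by (auto simp: power2_commute)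
    also have "\<dots> = t * (t - 2 * \<epsilon> * R)" using \<epsilon> by (auto simp: power2_eq_square algebra_simps)
    finally have "0 < t * (\<epsilon> * (t - 2 * \<epsilon> * R))" using pos by (simp add: mult.left_commute)
    then have "0 < \<epsilon> * (t - 2 * \<epsilon> * R)" using t(2) by (simp add: zero_less_mult_iff)
    then show False using \<epsilon> t by auto
  qed
  have HC: "YY y u \<notin> ?C" if y: "y \<in> I" and u: "u \<in> DD y" for y u
  proof
    assume "YY y u \<in> ?C"
    then obtain z where z: "z \<in> I" "YY y u = \<sigma> z" by auto
    have "tangent_space S' (\<sigma> z) \<subseteq> contact_plane (\<sigma> z)" using pr[OF z(1)] by (simp add: pr_def)
    moreover have "\<not> tangent_space S' (YY y u) \<subseteq> contact_plane (YY y u)"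
      using pr[OF y] u unfolding pr_def by blast
    ultimately show False using z(2) by simp
  qed
  have other: "other_side S ?C S' W = H"
  proof
    show "other_side S ?C S' W \<subseteq> H"
    proof
      fix p assume p: "p \<in> other_side S ?C S' W"
      then obtain y where y: "y \<in> I" "p \<in> WW y" by (auto simp: other_side_def W_def)
      have "S' \<inter> WW y \<subseteq> S \<union> ?C \<union> YY y ` DD y" using pr[OF y(1)] by (simp add: pr_def)
      then have "p \<in> YY y ` DD y" using p y(2) by (auto simp: other_side_def)
      then show "p \<in> H" using y(1) unfolding H_def by blast
    qed
    show "H \<subseteq> other_side S ?C S' W"
    proof
      fix p assume "p \<in> H"
      then obtain y u where yu: "y \<in> I" "u \<in> DD y" "p = YY y u" by (auto simp: H_def)
      have "YY y ` DD y \<subseteq> WW y" using pr[OF yu(1)] by (simp add: pr_def)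
      then have "p \<in> W" using yu by (auto simp: W_def)
      then show "p \<in> other_side S ?C S' W"
        using HS[OF yu(1,2)] HC[OF yu(1,2)] HS'[OF yu(1)] yu by (auto simp: other_side_def)
    qed
  qed
  have oH: "openin (top_of_set S') H"
    unfolding H_def by (rule openin_Union) (use local_paramD(4)[OF lp] in auto)
  have minH: "p_minimal_surface H" by (rule p_minimal_surface_open_part[OF smS' oH S'(1)])
  have smH: "smooth_surface H" using minH by (simp add: p_minimal_surface_def)
  have clo: "?C \<subseteq> closure H"
  proof (rule image_subsetI)
    fix y assume y: "y \<in> I"
    have "\<sigma> y \<in> closure (YY y ` DD y)" using pr[OF y] by (simp add: pr_def)
    moreover have "YY y ` DD y \<subseteq> H" using y by (auto simp: H_def)
    ultimately show "\<sigma> y \<in> closure H" using closure_mono by blast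
  qed
  have charts: "regular_point H p \<and> (\<exists>D' Y. general_type_coords H D' Y c1 c2 \<and> p \<in> Y ` D' \<and>
       (\<forall>(x, y)\<in>D'. c2 y < 0 \<and> (\<exists>t. 0 < t \<and> t < sqrt (- c2 y) \<and> x = ?f y - \<epsilon> * s * t)))"
    if p: "p \<in> H" for p
  proof -
    obtain y u where yu: "y \<in> I" "u \<in> DD y" "p = YY y u" using p unfolding H_def by blast
    note l = local_paramD[OF lp[OF yu(1)]]
    have "local_param H (DD y) (YY y)"
      by (rule local_param_injective_immersion[OF smH l(1,2,6) _ l(3)]) (use yu(1) in \<open>auto simp: H_def\<close>)
    from general_type_coords_open_part[OF smS' oH this, of c1 c2] pr[OF yu(1)]
    have g: "general_type_coords H (DD y) (YY y) c1 c2" by (simp add: pr_def)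
    then have "regular_point H p"
      using yu by (auto simp: general_type_coords_def compatible_coords_def characteristic_field_def)
    then show ?thesis using g pr[OF yu(1)] yu by (auto simp: pr_def)
  qed
  show ?thesis
  proof (rule that[of W], unfold other)
    show "open W" unfolding W_def using pr by (auto simp: pr_def)
    show "?C \<subseteq> W" unfolding W_def using pr by (auto simp: pr_def)
    show "H \<noteq> {}" using clo I(2) by auto
  qed (use clo minH charts in auto)
qed

section \<open>Sign of the denominator for the two types, and the conclusion\<close>

lemma type_II_denominator:
  assumes "type_II_coords S D X c1 c2" "(x, y) \<in> D"
  shows "0 < (x + c1 y)\<^sup>2 + c2 y"
proof -
  have "c2 y < 0" using assms by (force simp: type_II_coords_def)
  moreover have "x < - c1 y - sqrt (- c2 y) \<or> x > - c1 y + sqrt (- c2 y)"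
    using assms by (auto simp: type_II_coords_def sing_root_def)
  ultimately have "sqrt (- c2 y) < \<bar>x + c1 y\<bar>" "0 \<le> sqrt (- c2 y)" by auto
  then have "(sqrt (- c2 y))\<^sup>2 < \<bar>x + c1 y\<bar>\<^sup>2" by (rule power_strict_mono) auto
  then show ?thesis using \<open>c2 y < 0\<close> by simp
qed

lemma type_III_denominator:
  assumes "type_III_coords S D X c1 c2" "(x, y) \<in> D"
  shows "(x + c1 y)\<^sup>2 + c2 y < 0"
proof -
  have "c2 y < 0" using assms by (force simp: type_III_coords_def)
  moreover have "x > - c1 y - sqrt (- c2 y) \<and> x < - c1 y + sqrt (- c2 y)"
    using assms by (auto simp: type_III_coords_def sing_root_def)
  ultimately have "\<bar>x + c1 y\<bar> < sqrt (- c2 y)" by auto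
  then have "\<bar>x + c1 y\<bar>\<^sup>2 < (sqrt (- c2 y))\<^sup>2" by (rule power_strict_mono) auto
  then show ?thesis using \<open>c2 y < 0\<close> by simp
qed

theorem theorem1p9:
  fixes S C S' :: "heis set"
  assumes "singular_curve S C"
    and "p_minimal_extension_through S C S'"
  shows "(type_II_surface S \<longrightarrow>
            (\<exists>W. open W \<and> C \<subseteq> W \<and> C \<subseteq> closure (other_side S C S' W) \<and>
                 type_III_surface (other_side S C S' W))) \<and>
         (type_III_surface S \<longrightarrow>
            (\<exists>W. open W \<and> C \<subseteq> W \<and> C \<subseteq> closure (other_side S C S' W) \<and>
                 type_II_surface (other_side S C S' W)))"
proof -
  obtain D X c1 c2 s I \<sigma> where
    coords: "type_II_coords S D X c1 c2 \<or> type_III_coords S D X c1 c2" and s: "s = 1 \<or> s = (-1::real)"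
    and I: "open I" "I \<noteq> {}" and bd: "\<And>y. y \<in> I \<Longrightarrow> bounded_by_graph_at D (sing_root s c1 c2) y"
    and \<sigma>: "\<And>y. y \<in> I \<Longrightarrow> (X \<longlongrightarrow> \<sigma> y) (at (sing_root s c1 c2 y, y) within D)" and C: "C = \<sigma> ` I"
    using assms(1) unfolding singular_curve_def by blast
  have gen: "general_type_coords S D X c1 c2" and c2: "\<And>y. y \<in> snd ` D \<Longrightarrow> c2 y < 0"
    using coords by (auto simp: type_II_coords_def type_III_coords_def)
  have S': "p_minimal_surface S'" "S \<subseteq> S'" "\<sigma> ` I \<subseteq> S'"
    using assms(2) C by (auto simp: p_minimal_extension_through_def)
  show ?thesis
  proof (intro conjI impI)
    assume S: "type_II_surface S"
    have sgn: "\<exists>D X c1 c2. general_type_coords S D X c1 c2 \<and> p \<in> X ` D \<and>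
      (\<forall>(x, y)\<in>D. 0 < 1 * ((x + c1 y)\<^sup>2 + c2 y))" if p: "p \<in> S" for p
    proof -
      obtain D X c1 c2 where c: "type_II_coords S D X c1 c2" "p \<in> X ` D"
        using S p unfolding type_II_surface_def by blast
      have "\<forall>(x, y)\<in>D. 0 < 1 * ((x + c1 y)\<^sup>2 + c2 y)"
        using type_II_denominator[OF c(1)] by auto
      then show ?thesis using c unfolding type_II_coords_def by blast
    qed
    have pS: "p_minimal_surface S" using S by (simp add: type_II_surface_def)
    obtain W where W: "open W" "C \<subseteq> W" "C \<subseteq> closure (other_side S C S' W)"
      "p_minimal_surface (other_side S C S' W)" "other_side S C S' W \<noteq> {}"
      and charts: "\<forall>p\<in>other_side S C S' W. regular_point (other_side S C S' W) p \<and>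
       (\<exists>D' Y. general_type_coords (other_side S C S' W) D' Y c1 c2 \<and> p \<in> Y ` D' \<and>
       (\<forall>(x, y)\<in>D'. c2 y < 0 \<and> (\<exists>t. 0 < t \<and> t < sqrt (- c2 y) \<and> x = sing_root s c1 c2 y - 1 * s * t)))"
      using other_side_opposite_sign[OF pS gen c2 s I bd \<sigma> S' _ sgn] unfolding C by blast
    have "type_III_coords (other_side S C S' W) D' Y c1 c2"
      if g: "general_type_coords (other_side S C S' W) D' Y c1 c2"
        and x: "\<forall>(x, y)\<in>D'. c2 y < 0 \<and> (\<exists>t. 0 < t \<and> t < sqrt (- c2 y) \<and> x = sing_root s c1 c2 y - 1 * s * t)"
      for D' Y
      unfolding type_III_coords_def
    proof (intro conjI)
      show "\<forall>(x, y)\<in>D'. sing_root (-1) c1 c2 y < x \<and> x < sing_root 1 c1 c2 y"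
      proof clarify
        fix x' y assume "(x', y) \<in> D'"
        then obtain t where "0 < t" "t < sqrt (- c2 y)" "x' = sing_root s c1 c2 y - 1 * s * t"
          using x by blast
        then show "sing_root (-1) c1 c2 y < x' \<and> x' < sing_root 1 c1 c2 y"
          using s by (auto simp: sing_root_def)
      qed
    qed (use g x in auto)
    then have "type_III_surface (other_side S C S' W)"
      unfolding type_III_surface_def using W charts by blast
    then show "\<exists>W. open W \<and> C \<subseteq> W \<and> C \<subseteq> closure (other_side S C S' W) \<and>
        type_III_surface (other_side S C S' W)" using W by blast
  next
    assume S: "type_III_surface S"
    have sgn: "\<exists>D X c1 c2. general_type_coords S D X c1 c2 \<and> p \<in> X ` D \<and>
      (\<forall>(x, y)\<in>D. 0 < -1 * ((x + c1 y)\<^sup>2 + c2 y))" if p: "p \<in> S" for p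
    proof -
      obtain D X c1 c2 where c: "type_III_coords S D X c1 c2" "p \<in> X ` D"
        using S p unfolding type_III_surface_def by blast
      have "\<forall>(x, y)\<in>D. 0 < -1 * ((x + c1 y)\<^sup>2 + c2 y)"
      proof clarify
        fix x y assume "(x, y) \<in> D"
        from type_III_denominator[OF c(1) this] show "0 < -1 * ((x + c1 y)\<^sup>2 + c2 y)"
          by (simp only: mult_minus1 neg_0_less_iff_less)
      qed
      then show ?thesis using c unfolding type_III_coords_def by blast
    qed
    have pS: "p_minimal_surface S" using S by (simp add: type_III_surface_def)
    obtain W where W: "open W" "C \<subseteq> W" "C \<subseteq> closure (other_side S C S' W)"
      "p_minimal_surface (other_side S C S' W)" "other_side S C S' W \<noteq> {}"
      and charts: "\<forall>p\<in>other_side S C S' W. regular_point (other_side S C S' W) p \<and>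
       (\<exists>D' Y. general_type_coords (other_side S C S' W) D' Y c1 c2 \<and> p \<in> Y ` D' \<and>
       (\<forall>(x, y)\<in>D'. c2 y < 0 \<and> (\<exists>t. 0 < t \<and> t < sqrt (- c2 y) \<and> x = sing_root s c1 c2 y - -1 * s * t)))"
      using other_side_opposite_sign[OF pS gen c2 s I bd \<sigma> S' _ sgn] unfolding C by blast
    have "type_II_coords (other_side S C S' W) D' Y c1 c2"
      if g: "general_type_coords (other_side S C S' W) D' Y c1 c2"
        and x: "\<forall>(x, y)\<in>D'. c2 y < 0 \<and> (\<exists>t. 0 < t \<and> t < sqrt (- c2 y) \<and> x = sing_root s c1 c2 y - -1 * s * t)"
      for D' Y
      unfolding type_II_coords_def
    proof (intro conjI)
      \<comment> \<open>All of \<open>D'\<close> lies beyond the root through which \<open>S\<close>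
        was extended, so the sign \<open>s\<close> of that root selects the alternative.\<close>
      show "(\<forall>(x, y)\<in>D'. x < sing_root (-1) c1 c2 y) \<or> (\<forall>(x, y)\<in>D'. x > sing_root 1 c1 c2 y)"
        using s
      proof
        assume "s = 1"
        then have "\<forall>(x, y)\<in>D'. x > sing_root 1 c1 c2 y" using x by fastforce
        then show ?thesis ..
      next
        assume "s = -1"
        then have "\<forall>(x, y)\<in>D'. x < sing_root (-1) c1 c2 y" using x by fastforce
        then show ?thesis ..
      qed
    qed (use g x in auto)
    then have "type_II_surface (other_side S C S' W)"
      unfolding type_II_surface_def using W charts by blast
    then show "\<exists>W. open W \<and> C \<subseteq> W \<and> C \<subseteq> closure (other_side S C S' W) \<and>
        type_II_surface (other_side S C S' W)" using W by blast
  qed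
qed

end
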